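(* Assume that the QBD with transition matrix $P$ is not null recurrent. Define $X=[\,X_1\mid X_2\,]$ with $X_1=[\,I_m\mid L\,]$ and $X_2=K$, and $T=\mathrm{diag}(T_1,T_2)$ with $T_1=\mathrm{diag}(G,V_1^{-1})$ and $T_2=V_0$. Let $Z$ be the matrix defined by $$Z=\begin{bmatrix}Z_1\\ Z_2\end{bmatrix},\qquad Z_1=\begin{bmatrix}W\\ -EW\end{bmatrix},\qquad Z_2=-V_0FW.$$ Then the triple $(X,T,Z)$ is a resolvent triple of the matrix polynomial $\eta(\lambda)=A_{-1}+(A_0-I)\lambda+A_1\lambda^2$.
   Context: QBD process. Let $m\ge1$ be an integer and let $B,A_{-1},A_0,A_1$ be nonnegative $m\times m$ matrices such that the infinite block tridiagonal matrix $P=(P_{i,j})_{i,j\ge 0}$ with $m\times m$ blocks $P_{0,0}=B$, $P_{i,i}=A_0$ for $i\ge1$, $P_{i,i+1}=A_1$ for $i\ge 0$, $P_{i,i-1}=A_{-1}$ for $i\ge1$, and all other blocks zero, is row-stochastic. $P$ is the transition matrix of a discrete-time Markov chain (a QBD) on $\mathbb N\times\mathcal E$, $\mathcal E=\{1,\dots,m\}$; "null recurrent" refers to this chain. Standing assumptions: $P$ is irreducible; $A_{-1}+A_0+A_1$ is irreducible; and the doubly infinite QBD on $\mathbb Z\times\mathcal E$ (with transition blocks $A_{-1},A_0,A_1$ for level changes $-1,0,+1$) has only one final class $\mathbb Z\times\mathcal E_*$, with $\emptyset\ne\mathcal E_*\subseteq\mathcal E$, and every other state is on a path to the final class. $G$,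 $\widehat G$, $R$ are the minimal nonnegative solutions of $A_{-1}+(A_0-I)X+A_1X^2=0$, $A_1+(A_0-I)X+A_{-1}X^2=0$ and $A_1+X(A_0-I)+X^2A_{-1}=0$, respectively. Put $U=A_0+RA_{-1}$ (equivalently $U=A_0+A_1G$). When the QBD is not null recurrent, the series $W=\sum_{j=0}^\infty G^j(U-I)^{-1}R^j$ converges. $M$ is a nonsingular matrix such that $\widehat GM=MJ$ with $J=\mathrm{diag}(V_1,V_0)$, where $V_1$ is a nonsingular $p\times p$ matrix, $0\le p\le m$, and $V_0$ is an $(m-p)\times(m-p)$ matrix with spectral radius $0$. Write $M=[\,L\mid K\,]$ with $L$ of size $m\times p$ and $K$ of size $m\times(m-p)$, and $M^{-1}=\begin{bmatrix}E\\ F\end{bmatrix}$ with $E$ of size $p\times m$ and $F$ of size $(m-p)\times m$. Decomposable pair and resolvent triple. Let $B(\lambda)=\sum_{i=0}^{l}B_i\lambda^i$ be an $m\times m$ matrix polynomial (here $l=2$). A pair $(X,T)$, with $X$ of size $m\times ml$ and $T$ of size $ml\times ml$, is a decomposable pair for $B(\lambda)$ if: (i) $X=[\,X_1\mid X_2\,]$ and $T=\mathrm{diag}(T_1,T_2)$ where $X_1$ is $m\times q$ and $T_1$ is $q\times q$ for some $0\le q\le ml$; (ii) the block matrix with block rows $[\,X_1T_1^{i}\mid X_2T_2^{l-1-i}\,]$, $i=0,\dots,l-1$, is nonsingular; (iii) $\sum_{i=0}^lB_iX_1T_1^i=0$ and $\sum_{i=0}^lB_iX_2T_2^{l-i}=0$.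 A triple $(X,T,Z)$ is a resolvent triple of $B(\lambda)$ if $(X,T)$ is a decomposable pair of $B(\lambda)$ and $B(\lambda)^{-1}=X\,T(\lambda)^{-1}Z$ (for all $\lambda$ where the inverses exist), where $T(\lambda)=\mathrm{diag}(\lambda I-T_1,\ \lambda T_2-I)$. *)

theory Defs
  imports
    "HOL-Analysis.Infinite_Sum"
    "Jordan_Normal_Form.Matrix"
    "Jordan_Normal_Form.Gauss_Jordan_Elimination"
    "Jordan_Normal_Form.Spectral_Radius"
begin

section \<open>Countable Markov chains\<close>

text \<open>A chain is given by its state space \<open>S\<close> and its one-step transition probabilities \<open>p s t\<close>;
  values of \<open>p\<close> outside \<open>S\<close> play no role.\<close>

definition stochastic_on :: "'s set \<Rightarrow> ('s \<Rightarrow> 's \<Rightarrow> real) \<Rightarrow> bool" where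
  "stochastic_on S p \<longleftrightarrow> (\<forall>s\<in>S. (\<forall>t\<in>S. 0 \<le> p s t) \<and> (p s has_sum 1) S)"

definition transition_graph :: "'s set \<Rightarrow> ('s \<Rightarrow> 's \<Rightarrow> real) \<Rightarrow> 's rel" where
  "transition_graph S p = {(s, t). s \<in> S \<and> t \<in> S \<and> p s t > 0}"

definition irreducible_on :: "'s set \<Rightarrow> ('s \<Rightarrow> 's \<Rightarrow> real) \<Rightarrow> bool" where
  "irreducible_on S p \<longleftrightarrow> (\<forall>s\<in>S. \<forall>t\<in>S. (s, t) \<in> (transition_graph S p)\<^sup>*)"

definition final_class :: "'s set \<Rightarrow> ('s \<Rightarrow> 's \<Rightarrow> real) \<Rightarrow> 's set \<Rightarrow> bool" where
  "final_class S p C \<longleftrightarrow> C \<noteq> {} \<and> C \<subseteq> S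
     \<and> (\<forall>s\<in>C. \<forall>t\<in>C. (s, t) \<in> (transition_graph S p)\<^sup>*)
     \<and> (\<forall>s\<in>C. \<forall>t. (s, t) \<in> transition_graph S p \<longrightarrow> t \<in> C)"

text \<open>\<open>first_passage S p t n s\<close> is the probability that the chain started in \<open>s\<close> visits \<open>t\<close> at
  time \<open>n\<close> and at none of the times \<open>1, \<dots>, n - 1\<close>. In particular \<open>first_passage S p s n s\<close> is the
  distribution of the first return time to \<open>s\<close>.\<close>

fun first_passage :: "'s set \<Rightarrow> ('s \<Rightarrow> 's \<Rightarrow> real) \<Rightarrow> 's \<Rightarrow> nat \<Rightarrow> 's \<Rightarrow> real" where
  "first_passage S p t 0 s = 0"
| "first_passage S p t (Suc 0) s = p s t"
| "first_passage S p t (Suc (Suc n)) s = (\<Sum>\<^sub>\<infinity>u\<in>S - {t}. p s u * first_passage S p t (Suc n) u)"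

text \<open>Return with probability one, but with infinite mean return time.\<close>

definition null_recurrent_state :: "'s set \<Rightarrow> ('s \<Rightarrow> 's \<Rightarrow> real) \<Rightarrow> 's \<Rightarrow> bool" where
  "null_recurrent_state S p s \<longleftrightarrow> (\<lambda>n. first_passage S p s n s) sums 1
     \<and> \<not> summable (\<lambda>n. real n * first_passage S p s n s)"

definition null_recurrent_chain :: "'s set \<Rightarrow> ('s \<Rightarrow> 's \<Rightarrow> real) \<Rightarrow> bool" where
  "null_recurrent_chain S p \<longleftrightarrow> (\<forall>s\<in>S. null_recurrent_state S p s)"

section \<open>Quasi-birth-and-death processes\<close>

text \<open>States are pairs (level, phase); the \<open>m\<close> phases are numbered from \<open>0\<close>. The arguments \<open>Am\<close>,
  \<open>A0\<close>, \<open>A1\<close> are the blocks for the level changes \<open>-1\<close>, \<open>0\<close>, \<open>+1\<close>.\<close>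

definition qbd_states :: "nat \<Rightarrow> (nat \<times> nat) set" where
  "qbd_states m = UNIV \<times> {..<m}"

definition qbd_block :: "nat \<Rightarrow> real mat \<Rightarrow> real mat \<Rightarrow> real mat \<Rightarrow> real mat \<Rightarrow> nat \<Rightarrow> nat \<Rightarrow> real mat" where
  "qbd_block m B Am A0 A1 i j =
     (if i = 0 \<and> j = 0 then B
      else if j = i then A0
      else if j = i + 1 then A1
      else if i = j + 1 then Am
      else 0\<^sub>m m m)"

definition qbd_matrix ::
  "nat \<Rightarrow> real mat \<Rightarrow> real mat \<Rightarrow> real mat \<Rightarrow> real mat \<Rightarrow> nat \<times> nat \<Rightarrow> nat \<times> nat \<Rightarrow> real" where
  "qbd_matrix m B Am A0 A1 s t = qbd_block m B Am A0 A1 (fst s) (fst t) $$ (snd s, snd t)"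

definition dqbd_states :: "nat \<Rightarrow> (int \<times> nat) set" where
  "dqbd_states m = UNIV \<times> {..<m}"

definition dqbd_matrix ::
  "nat \<Rightarrow> real mat \<Rightarrow> real mat \<Rightarrow> real mat \<Rightarrow> int \<times> nat \<Rightarrow> int \<times> nat \<Rightarrow> real" where
  "dqbd_matrix m Am A0 A1 s t =
     (if fst t = fst s then A0
      else if fst t = fst s + 1 then A1
      else if fst t = fst s - 1 then Am
      else 0\<^sub>m m m) $$ (snd s, snd t)"

definition dqbd_one_final_class :: "nat \<Rightarrow> real mat \<Rightarrow> real mat \<Rightarrow> real mat \<Rightarrow> bool" where
  "dqbd_one_final_class m Am A0 A1 \<longleftrightarrow>
     (let S = dqbd_states m; q = dqbd_matrix m Am A0 A1 in
      \<exists>Es. Es \<noteq> {} \<and> Es \<subseteq> {..<m} \<and> {C. final_class S q C} = {UNIV \<times> Es}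
        \<and> (\<forall>s\<in>S - UNIV \<times> Es. \<exists>t\<in>UNIV \<times> Es. (s, t) \<in> (transition_graph S q)\<^sup>*))"

definition irreducible_matrix :: "nat \<Rightarrow> real mat \<Rightarrow> bool" where
  "irreducible_matrix m A \<longleftrightarrow> irreducible_on {..<m} (\<lambda>i j. A $$ (i, j))"

definition minimal_nonneg_solution :: "nat \<Rightarrow> (real mat \<Rightarrow> real mat) \<Rightarrow> real mat \<Rightarrow> bool" where
  "minimal_nonneg_solution m \<Phi> X \<longleftrightarrow>
     X \<in> carrier_mat m m \<and> 0\<^sub>m m m \<le> X \<and> \<Phi> X = 0\<^sub>m m m
     \<and> (\<forall>Y\<in>carrier_mat m m. 0\<^sub>m m m \<le> Y \<and> \<Phi> Y = 0\<^sub>m m m \<longrightarrow> X \<le> Y)"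

section \<open>Matrices\<close>

text \<open>Meaningful for nonsingular \<open>A\<close> only.\<close>

definition mat_inv :: "'a :: field mat \<Rightarrow> 'a mat" where
  "mat_inv A = the (mat_inverse A)"

definition append_cols :: "'a :: zero mat \<Rightarrow> 'a mat \<Rightarrow> 'a mat" (infixr "@\<^sub>c" 65) where
  "A @\<^sub>c B = four_block_mat A B (0\<^sub>m 0 (dim_col A)) (0\<^sub>m 0 (dim_col B))"

abbreviation cmat :: "real mat \<Rightarrow> complex mat" where
  "cmat \<equiv> map_mat complex_of_real"

definition qbd_W :: "nat \<Rightarrow> real mat \<Rightarrow> real mat \<Rightarrow> real mat \<Rightarrow> real mat" where
  "qbd_W m G U R = mat m m (\<lambda>ij. \<Sum>k. (G ^\<^sub>m k * mat_inv (U - 1\<^sub>m m) * R ^\<^sub>m k) $$ ij)"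

section \<open>Decomposable pairs and resolvent triples\<close>

definition mat_sum :: "nat \<Rightarrow> nat \<Rightarrow> (nat \<Rightarrow> 'a :: comm_monoid_add mat) \<Rightarrow> nat \<Rightarrow> 'a mat" where
  "mat_sum nr nc f l = mat nr nc (\<lambda>ij. \<Sum>i\<le>l. f i $$ ij)"

text \<open>A matrix polynomial \<open>\<Sum>i\<le>l. z\<^sup>i Bs i\<close> is given by \<open>l\<close> and its coefficients \<open>Bs\<close>.\<close>

definition matrix_poly :: "nat \<Rightarrow> nat \<Rightarrow> (nat \<Rightarrow> complex mat) \<Rightarrow> complex \<Rightarrow> complex mat" where
  "matrix_poly m l Bs z = mat_sum m m (\<lambda>i. z ^ i \<cdot>\<^sub>m Bs i) l"

text \<open>The \<open>ml \<times> ml\<close> matrix with block rows \<open>[X1 T1^i | X2 T2^(l - 1 - i)]\<close>, \<open>i = 0, \<dots>, l - 1\<close>.\<close>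

definition pair_matrix ::
  "nat \<Rightarrow> nat \<Rightarrow> complex mat \<Rightarrow> complex mat \<Rightarrow> complex mat \<Rightarrow> complex mat \<Rightarrow> complex mat" where
  "pair_matrix m l X1 X2 T1 T2 = mat (m * l) (m * l)
     (\<lambda>(r, c). ((X1 * T1 ^\<^sub>m (r div m)) @\<^sub>c (X2 * T2 ^\<^sub>m (l - 1 - r div m))) $$ (r mod m, c))"

text \<open>The size \<open>q\<close> of the first block is a parameter, rather than existentially quantified, because
  the pencil \<open>T(z)\<close> below depends on it. It determines the blocks.\<close>

definition decomposable_pair ::
  "nat \<Rightarrow> nat \<Rightarrow> (nat \<Rightarrow> complex mat) \<Rightarrow> nat \<Rightarrow> complex mat \<Rightarrow> complex mat \<Rightarrow> bool" where
  "decomposable_pair m l Bs q X T \<longleftrightarrow> q \<le> m * l \<and>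
     (\<exists>X1 X2 T1 T2.
        X1 \<in> carrier_mat m q \<and> X2 \<in> carrier_mat m (m * l - q)
      \<and> T1 \<in> carrier_mat q q \<and> T2 \<in> carrier_mat (m * l - q) (m * l - q)
      \<and> X = X1 @\<^sub>c X2 \<and> T = diag_block_mat [T1, T2]
      \<and> invertible_mat (pair_matrix m l X1 X2 T1 T2)
      \<and> mat_sum m q (\<lambda>i. Bs i * X1 * T1 ^\<^sub>m i) l = 0\<^sub>m m q
      \<and> mat_sum m (m * l - q) (\<lambda>i. Bs i * X2 * T2 ^\<^sub>m (l - i)) l = 0\<^sub>m m (m * l - q))"

text \<open>\<open>T(z) = diag(zI - T1, zT2 - I)\<close> for \<open>T = diag(T1, T2)\<close> with \<open>T1\<close> of size \<open>q\<close>.\<close>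

definition resolvent_pencil :: "nat \<Rightarrow> complex mat \<Rightarrow> complex \<Rightarrow> complex mat" where
  "resolvent_pencil q T z = (case split_block T q q of (T1, _, _, T2) \<Rightarrow>
     diag_block_mat [z \<cdot>\<^sub>m 1\<^sub>m (dim_row T1) - T1, z \<cdot>\<^sub>m T2 - 1\<^sub>m (dim_row T2)])"

definition resolvent_triple ::
  "nat \<Rightarrow> nat \<Rightarrow> (nat \<Rightarrow> complex mat) \<Rightarrow> nat \<Rightarrow> complex mat \<Rightarrow> complex mat \<Rightarrow> complex mat \<Rightarrow> bool" where
  "resolvent_triple m l Bs q X T Z \<longleftrightarrow>
     decomposable_pair m l Bs q X T \<and> Z \<in> carrier_mat (m * l) m
     \<and> (\<forall>z. invertible_mat (matrix_poly m l Bs z) \<and> invertible_mat (resolvent_pencil q T z) \<longrightarrow>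
          mat_inv (matrix_poly m l Bs z) = X * mat_inv (resolvent_pencil q T z) * Z)"

end

theory Submission imports Defs
begin

text \<open>
  Put \<open>D = I - U\<close>. The polynomial factors as
  \<open>\<eta>(z) = - (I - z R) D (z I - G)\<close>, because \<open>Am = D G\<close>, \<open>A1 = R D\<close> and \<open>A0 - I = - (D + R D G)\<close>.
  The matrix \<open>N = - W\<close> is the Green matrix of the doubly infinite process: its series gives
  \<open>N = D\<^sup>-\<^sup>1 + G N R\<close>, and it intertwines the two outer solvents, \<open>Gh N = N R\<close>. These two
  equations turn the product of \<open>(z I - G)\<^sup>-\<^sup>1 W + Gh (I - z Gh)\<^sup>-\<^sup>1 W\<close> with \<open>\<eta>(z)\<close> into the
  identity matrix (\<open>resolvent_identity\<close>). Since \<open>Gh = L V1 E + K V0 F\<close>, the matrix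
  \<open>Gh (I - z Gh)\<^sup>-\<^sup>1\<close> equals
  \<open>- L (z I - V1\<^sup>-\<^sup>1)\<^sup>-\<^sup>1 E - K (z V0 - I)\<^sup>-\<^sup>1 V0 F\<close>, and the sum is exactly \<open>X T(z)\<^sup>-\<^sup>1 Z\<close>.
  The two solvent equations for \<open>G\<close> and \<open>Gh\<close> are the polynomial conditions of a decomposable
  pair; its nonsingularity condition amounts to that of \<open>I - G Gh\<close>.

  What has to be shown is therefore that \<open>I - U\<close> and \<open>I - G Gh\<close> are nonsingular, that \<open>W\<close>
  converges, and that \<open>Gh W = W R\<close>. The last point is algebra once the others are known:
  \<open>\<Delta> = D (I - G Gh)\<close> satisfies \<open>\<Delta> Gh = A1 (I - G Gh) = R \<Delta>\<close>, and \<open>N = \<Delta>\<^sup>-\<^sup>1\<close>.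
  The others all follow from one strict inequality: there are \<open>\<mu> > 0\<close> and a positive
  vector \<open>v\<close> with \<open>(Am + \<mu> A0 + \<mu>\<^sup>2 A1) v < \<mu> v\<close> in every entry. Indeed \<open>\<mu>\<^sup>n v\<close> is then a
  supersolution on all levels, and the iterations that converge to the minimal solvents give
  \<open>G v < \<mu> v\<close>, \<open>Gh v < \<mu>\<^sup>-\<^sup>1 v\<close> and \<open>U v < v\<close>. So \<open>U\<close> and \<open>G Gh\<close> are strict contractions in the
  norm weighted by \<open>v\<close>, and the remainders \<open>G\<^sup>n Gh\<^sup>n N\<close> of the series decay geometrically.

  The inequality is where null recurrence is excluded. As \<open>A = Am + A0 + A1\<close> is stochastic and
  irreducible, \<open>(I - A) w = (A1 - Am) 1 + d 1\<close> has a solution \<open>(w, d)\<close>; here \<open>- d\<close> is the mean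
  drift of the level. If \<open>d \<noteq> 0\<close>, the choice \<open>\<mu> = 1 - e\<close>, \<open>v = 1 - e w\<close> with a small \<open>e\<close> of
  the sign opposite to \<open>d\<close> works. If \<open>d = 0\<close>, the function (level) + \<open>w\<close>(phase) is harmonic
  off level 0, tends to infinity and has bounded increments; such a function forces the chain to
  be null recurrent (\<open>null_recurrent_if_harmonic\<close>).
\<close>

section \<open>Null recurrence from an unbounded harmonic function\<close>

lemma infsum_eq_sum_support:
  fixes f :: "'s \<Rightarrow> real"
  assumes "finite F" "F \<subseteq> A" "\<And>x. x \<in> A - F \<Longrightarrow> f x = 0"
  shows "infsum f A = sum f F"
proof -
  have "infsum f A = infsum f F"
    by (rule infsum_cong_neutral) (use assms in auto)
  then show ?thesis using assms(1) by simp
qed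

text \<open>Finitely many successors per state turn the infinite sums that define first passage
  probabilities into finite ones, so that limits may be taken term by term.\<close>

locale locally_finite_chain =
  fixes S :: "'s set" and p :: "'s \<Rightarrow> 's \<Rightarrow> real"
  assumes stoch: "stochastic_on S p"
    and irred: "irreducible_on S p"
    and finite_succ: "\<And>x. x \<in> S \<Longrightarrow> finite {u \<in> S. p x u \<noteq> 0}"
begin

definition succs :: "'s \<Rightarrow> 's set" where
  "succs x = {u \<in> S. p x u \<noteq> 0}"

definition step :: "('s \<Rightarrow> real) \<Rightarrow> 's \<Rightarrow> real" where
  "step f x = (\<Sum>u\<in>succs x. p x u * f u)"

lemma fin: "x \<in> S \<Longrightarrow> finite (succs x)"
  using finite_succ by (simp add: succs_def)

lemma succs_subset: "succs x \<subseteq> S" by (auto simp: succs_def)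

lemma succsD: "u \<in> succs x \<Longrightarrow> u \<in> S" by (simp add: succs_def)

lemma pos: "x \<in> S \<Longrightarrow> u \<in> succs x \<Longrightarrow> 0 < p x u"
  using stoch by (force simp: stochastic_on_def succs_def)

lemma graph_iff: "(x, u) \<in> transition_graph S p \<longleftrightarrow> x \<in> S \<and> u \<in> succs x"
  using pos by (auto simp: transition_graph_def succs_def)

lemma row_sum: assumes "x \<in> S" shows "(\<Sum>u\<in>succs x. p x u) = 1"
proof -
  have "infsum (p x) S = 1"
    using stoch assms by (auto simp: stochastic_on_def intro: infsumI)
  moreover have "infsum (p x) S = (\<Sum>u\<in>succs x. p x u)"
    by (rule infsum_eq_sum_support) (use fin[OF assms] in \<open>auto simp: succs_def\<close>)
  ultimately show ?thesis by simp
qed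

lemma step_mono: "x \<in> S \<Longrightarrow> (\<And>u. u \<in> succs x \<Longrightarrow> f u \<le> g u) \<Longrightarrow> step f x \<le> step g x"
  unfolding step_def by (intro sum_mono mult_left_mono) (auto dest: pos intro: less_imp_le)

lemma step_const: "x \<in> S \<Longrightarrow> step (\<lambda>_. c) x = c"
  unfolding step_def by (simp add: row_sum flip: sum_distrib_right)

lemma step_add: "step (\<lambda>u. f u + g u) x = step f x + step g x"
  by (simp add: step_def distrib_left sum.distrib)

lemma step_diff: "step (\<lambda>u. f u - g u) x = step f x - step g x"
  by (simp add: step_def right_diff_distrib sum_subtractf)

lemma step_cmult: "step (\<lambda>u. c * f u) x = c * step f x"
  by (simp add: step_def sum_distrib_left mult.left_commute)

lemma step_eq_sum:
  assumes "x \<in> S" "finite F" "F \<subseteq> S" "succs x \<subseteq> F"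
  shows "step f x = (\<Sum>u\<in>F. p x u * f u)"
  unfolding step_def using assms by (intro sum.mono_neutral_left) (auto simp: succs_def)

lemma step_eq_maxD:
  assumes "x \<in> S" "\<And>u. u \<in> S \<Longrightarrow> f u \<le> c" "c \<le> step f x" "u \<in> succs x"
  shows "f u = c"
proof (rule ccontr)
  assume "f u \<noteq> c"
  then have lt: "f u < c" using assms(2)[of u] assms(4) succs_subset by force
  have "step f x < (\<Sum>u\<in>succs x. p x u * c)"
    unfolding step_def
    by (rule sum_strict_mono_ex1)
      (use assms fin pos lt succsD in \<open>auto intro!: mult_left_mono less_imp_le[OF pos] bexI[of _ u]\<close>)
  then show False using assms(3) row_sum[OF assms(1)] by (simp flip: sum_distrib_right)
qed

text \<open>The set where the maximum is attained is closed under transitions as long as it avoids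
  \<open>T\<close>; a path to a state of \<open>T\<close> must therefore meet \<open>T\<close> at a point of that set.\<close>

lemma maximum_principle:
  assumes x0: "x0 \<in> S" and mx: "\<And>x. x \<in> S \<Longrightarrow> f x \<le> f x0"
    and sub: "\<And>x. x \<in> S - T \<Longrightarrow> f x \<le> step f x"
    and t: "t \<in> S \<inter> T"
  shows "\<exists>y\<in>S \<inter> T. f y = f x0"
proof -
  have "(x0, t) \<in> (transition_graph S p)\<^sup>*"
    using irred x0 t by (auto simp: irreducible_on_def)
  then have "(\<exists>y\<in>S \<inter> T. f y = f x0) \<or> f t = f x0"
  proof (induction rule: rtrancl_induct)
    case (step y z)
    from step.hyps(2) have yz: "y \<in> S" "z \<in> succs y" by (auto simp: graph_iff)
    show ?case
    proof (cases "y \<in> T")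
      case False
      have "f z = f x0" if "f y = f x0"
        by (rule step_eq_maxD[OF yz(1) mx _ yz(2)]) (use sub[of y] yz False that in auto)
      then show ?thesis using step.IH by blast
    qed (use step.IH yz in auto)
  qed simp
  with t show ?thesis by auto
qed

abbreviation fp :: "'s \<Rightarrow> nat \<Rightarrow> 's \<Rightarrow> real" where
  "fp t n x \<equiv> first_passage S p t n x"

text \<open>Killing at \<open>t\<close>: it moves the excluded state of the first passage recursion from the
  summation range into the summand, so that the recursion becomes one application of \<open>step\<close>.\<close>

definition avoid :: "'s \<Rightarrow> ('s \<Rightarrow> real) \<Rightarrow> 's \<Rightarrow> real" where
  "avoid t f u = (if u = t then 0 else f u)"

lemma fp_Suc_Suc:
  assumes "x \<in> S"
  shows "fp t (Suc (Suc n)) x = step (avoid t (fp t (Suc n))) x"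
proof -
  have "fp t (Suc (Suc n)) x = (\<Sum>u\<in>succs x - {t}. p x u * fp t (Suc n) u)"
    unfolding first_passage.simps
    by (rule infsum_eq_sum_support) (use fin[OF assms] in \<open>auto simp: succs_def\<close>)
  also have "\<dots> = step (avoid t (fp t (Suc n))) x"
    unfolding step_def
    by (rule sum.mono_neutral_cong_left) (use fin[OF assms] in \<open>auto simp: avoid_def\<close>)
  finally show ?thesis .
qed

text \<open>The probability that the first passage to \<open>t\<close> happens after time \<open>N\<close>.\<close>

definition surv :: "'s \<Rightarrow> nat \<Rightarrow> 's \<Rightarrow> real" where
  "surv t N x = 1 - (\<Sum>n\<le>N. fp t n x)"

lemma surv_0: "surv t 0 x = 1" by (simp add: surv_def)

text \<open>The first step analysis of \<open>surv\<close>, which is simpler than the one of \<open>first_passage\<close>: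
  the term \<open>p x t\<close> has disappeared, since by stochasticity it is absorbed into the constant 1.\<close>

lemma surv_Suc:
  assumes "x \<in> S" "t \<in> S"
  shows "surv t (Suc N) x = step (avoid t (surv t N)) x"
proof -
  have p: "p x t = step (\<lambda>u. if u = t then 1 else 0) x"
    unfolding step_def using assms fin[OF assms(1)]
    by (simp add: if_distrib sum.delta cong: if_cong) (auto simp: succs_def)
  have 1: "(\<Sum>n\<le>Suc N. fp t n x) = p x t + step (avoid t (\<lambda>u. \<Sum>n\<le>N. fp t n u)) x"
  proof (induction N)
    case 0
    show ?case by (simp add: avoid_def step_def cong: if_cong)
  next
    case (Suc N)
    have "avoid t (\<lambda>u. \<Sum>n\<le>Suc N. fp t n u)
        = (\<lambda>u. avoid t (\<lambda>u. \<Sum>n\<le>N. fp t n u) u + avoid t (fp t (Suc N)) u)"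
      by (auto simp: avoid_def)
    moreover have "(\<Sum>n\<le>Suc (Suc N). fp t n x) = (\<Sum>n\<le>Suc N. fp t n x) + fp t (Suc (Suc N)) x"
      by (rule sum.atMost_Suc)
    ultimately show ?case
      by (simp only: Suc step_add fp_Suc_Suc[OF assms(1)] add.assoc)
  qed
  have "surv t (Suc N) x = step (\<lambda>_. 1) x - p x t - step (avoid t (\<lambda>u. \<Sum>n\<le>N. fp t n u)) x"
    unfolding surv_def 1 using assms by (simp add: step_const)
  also have "\<dots> = step (avoid t (surv t N)) x"
    unfolding p step_diff[symmetric]
    by (rule arg_cong[where f="\<lambda>f. step f x"]) (auto simp: avoid_def surv_def)
  finally show ?thesis .
qed

lemma fp_nonneg: "x \<in> S \<Longrightarrow> t \<in> S \<Longrightarrow> 0 \<le> fp t n x"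
proof (induction n arbitrary: x rule: induct_nat_012)
  case 1 then show ?case using stoch by (auto simp: stochastic_on_def)
next
  case (ge2 n)
  have "step (\<lambda>_. 0) x \<le> step (avoid t (fp t (Suc n))) x"
    by (rule step_mono) (use ge2 succs_subset in \<open>auto simp: avoid_def\<close>)
  then show ?case using ge2.prems fp_Suc_Suc[of x t n] by (simp add: step_const del: first_passage.simps)
qed simp

lemma surv_nonneg: "x \<in> S \<Longrightarrow> t \<in> S \<Longrightarrow> 0 \<le> surv t N x"
proof (induction N arbitrary: x)
  case (Suc N)
  have "step (\<lambda>_. 0) x \<le> step (avoid t (surv t N)) x"
    by (rule step_mono) (use Suc succs_subset in \<open>auto simp: avoid_def\<close>)
  then show ?case using Suc by (simp add: surv_Suc step_const)
qed (simp add: surv_0)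

lemma surv_tendsto:
  assumes "x \<in> S" "t \<in> S"
  shows "summable (\<lambda>n. fp t n x)" "(\<lambda>N. surv t N x) \<longlonglongrightarrow> 1 - (\<Sum>n. fp t n x)"
proof -
  show s: "summable (\<lambda>n. fp t n x)"
  proof (rule summableI_nonneg_bounded)
    fix n
    have "(\<Sum>i<n. fp t i x) \<le> (\<Sum>i\<le>n. fp t i x)"
      by (rule sum_mono2) (use fp_nonneg assms in auto)
    then show "(\<Sum>i<n. fp t i x) \<le> 1"
      using surv_nonneg[OF assms, of n] by (simp add: surv_def)
  qed (use fp_nonneg assms in auto)
  have "(\<lambda>N. \<Sum>n\<le>N. fp t n x) \<longlonglongrightarrow> (\<Sum>n. fp t n x)"
    using summable_LIMSEQ'[OF s] .
  then show "(\<lambda>N. surv t N x) \<longlonglongrightarrow> 1 - (\<Sum>n. fp t n x)"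
    unfolding surv_def by (intro tendsto_intros)
qed

lemma step_tendsto:
  assumes "x \<in> S" "\<And>u. u \<in> succs x \<Longrightarrow> (\<lambda>N. f N u) \<longlonglongrightarrow> g u"
  shows "(\<lambda>N. step (f N) x) \<longlonglongrightarrow> step g x"
  unfolding step_def by (intro tendsto_intros assms)

text \<open>A Foster-Lyapunov criterion. Recurrence: the probability \<open>g\<close> of never hitting \<open>t\<close> is
  harmonic off \<open>t\<close>, and \<open>g - e V\<close> attains its maximum because \<open>V\<close> tends to infinity, so by the maximum
  principle \<open>g\<close> is bounded by its maximum over the finite exceptional set; being attained, that
  maximum is \<open>g t = 0\<close>. Infinite mean: along the chain stopped on the exceptional set, \<open>V\<close> is a
  martingale with increments at most \<open>c\<close>. If the mean return time were finite, the contribution of the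
  paths not stopped by time \<open>N\<close>, at most \<open>(V x + c N)\<close> times their probability, would vanish in
  the limit, and \<open>V\<close> would be bounded by its values on the exceptional set.\<close>

theorem null_recurrent_if_harmonic:
  fixes V :: "'s \<Rightarrow> real"
  assumes inf: "infinite S"
    and V0: "\<And>x. x \<in> S \<Longrightarrow> 0 \<le> V x"
    and fin_sub: "\<And>c. finite {x \<in> S. V x \<le> c}"
    and F: "finite F" "F \<subseteq> S"
    and harm: "\<And>x. x \<in> S - F \<Longrightarrow> step V x = V x"
    and incr: "\<And>x u. x \<in> S \<Longrightarrow> u \<in> succs x \<Longrightarrow> V u \<le> V x + c"
  shows "null_recurrent_chain S p"
  unfolding null_recurrent_chain_def
proof
  fix t assume t: "t \<in> S"
  let ?h = "\<lambda>x. \<Sum>n. fp t n x"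
  let ?g = "avoid t (\<lambda>x. 1 - ?h x)"
  let ?T = "insert t F"
  have T: "finite ?T" "?T \<subseteq> S" "?T \<noteq> {}" "t \<in> S \<inter> ?T" using F t by auto
  have h: "1 - ?h x = step ?g x" if x: "x \<in> S" for x
  proof -
    have "(\<lambda>N. surv t (Suc N) x) \<longlonglongrightarrow> 1 - ?h x"
      using surv_tendsto(2)[OF x t] by (rule LIMSEQ_Suc)
    moreover have "(\<lambda>N. surv t (Suc N) x) \<longlonglongrightarrow> step ?g x"
      unfolding surv_Suc[OF x t]
    proof (rule step_tendsto[OF x])
      fix u assume "u \<in> succs x"
      then have "u \<in> S" using succs_subset by auto
      then show "(\<lambda>N. avoid t (surv t N) u) \<longlonglongrightarrow> ?g u"
        using surv_tendsto(2)[OF _ t, of u] by (auto simp: avoid_def)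
    qed
    ultimately show ?thesis by (rule LIMSEQ_unique)
  qed
  have g_harm: "?g x = step ?g x" if "x \<in> S" "x \<noteq> t" for x
    using h[OF that(1)] that(2) by (simp add: avoid_def)
  have gt: "?g t = 0" by (simp add: avoid_def)
  have g_bounds: "0 \<le> ?g x" "?g x \<le> 1" if x: "x \<in> S" for x
  proof -
    have "0 \<le> 1 - ?h x"
      by (rule LIMSEQ_le_const[OF surv_tendsto(2)[OF x t]]) (use surv_nonneg x t in auto)
    moreover have "0 \<le> ?h x" by (rule suminf_nonneg) (use surv_tendsto fp_nonneg x t in auto)
    ultimately show "0 \<le> ?g x" "?g x \<le> 1" by (auto simp: avoid_def)
  qed
  define M where "M = Max (?g ` ?T)"
  have M_ge: "?g x \<le> M" if "x \<in> ?T" for x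
    unfolding M_def using T that by (intro Max_ge) auto
  have "0 \<le> M" using M_ge[of t] gt by simp
  \<comment> \<open>maximum principle for \<open>g - e V - M\<close>, whose positive values occur only where \<open>V \<le> 1 / e\<close>\<close>
  have g_le: "?g x \<le> M + e * V x" if e: "0 < e" and x: "x \<in> S" for e x
  proof (rule ccontr)
    let ?phi = "\<lambda>x. ?g x - e * V x - M"
    assume "\<not> ?g x \<le> M + e * V x"
    then have x_pos: "?phi x > 0" by simp
    let ?K = "{y \<in> S. V y \<le> 1 / e}"
    have out: "?phi y \<le> 0" if "y \<in> S" "y \<notin> ?K" for y
    proof -
      have "1 \<le> e * V y" using that e by (simp add: field_simps not_le)
      then show ?thesis using g_bounds[OF that(1)] \<open>0 \<le> M\<close> by simp
    qed
    have fK: "finite ?K" by (rule fin_sub)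
    have xK: "x \<in> ?K" using out[OF x] x_pos by force
    have "Max (?phi ` ?K) \<in> ?phi ` ?K" using fK xK by (intro Max_in) auto
    then obtain x0 where x0K: "x0 \<in> ?K" and x0: "Max (?phi ` ?K) = ?phi x0" by (rule imageE)
    have x0_max: "?phi y \<le> ?phi x0" if "y \<in> ?K" for y
      unfolding x0[symmetric] using fK that by (intro Max_ge) auto
    have pos0: "?phi x0 > 0" using x0_max[OF xK] x_pos by simp
    have "\<exists>y\<in>S \<inter> ?T. ?phi y = ?phi x0"
    proof (rule maximum_principle[where t = t])
      show "x0 \<in> S" using x0K by simp
      show "?phi y \<le> ?phi x0" if "y \<in> S" for y
        using x0_max[of y] out[of y] pos0 that by (cases "y \<in> ?K") linarith+
      show "?phi y \<le> step ?phi y" if "y \<in> S - ?T" for y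
        using that g_harm[of y] harm[of y]
        by (simp add: step_diff step_cmult step_const)
    qed (use T in auto)
    then obtain y where "y \<in> S" "y \<in> ?T" "?phi y > 0" using pos0 by auto
    moreover have "0 \<le> e * V y" using V0 e \<open>y \<in> S\<close> by simp
    ultimately show False using M_ge[of y] by simp
  qed
  have g_le_M: "?g x \<le> M" if x: "x \<in> S" for x
  proof (rule field_le_epsilon)
    fix e :: real assume e: "0 < e"
    have V: "0 \<le> V x" by (rule V0[OF x])
    have "?g x \<le> M + (e / (1 + V x)) * V x" using e V x by (intro g_le) auto
    also have "(e / (1 + V x)) * V x \<le> e" using e V by (simp add: field_simps)
    finally show "?g x \<le> M + e" by simp
  qed
  have "M \<in> ?g ` ?T" unfolding M_def using T by (intro Max_in) auto
  then obtain z where z: "z \<in> ?T" "?g z = M" by (metis imageE)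
  have "\<exists>y\<in>S \<inter> {t}. ?g y = ?g z"
  proof (rule maximum_principle[where t = t])
    show "z \<in> S" using z T by auto
  qed (use z g_le_M g_harm t in auto)
  then have "M = 0" using z gt by simp
  then have g0: "?g x = 0" if "x \<in> S" for x using g_le_M[OF that] g_bounds[OF that] by simp
  have h1: "?h x = 1" if x: "x \<in> S" for x
  proof -
    have "step ?g x \<le> step (\<lambda>_. 0) x"
      using x succs_subset g0 by (intro step_mono) force+
    moreover have "step (\<lambda>_. 0) x \<le> step ?g x"
      using x succs_subset g0 by (intro step_mono) force+
    ultimately show ?thesis using h[OF x] x by (simp add: step_const)
  qed
  have sums1: "(\<lambda>n. fp t n x) sums 1" if "x \<in> S" for x
    using surv_tendsto(1)[OF that t] h1[OF that] by (metis summable_sums)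
  have "\<not> summable (\<lambda>n. real n * fp t n t)"
  proof
    assume *: "summable (\<lambda>n. real n * fp t n t)"
    \<comment> \<open>finiteness of the mean passage time propagates from \<open>t\<close> along every transition to a state
      other than \<open>t\<close>, because \<open>fp t (n + 1) x \<ge> p x u * fp t n u\<close>\<close>
    have mean: "summable (\<lambda>n. real n * fp t n x)" if x: "x \<in> S" for x
    proof -
      have "(t, x) \<in> (transition_graph S p)\<^sup>*"
        using irred x t by (auto simp: irreducible_on_def)
      then show ?thesis
      proof (induction rule: rtrancl_induct)
        case (step y z)
        then have yz: "y \<in> S" "z \<in> succs y" "z \<in> S" using succs_subset by (auto simp: graph_iff)
        show ?case
        proof (cases "z = t")
          case False
          have le: "p y z * fp t (Suc n) z \<le> fp t (Suc (Suc n)) y" for n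
          proof -
            have "(\<Sum>u\<in>{z}. p y u * avoid t (fp t (Suc n)) u) \<le> step (avoid t (fp t (Suc n))) y"
              unfolding step_def
              by (rule sum_mono2)
                (use yz fin pos succsD fp_nonneg t in
                  \<open>auto simp: avoid_def simp del: first_passage.simps intro!: mult_nonneg_nonneg intro: less_imp_le\<close>)
            then show ?thesis using False yz by (simp add: avoid_def fp_Suc_Suc del: first_passage.simps)
          qed
          have "summable (\<lambda>n. real (Suc (Suc n)) * fp t (Suc (Suc n)) y)"
            using step.IH
            by (subst (asm) summable_Suc_iff[symmetric], subst (asm) summable_Suc_iff[symmetric])
          then have "summable (\<lambda>n. inverse (p y z) * (real (Suc (Suc n)) * fp t (Suc (Suc n)) y))"
            by (rule summable_mult)
          then have "summable (\<lambda>n. real (Suc n) * fp t (Suc n) z)"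
          proof (rule summable_comparison_test'[where N = 0])
            fix n :: nat
            have pz: "0 < p y z" using pos yz by blast
            have "real (Suc n) * fp t (Suc n) z \<le> real (Suc (Suc n)) * fp t (Suc n) z"
              using fp_nonneg[OF yz(3) t] by (intro mult_right_mono) auto
            also have "\<dots> = inverse (p y z) * (real (Suc (Suc n)) * (p y z * fp t (Suc n) z))"
              using pz by (simp add: field_simps)
            also have "\<dots> \<le> inverse (p y z) * (real (Suc (Suc n)) * fp t (Suc (Suc n)) y)"
              using pz le[of n] by (intro mult_left_mono) auto
            finally show "norm (real (Suc n) * fp t (Suc n) z)
                \<le> inverse (p y z) * (real (Suc (Suc n)) * fp t (Suc (Suc n)) y)"
              using fp_nonneg[OF yz(3) t] by simp
          qed
          then show ?thesis by (subst summable_Suc_iff[symmetric])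
        qed (use * in simp)
      qed (use * in simp)
    qed
    have surv_tail: "(\<lambda>N. real N * surv t N x) \<longlonglongrightarrow> 0" if x: "x \<in> S" for x
    proof -
      let ?r = "\<lambda>n. real n * fp t n x"
      have lim: "(\<lambda>N. suminf ?r - (\<Sum>n\<le>N. ?r n)) \<longlonglongrightarrow> 0"
        using tendsto_diff[OF tendsto_const[of "suminf ?r"] summable_LIMSEQ'[OF mean[OF x]]] by simp
      have up: "real N * surv t N x \<le> suminf ?r - (\<Sum>n\<le>N. ?r n)" for N
      proof -
        have s: "summable (\<lambda>n. fp t n x)" using surv_tendsto x t by simp
        have "surv t N x = (\<Sum>n. fp t (n + Suc N) x)"
          using suminf_split_initial_segment[OF s, of "Suc N"] h1[OF x]
          by (simp add: surv_def lessThan_Suc_atMost)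
        then have "real N * surv t N x = (\<Sum>n. real N * fp t (n + Suc N) x)"
          using suminf_mult[of "\<lambda>n. fp t (n + Suc N) x" "real N"] s
          by (simp add: summable_iff_shift[of "\<lambda>n. fp t n x" "Suc N"] del: add_Suc_right)
        also have "\<dots> \<le> (\<Sum>n. ?r (n + Suc N))"
        proof (rule suminf_le)
          show "real N * fp t (n + Suc N) x \<le> ?r (n + Suc N)" for n
            using fp_nonneg[OF x t] by (intro mult_right_mono) auto
          show "summable (\<lambda>n. real N * fp t (n + Suc N) x)"
            using s by (intro summable_mult) (rule summable_ignore_initial_segment)
          show "summable (\<lambda>n. ?r (n + Suc N))"
            using mean[OF x] by (rule summable_ignore_initial_segment)
        qed
        also have "\<dots> = suminf ?r - (\<Sum>n\<le>N. ?r n)"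
          using suminf_split_initial_segment[OF mean[OF x], of "Suc N"]
          by (simp add: lessThan_Suc_atMost)
        finally show ?thesis .
      qed
      show ?thesis
        by (rule tendsto_sandwich[OF _ _ tendsto_const lim])
          (use up surv_nonneg[OF x t] in \<open>auto intro!: always_eventually\<close>)
    qed
    define b where "b = Max (V ` ?T)"
    let ?W = "\<lambda>x. V x - b"
    have Wb: "?W x \<le> 0" if "x \<in> ?T" for x
    proof -
      have "V x \<le> b" unfolding b_def using T(1) that by (intro Max_ge) blast+
      then show ?thesis by simp
    qed
    have c': "?W u \<le> ?W x + max 0 c" if "x \<in> S" "u \<in> succs x" for x u
      using incr[OF that] by simp
    \<comment> \<open>optional stopping, in the form of an induction on the time horizon\<close>
    have key: "?W x \<le> (max 0 (?W x) + max 0 c * real N) * surv t N x" if "x \<in> S" for x N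
      using that
    proof (induction N arbitrary: x)
      case (Suc N)
      have nn: "0 \<le> max 0 (?W x) + max 0 c * real (Suc N)" by simp
      show ?case
      proof (cases "x \<in> ?T")
        case True
        have "0 \<le> (max 0 (?W x) + max 0 c * real (Suc N)) * surv t (Suc N) x"
          by (rule mult_nonneg_nonneg[OF nn surv_nonneg[OF Suc.prems t]])
        then show ?thesis using Wb[OF True] by linarith
      next
        case False
        have "?W x = step ?W x" using harm[of x] False Suc.prems by (simp add: step_diff step_const)
        also have "\<dots> \<le> step (\<lambda>u. (max 0 (?W x) + max 0 c * real (Suc N)) * avoid t (surv t N) u) x"
        proof (rule step_mono[OF Suc.prems])
          fix u assume u: "u \<in> succs x"
          then have uS: "u \<in> S" using succs_subset by auto
          show "?W u \<le> (max 0 (?W x) + max 0 c * real (Suc N)) * avoid t (surv t N) u"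
          proof (cases "u = t")
            case True then show ?thesis using Wb[of t] by (simp add: avoid_def)
          next
            case False
            have "?W u \<le> (max 0 (?W u) + max 0 c * real N) * surv t N u" by (rule Suc.IH[OF uS])
            also have "\<dots> \<le> (max 0 (?W x) + max 0 c * real (Suc N)) * surv t N u"
              using c'[OF Suc.prems u] surv_nonneg[OF uS t]
              by (intro mult_right_mono) (auto simp: algebra_simps)
            finally show ?thesis using False by (simp add: avoid_def)
          qed
        qed
        also have "\<dots> = (max 0 (?W x) + max 0 c * real (Suc N)) * surv t (Suc N) x"
          unfolding step_cmult surv_Suc[OF Suc.prems t] ..
        finally show ?thesis .
      qed
    qed (simp add: surv_0)
    have "?W x \<le> 0" if x: "x \<in> S" for x
    proof -
      have "(\<lambda>N. max 0 (?W x) * surv t N x + max 0 c * (real N * surv t N x))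
          \<longlonglongrightarrow> max 0 (?W x) * (1 - ?h x) + max 0 c * 0"
        by (intro tendsto_intros surv_tendsto surv_tail x t)
      then have "(\<lambda>N. (max 0 (?W x) + max 0 c * real N) * surv t N x) \<longlonglongrightarrow> 0"
        by (simp add: h1[OF x] distrib_right mult.assoc)
      then show ?thesis by (rule LIMSEQ_le_const) (use key[OF x] in blast)
    qed
    then have "S \<subseteq> {x \<in> S. V x \<le> b}" by auto
    then show False using inf fin_sub[of b] finite_subset by blast
  qed
  then show "null_recurrent_state S p t"
    using sums1[OF t] by (simp add: null_recurrent_state_def)
qed

end

section \<open>Nonnegative matrices acting on vectors\<close>

text \<open>Vectors are plain functions, so that the chain, whose functions are indexed by states, and
  the matrices can share them; only the entries below \<open>m\<close> matter.\<close>

definition mat_act :: "nat \<Rightarrow> real mat \<Rightarrow> (nat \<Rightarrow> real) \<Rightarrow> nat \<Rightarrow> real" where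
  "mat_act m A v i = (\<Sum>j<m. A $$ (i, j) * v j)"

definition nonneg_mat :: "nat \<Rightarrow> real mat \<Rightarrow> bool" where
  "nonneg_mat m A \<longleftrightarrow> A \<in> carrier_mat m m \<and> 0\<^sub>m m m \<le> A"

lemma nonneg_matD:
  assumes "nonneg_mat m A"
  shows "A \<in> carrier_mat m m" "i < m \<Longrightarrow> j < m \<Longrightarrow> 0 \<le> A $$ (i, j)"
  using assms unfolding nonneg_mat_def less_eq_mat_def by force+

lemma nonneg_matI:
  assumes "A \<in> carrier_mat m m" "\<And>i j. i < m \<Longrightarrow> j < m \<Longrightarrow> 0 \<le> A $$ (i, j)"
  shows "nonneg_mat m A"
  using assms unfolding nonneg_mat_def less_eq_mat_def by simp

lemma le_matD:
  fixes A B :: "real mat"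
  assumes "A \<le> B" "B \<in> carrier_mat m m" "i < m" "j < m"
  shows "A $$ (i, j) \<le> B $$ (i, j)"
  using assms unfolding less_eq_mat_def by simp

lemma le_matI:
  fixes A B :: "real mat"
  assumes "A \<in> carrier_mat m m" "B \<in> carrier_mat m m"
    "\<And>i j. i < m \<Longrightarrow> j < m \<Longrightarrow> A $$ (i, j) \<le> B $$ (i, j)"
  shows "A \<le> B"
  using assms unfolding less_eq_mat_def by simp

lemma mult_entry:
  fixes A B :: "'a :: semiring_0 mat"
  shows "A \<in> carrier_mat m n \<Longrightarrow> B \<in> carrier_mat n k \<Longrightarrow> i < m \<Longrightarrow> j < k \<Longrightarrow>
    (A * B) $$ (i, j) = (\<Sum>l<n. A $$ (i, l) * B $$ (l, j))"
  by (auto simp: scalar_prod_def atLeast0LessThan)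

lemma act_mult:
  assumes c: "A \<in> carrier_mat m m" "B \<in> carrier_mat m m" and i: "i < m"
  shows "mat_act m (A * B) v i = mat_act m A (mat_act m B v) i"
proof -
  have "mat_act m (A * B) v i = (\<Sum>j<m. \<Sum>l<m. A $$ (i, l) * (B $$ (l, j) * v j))"
    unfolding mat_act_def
    by (rule sum.cong) (use i in \<open>simp_all add: mult_entry[OF c] sum_distrib_right mult.assoc del: index_mult_mat(1)\<close>)
  also have "\<dots> = (\<Sum>l<m. \<Sum>j<m. A $$ (i, l) * (B $$ (l, j) * v j))" by (rule sum.swap)
  finally show ?thesis by (simp add: mat_act_def sum_distrib_left)
qed

lemma act_plus:
  "A \<in> carrier_mat m m \<Longrightarrow> B \<in> carrier_mat m m \<Longrightarrow> i < m \<Longrightarrow> mat_act m (A + B) v i = mat_act m A v i + mat_act m B v i"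
  by (simp add: mat_act_def distrib_right sum.distrib)

lemma act_one: "i < m \<Longrightarrow> mat_act m (1\<^sub>m m) v i = v i"
proof -
  assume "i < m"
  then have "mat_act m (1\<^sub>m m) v i = (\<Sum>j<m. if i = j then v j else 0)"
    unfolding mat_act_def by (intro sum.cong) auto
  then show ?thesis using \<open>i < m\<close> by (simp add: sum.delta)
qed

lemma act_zero: "i < m \<Longrightarrow> mat_act m (0\<^sub>m m m) v i = 0"
  by (simp add: mat_act_def)

lemma act_cmult: "mat_act m A (\<lambda>i. c * v i) i = c * mat_act m A v i"
  by (simp add: mat_act_def sum_distrib_left mult.left_commute)

lemma act_diff: "mat_act m A (\<lambda>i. v i - w i) i = mat_act m A v i - mat_act m A w i"
  by (simp add: mat_act_def right_diff_distrib sum_subtractf)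

lemma act_add: "mat_act m A (\<lambda>i. v i + w i) i = mat_act m A v i + mat_act m A w i"
  by (simp add: mat_act_def distrib_left sum.distrib)

lemma act_mono:
  assumes "nonneg_mat m A" "i < m" "\<And>j. j < m \<Longrightarrow> v j \<le> w j"
  shows "mat_act m A v i \<le> mat_act m A w i"
  unfolding mat_act_def
  by (intro sum_mono mult_left_mono assms(3) nonneg_matD(2)[OF assms(1)]) (use assms(2) in auto)

lemma act_nonneg:
  assumes "nonneg_mat m A" "i < m" "\<And>j. j < m \<Longrightarrow> 0 \<le> v j"
  shows "0 \<le> mat_act m A v i"
  unfolding mat_act_def
  by (intro sum_nonneg mult_nonneg_nonneg assms(3) nonneg_matD(2)[OF assms(1)]) (use assms(2) in auto)

lemma act_cong: "(\<And>j. j < m \<Longrightarrow> v j = w j) \<Longrightarrow> mat_act m A v i = mat_act m A w i"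
  by (simp add: mat_act_def)

lemma nonneg_mult:
  assumes "nonneg_mat m A" "nonneg_mat m B"
  shows "nonneg_mat m (A * B)"
proof (rule nonneg_matI)
  fix i j assume "i < m" "j < m"
  then show "0 \<le> (A * B) $$ (i, j)"
    unfolding mult_entry[OF nonneg_matD(1)[OF assms(1)] nonneg_matD(1)[OF assms(2)] \<open>i < m\<close> \<open>j < m\<close>]
    by (intro sum_nonneg mult_nonneg_nonneg nonneg_matD(2)[OF assms(1)] nonneg_matD(2)[OF assms(2)]) auto
qed (rule mult_carrier_mat[OF assms[THEN nonneg_matD(1)]])

lemma nonneg_plus:
  assumes "nonneg_mat m A" "nonneg_mat m B"
  shows "nonneg_mat m (A + B)"
  using assms[THEN nonneg_matD(1)] assms[THEN nonneg_matD(2)] by (intro nonneg_matI) simp_all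

lemma mult_left_mono_mat:
  assumes A: "nonneg_mat m A" and c: "B \<in> carrier_mat m m" "C \<in> carrier_mat m m" and le: "B \<le> C"
  shows "A * B \<le> A * C"
proof (rule le_matI[of _ m])
  fix i j assume ij: "i < m" "j < m"
  show "(A * B) $$ (i, j) \<le> (A * C) $$ (i, j)"
    unfolding mult_entry[OF nonneg_matD(1)[OF A] c(1) ij] mult_entry[OF nonneg_matD(1)[OF A] c(2) ij]
    by (intro sum_mono mult_left_mono le_matD[OF le c(2)] nonneg_matD(2)[OF A]) (use ij in auto)
qed (use c nonneg_matD(1)[OF A] in auto)

lemma mult_right_mono_mat:
  assumes A: "nonneg_mat m A" and c: "B \<in> carrier_mat m m" "C \<in> carrier_mat m m" and le: "B \<le> C"
  shows "B * A \<le> C * A"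
proof (rule le_matI[of _ m])
  fix i j assume ij: "i < m" "j < m"
  show "(B * A) $$ (i, j) \<le> (C * A) $$ (i, j)"
    unfolding mult_entry[OF c(1) nonneg_matD(1)[OF A] ij] mult_entry[OF c(2) nonneg_matD(1)[OF A] ij]
    by (intro sum_mono mult_right_mono le_matD[OF le c(2)] nonneg_matD(2)[OF A]) (use ij in auto)
qed (use c nonneg_matD(1)[OF A] in auto)

lemma inverse_if_injective:
  fixes A :: "'a :: field mat"
  assumes A: "A \<in> carrier_mat m m"
    and inj: "\<And>v. v \<in> carrier_vec m \<Longrightarrow> A *\<^sub>v v = 0\<^sub>v m \<Longrightarrow> v = 0\<^sub>v m"
  obtains S where "S \<in> carrier_mat m m" "S * A = 1\<^sub>m m" "A * S = 1\<^sub>m m"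
proof -
  have "det A \<noteq> 0" using det_0_iff_vec_prod_zero_field[OF A] inj by auto
  then have "A \<in> Units (ring_mat TYPE('a) m ())" using det_non_zero_imp_unit[OF A] by simp
  then show thesis using that by (auto simp: Units_def ring_mat_simps)
qed

lemma mult_vec_entry:
  "A \<in> carrier_mat m m \<Longrightarrow> x \<in> carrier_vec m \<Longrightarrow> i < m \<Longrightarrow> (A *\<^sub>v x) $ i = mat_act m A (($) x) i"
  by (auto simp: scalar_prod_def mat_act_def atLeast0LessThan)

text \<open>A minimum principle weighted by \<open>v\<close>: at an index minimizing \<open>x i / v i\<close>, a negative ratio
  \<open>r\<close> would give \<open>x i \<ge> (T x) i \<ge> r (T v) i > r v i = x i\<close>.\<close>

lemma nonneg_if_supersolution:
  assumes T: "nonneg_mat m T"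
    and v: "\<And>i. i < m \<Longrightarrow> 0 < v i" "\<And>i. i < m \<Longrightarrow> mat_act m T v i < v i"
    and x: "\<And>i. i < m \<Longrightarrow> mat_act m T x i \<le> x i"
    and k: "k < m"
  shows "0 \<le> x k"
proof (rule ccontr)
  assume neg: "\<not> 0 \<le> x k"
  define r where "r = Min ((\<lambda>i. x i / v i) ` {..<m})"
  have "r \<in> (\<lambda>i. x i / v i) ` {..<m}" unfolding r_def using k by (intro Min_in) auto
  then obtain i where i: "i < m" "r = x i / v i" by auto
  have r: "r \<le> x j / v j" if "j < m" for j unfolding r_def using that by (intro Min_le) auto
  have "r < 0" using r[OF k] neg v(1)[OF k] by (meson divide_neg_pos less_le_trans linorder_not_le order_le_less_trans)
  have "r * mat_act m T v i \<le> mat_act m T x i"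
    unfolding act_cmult[symmetric]
    using r v(1) by (intro act_mono[OF T i(1)]) (simp add: field_simps)
  moreover have "x i < r * mat_act m T v i"
    using i v[OF i(1)] \<open>r < 0\<close> mult_strict_left_mono_neg[OF v(2)[OF i(1)] \<open>r < 0\<close>] by simp
  ultimately show False using x[OF i(1)] by simp
qed

text \<open>The minimum principle applied to \<open>\<plusminus>x\<close> makes \<open>I - T\<close> injective, and applied to the
  columns of the inverse makes them nonnegative.\<close>

lemma contraction_inverse:
  assumes T: "nonneg_mat m T"
    and v: "\<And>i. i < m \<Longrightarrow> 0 < v i" "\<And>i. i < m \<Longrightarrow> mat_act m T v i < v i"
  obtains S where "nonneg_mat m S" "S * (1\<^sub>m m - T) = 1\<^sub>m m" "(1\<^sub>m m - T) * S = 1\<^sub>m m"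
proof -
  note Tc = nonneg_matD(1)[OF T]
  have mat_act: "mat_act m (1\<^sub>m m - T) x i = x i - mat_act m T x i" if "i < m" for x i
    using that Tc act_one[OF that, of x]
    by (simp add: mat_act_def left_diff_distrib sum_subtractf)
  have c: "1\<^sub>m m - T \<in> carrier_mat m m" by (rule minus_carrier_mat[OF Tc])
  obtain S where S: "S \<in> carrier_mat m m" "S * (1\<^sub>m m - T) = 1\<^sub>m m" "(1\<^sub>m m - T) * S = 1\<^sub>m m"
  proof (rule inverse_if_injective[OF c])
    fix x assume x: "x \<in> carrier_vec m" "(1\<^sub>m m - T) *\<^sub>v x = 0\<^sub>v m"
    have eq: "mat_act m T (($) x) i = x $ i" if "i < m" for i
      using mult_vec_entry[OF c x(1) that] mat_act[OF that, of "($) x"] x(2) that by simp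
    have le: "mat_act m T (\<lambda>i. x $ i) i \<le> x $ i" "mat_act m T (\<lambda>i. - 1 * x $ i) i \<le> - 1 * x $ i" if "i < m" for i
      unfolding act_cmult using eq[OF that] by simp_all
    have "x $ i = 0" if i: "i < m" for i
    proof (rule order_antisym)
      show "0 \<le> x $ i"
        by (rule nonneg_if_supersolution[where x = "\<lambda>i. x $ i", OF T v(1) v(2) le(1) i])
      have "0 \<le> - 1 * x $ i"
        by (rule nonneg_if_supersolution[where x = "\<lambda>i. - 1 * x $ i", OF T v(1) v(2) le(2) i])
      then show "x $ i \<le> 0" by simp
    qed
    then show "x = 0\<^sub>v m" using x(1) by (intro eq_vecI) auto
  qed
  have "0 \<le> S $$ (k, j)" if "k < m" "j < m" for k j
  proof (rule nonneg_if_supersolution[OF T v _ that(1)])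
    fix i assume i: "i < m"
    have "mat_act m (1\<^sub>m m - T) (\<lambda>k. S $$ (k, j)) i = (1\<^sub>m m :: real mat) $$ (i, j)"
      using mult_entry[OF c S(1) i that(2)] unfolding S(3) mat_act_def by simp
    then show "mat_act m T (\<lambda>k. S $$ (k, j)) i \<le> S $$ (i, j)"
      using i that by (simp add: mat_act[OF i] split: if_splits)
  qed
  with S show thesis using that nonneg_matI by blast
qed

section \<open>The drift of the level\<close>

text \<open>The kernel of \<open>I - A\<close> consists of the constants by the maximum principle, and no
  nonzero constant is in its range (look at a maximal and a minimal entry). Hence adding the value at
  index 0 as a constant, \<open>x \<mapsto> (I - A) x + x\<^sub>0 1\<close>, yields an injective, so bijective, map, and
  \<open>d = - x\<^sub>0\<close>.\<close>

lemma poisson_equation_solvable: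
  assumes m: "0 < m" and A: "nonneg_mat m A"
    and one: "\<And>i. i < m \<Longrightarrow> mat_act m A (\<lambda>_. 1) i = 1"
    and irr: "irreducible_matrix m A"
  obtains w d where "\<And>i. i < m \<Longrightarrow> w i - mat_act m A w i = b i + (d :: real)"
proof -
  note Ac = nonneg_matD(1)[OF A]
  interpret chain: locally_finite_chain "{..<m}" "\<lambda>i j. A $$ (i, j)"
  proof
    show "stochastic_on {..<m} (\<lambda>i j. A $$ (i, j))"
      unfolding stochastic_on_def
    proof (intro ballI conjI)
      fix i assume i: "i \<in> {..<m}"
      show "0 \<le> A $$ (i, j)" if "j \<in> {..<m}" for j using A i that by (auto dest: nonneg_matD)
      show "((\<lambda>j. A $$ (i, j)) has_sum 1) {..<m}"
        using one[of i] i by (simp add: mat_act_def has_sum_finite_iff)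
    qed
  qed (use irr in \<open>auto simp: irreducible_matrix_def\<close>)
  have step: "chain.step f i = mat_act m A f i" if "i < m" for f i
    unfolding chain.step_def mat_act_def chain.succs_def
    by (rule sum.mono_neutral_left) auto
  define E where "E = mat m m (\<lambda>(i, j). if j = 0 then 1 else (0 :: real))"
  have actE: "mat_act m E x i = x 0" if "i < m" for x i
  proof -
    have "mat_act m E x i = (\<Sum>j<m. if 0 = j then x j else 0)"
      unfolding mat_act_def using that by (intro sum.cong) (auto simp: E_def)
    then show ?thesis using m by (simp add: sum.delta)
  qed
  let ?Q = "1\<^sub>m m - A + E"
  have Qc: "?Q \<in> carrier_mat m m" using minus_carrier_mat[OF Ac] by (simp add: E_def)
  have actQ: "mat_act m ?Q x i = x i - mat_act m A x i + x 0" if "i < m" for x i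
  proof -
    have "mat_act m (1\<^sub>m m - A) x i = mat_act m (1\<^sub>m m) x i - mat_act m A x i"
      using that Ac by (simp add: mat_act_def left_diff_distrib sum_subtractf)
    then show ?thesis
      using act_plus[OF minus_carrier_mat[OF Ac] _ that, of E "1\<^sub>m m" x] actE[OF that, of x] act_one[OF that, of x]
      by (simp add: E_def)
  qed
  have below: "x i \<le> 0" if ker: "\<And>i. i < m \<Longrightarrow> x i - mat_act m A x i + x 0 = 0" and x0: "x 0 = 0"
    and i: "i < m" for x i
  proof -
    have "Max (x ` {..<m}) \<in> x ` {..<m}" using m by (intro Max_in) auto
    then obtain k where k: "k < m" "Max (x ` {..<m}) = x k" by auto
    have mx: "x j \<le> x k" if "j < m" for j using that unfolding k(2)[symmetric] by (intro Max_ge) auto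
    have "\<exists>y\<in>{..<m} \<inter> {0}. x y = x k"
    proof (rule chain.maximum_principle[where t = 0])
      show "x j \<le> chain.step x j" if "j \<in> {..<m} - {0}" for j
        using that ker[of j] x0 step[of j x] by simp
    qed (use k mx m in auto)
    then show "x i \<le> 0" using x0 mx[OF i] by auto
  qed
  have const: "x 0 \<le> 0" if ker: "\<And>i. i < m \<Longrightarrow> x i - mat_act m A x i + x 0 = 0" for x
  proof -
    have "Max (x ` {..<m}) \<in> x ` {..<m}" using m by (intro Max_in) auto
    then obtain k where k: "k < m" "Max (x ` {..<m}) = x k" by auto
    have mx: "x j \<le> x k" if "j < m" for j using that unfolding k(2)[symmetric] by (intro Max_ge) auto
    have "mat_act m A x k \<le> mat_act m A (\<lambda>_. x k * 1) k" using mx by (intro act_mono[OF A k(1)]) auto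
    also have "\<dots> = x k" unfolding act_cmult by (simp add: one k)
    finally show ?thesis using ker[OF k(1)] by simp
  qed
  obtain S where S: "S \<in> carrier_mat m m" "?Q * S = 1\<^sub>m m"
  proof (rule inverse_if_injective[OF Qc])
    fix x assume x: "x \<in> carrier_vec m" "?Q *\<^sub>v x = 0\<^sub>v m"
    have ker: "x $ i - mat_act m A (($) x) i + x $ 0 = 0" if "i < m" for i
      using mult_vec_entry[OF Qc x(1) that] actQ[OF that, of "($) x"] x(2) that by simp
    have ker': "- 1 * x $ i - mat_act m A (\<lambda>i. - 1 * x $ i) i + - 1 * x $ 0 = 0" if "i < m" for i
      using ker[OF that] unfolding act_cmult by simp
    have 0: "x $ 0 = 0" using const[of "($) x"] const[of "\<lambda>i. - 1 * x $ i"] ker ker' by force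
    have "x $ i \<le> 0" "- 1 * x $ i \<le> 0" if "i < m" for i
      using below[of "($) x" i] below[of "\<lambda>i. - 1 * x $ i" i] ker ker' 0 that by force+
    then have "x $ i = 0" if "i < m" for i using that by (simp add: order_antisym)
    then show "x = 0\<^sub>v m" using x(1) by (intro eq_vecI) auto
  qed
  let ?w = "mat_act m S b"
  show thesis
  proof (rule that)
    fix i assume i: "i < m"
    have "mat_act m ?Q ?w i = b i" using act_mult[OF Qc S(1) i, of b] S(2) act_one[OF i] by simp
    then show "?w i - mat_act m A ?w i = b i + (- ?w 0)" using actQ[OF i, of ?w] by simp
  qed
qed

text \<open>With \<open>\<mu> = 1 - e\<close> and \<open>v = 1 - e w\<close>, the difference of the two sides has the expansion
  \<open>e d + O(e\<^sup>2)\<close>: the constant term vanishes because \<open>A 1 = 1\<close>, and the Poisson equation was chosen to make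
  the linear term independent of the phase.\<close>

lemma strict_supersolution:
  assumes Am: "nonneg_mat m Am" and A0: "nonneg_mat m A0" and A1: "nonneg_mat m A1"
    and one: "\<And>i. i < m \<Longrightarrow> mat_act m (Am + A0 + A1) (\<lambda>_. 1) i = 1"
    and w: "\<And>i. i < m \<Longrightarrow> w i - mat_act m (Am + A0 + A1) w i = mat_act m A1 (\<lambda>_. 1) i - mat_act m Am (\<lambda>_. 1) i + d"
    and d: "d \<noteq> 0"
  obtains \<mu> v where "0 < \<mu>" "\<And>i. i < m \<Longrightarrow> 0 < v i"
    "\<And>i. i < m \<Longrightarrow> mat_act m Am v i + \<mu> * mat_act m A0 v i + \<mu>\<^sup>2 * mat_act m A1 v i < \<mu> * v i"
proof -
  note c = Am[THEN nonneg_matD(1)] A0[THEN nonneg_matD(1)] A1[THEN nonneg_matD(1)]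
  have split: "mat_act m (Am + A0 + A1) x i = mat_act m Am x i + mat_act m A0 x i + mat_act m A1 x i" if "i < m" for x i
    using c that by (simp add: act_plus)
  define r where "r i = \<bar>mat_act m A0 w i\<bar> + \<bar>mat_act m A1 (\<lambda>_. 1) i\<bar> + 3 * \<bar>mat_act m A1 w i\<bar> + \<bar>w i\<bar>" for i
  define C where "C = (\<Sum>i<m. r i)"
  have rC: "r i \<le> C" if "i < m" for i
    unfolding C_def using that by (intro member_le_sum) (auto simp: r_def)
  have C0: "0 \<le> C" unfolding C_def by (intro sum_nonneg) (auto simp: r_def)
  \<comment> \<open>\<open>C\<close> bounds the quadratic remainder and \<open>w\<close>; this step size makes \<open>e\<close>, \<open>e w\<close> and the
    relative remainder \<open>t C\<close> less than 1\<close>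
  define t where "t = 1 / ((1 + C) * (1 + \<bar>d\<bar>))"
  have den: "0 < (1 + C) * (1 + \<bar>d\<bar>)" using C0 by (intro mult_pos_pos) auto
  have t: "0 < t" "t * C < 1" "\<bar>d\<bar> * t < 1" "\<bar>d\<bar> * t * C < 1"
  proof -
    show "0 < t" unfolding t_def using den by simp
    have "t * C = C / ((1 + C) * (1 + \<bar>d\<bar>))" "\<bar>d\<bar> * t = \<bar>d\<bar> / ((1 + C) * (1 + \<bar>d\<bar>))"
      "\<bar>d\<bar> * t * C = \<bar>d\<bar> * C / ((1 + C) * (1 + \<bar>d\<bar>))" by (simp_all add: t_def)
    moreover have "0 \<le> C * \<bar>d\<bar>" using C0 by simp
    ultimately show "t * C < 1" "\<bar>d\<bar> * t < 1" "\<bar>d\<bar> * t * C < 1"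
      using den C0 by (simp_all add: distrib_left distrib_right add_pos_nonneg)
  qed
  define e where "e = - d * t"
  have ae: "\<bar>e\<bar> = \<bar>d\<bar> * t" using t(1) by (simp add: e_def abs_mult)
  then have e1: "\<bar>e\<bar> < 1" using t by simp
  let ?mu = "1 - e" and ?v = "\<lambda>i. 1 - e * w i"
  show thesis
  proof (rule that)
    show "0 < ?mu" using e1 by simp
    fix i assume i: "i < m"
    have "\<bar>e * w i\<bar> \<le> \<bar>d\<bar> * t * C"
      unfolding abs_mult ae using rC[OF i] t(1) by (intro mult_left_mono) (auto simp: r_def)
    then show "0 < ?v i" using t by linarith
    let ?sm = "mat_act m Am (\<lambda>_. 1) i" and ?s0 = "mat_act m A0 (\<lambda>_. 1) i" and ?s1 = "mat_act m A1 (\<lambda>_. 1) i"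
    let ?wm = "mat_act m Am w i" and ?w0 = "mat_act m A0 w i" and ?w1 = "mat_act m A1 w i"
    have s: "?sm = 1 - ?s0 - ?s1" using one[OF i] split[OF i] by simp
    have ww: "?wm = w i - ?w0 - ?w1 - ?s1 + ?sm - d" using w[OF i] split[OF i] by simp
    have "mat_act m Am ?v i + ?mu * mat_act m A0 ?v i + ?mu\<^sup>2 * mat_act m A1 ?v i - ?mu * ?v i
        = (?sm - e * ?wm) + (1 - e) * (?s0 - e * ?w0) + (1 - e)\<^sup>2 * (?s1 - e * ?w1) - (1 - e) * (1 - e * w i)"
      by (simp add: act_diff act_cmult)
    also have "\<dots> = e * d + e\<^sup>2 * (?w0 + ?s1 + 2 * ?w1 - e * ?w1 - w i)"
      unfolding ww s by (simp add: power2_eq_square algebra_simps)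
    also have "\<dots> \<le> e * d + e\<^sup>2 * C"
    proof -
      have "\<bar>e * ?w1\<bar> \<le> 1 * \<bar>?w1\<bar>" unfolding abs_mult using e1 by (intro mult_right_mono) auto
      then have "?w0 + ?s1 + 2 * ?w1 - e * ?w1 - w i \<le> r i" unfolding r_def by linarith
      then show ?thesis using rC[OF i] by (intro add_left_mono mult_left_mono) auto
    qed
    also have "\<dots> = d\<^sup>2 * t * (t * C - 1)" by (simp add: e_def power2_eq_square algebra_simps)
    also have "\<dots> < 0" using d t by (intro mult_pos_neg) auto
    finally show "mat_act m Am ?v i + ?mu * mat_act m A0 ?v i + ?mu\<^sup>2 * mat_act m A1 ?v i < ?mu * ?v i" by simp
  qed
qed

text \<open>For zero drift the function \<open>V(n, j) = n + w j + C\<close> is harmonic at all levels \<open>n \<ge> 1\<close>;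
  the constant \<open>C\<close> only makes it nonnegative.\<close>

lemma strict_supersolution_if_not_null_recurrent:
  assumes m: "m \<ge> 1"
    and nn: "nonneg_mat m Am" "nonneg_mat m A0" "nonneg_mat m A1"
    and stochastic: "stochastic_on (qbd_states m) (qbd_matrix m B Am A0 A1)"
    and irreducible_P: "irreducible_on (qbd_states m) (qbd_matrix m B Am A0 A1)"
    and irreducible_A: "irreducible_matrix m (Am + A0 + A1)"
    and nnr: "\<not> null_recurrent_chain (qbd_states m) (qbd_matrix m B Am A0 A1)"
  obtains \<mu> v where "0 < \<mu>" "\<And>i. i < m \<Longrightarrow> 0 < v i"
    "\<And>i. i < m \<Longrightarrow> mat_act m Am v i + \<mu> * mat_act m A0 v i + \<mu>\<^sup>2 * mat_act m A1 v i < \<mu> * v i"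
proof -
  let ?S = "qbd_states m" and ?p = "qbd_matrix m B Am A0 A1" and ?A = "Am + A0 + A1"
  have near: "fst u \<le> fst x + 1" if "x \<in> ?S" "u \<in> ?S" "?p x u \<noteq> 0" for x u
    using that by (auto simp: qbd_matrix_def qbd_block_def qbd_states_def split: if_splits)
  interpret chain: locally_finite_chain ?S ?p
  proof
    fix x assume x: "x \<in> ?S"
    have "{u \<in> ?S. ?p x u \<noteq> 0} \<subseteq> {..fst x + 1} \<times> {..<m}"
      using near[OF x] by (auto simp: qbd_states_def)
    then show "finite {u \<in> ?S. ?p x u \<noteq> 0}" by (rule finite_subset) simp
  qed (use stochastic irreducible_P in auto)
  have step: "chain.step f (Suc n, i)
      = mat_act m Am (\<lambda>j. f (n, j)) i + mat_act m A0 (\<lambda>j. f (Suc n, j)) i + mat_act m A1 (\<lambda>j. f (Suc (Suc n), j)) i"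
    if i: "i < m" for f n i
  proof -
    have "chain.step f (Suc n, i) = (\<Sum>u\<in>{n, Suc n, Suc (Suc n)} \<times> {..<m}. ?p (Suc n, i) u * f u)"
    proof (rule chain.step_eq_sum)
      show "chain.succs (Suc n, i) \<subseteq> {n, Suc n, Suc (Suc n)} \<times> {..<m}"
        using i unfolding chain.succs_def by (auto simp: qbd_matrix_def qbd_block_def qbd_states_def split: if_splits)
    qed (use i in \<open>auto simp: qbd_states_def\<close>)
    also have "\<dots> = (\<Sum>k\<in>{n, Suc n, Suc (Suc n)}. \<Sum>j<m. ?p (Suc n, i) (k, j) * f (k, j))"
      by (simp add: sum.cartesian_product del: sum.insert)
    finally show ?thesis by (simp add: mat_act_def qbd_matrix_def qbd_block_def)
  qed
  note c = nn[THEN nonneg_matD(1)]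
  have nA: "nonneg_mat m ?A" by (intro nonneg_plus nn)
  have split: "mat_act m ?A x i = mat_act m Am x i + mat_act m A0 x i + mat_act m A1 x i" if "i < m" for x i
    using c that by (simp add: act_plus)
  have one: "mat_act m ?A (\<lambda>_. 1) i = 1" if i: "i < m" for i
  proof -
    have "chain.step (\<lambda>_. 1) (Suc 0, i) = 1" using i by (intro chain.step_const) (auto simp: qbd_states_def)
    then show ?thesis using step[OF i, of "\<lambda>_. 1"] split[OF i] by simp
  qed
  obtain w d where w: "\<And>i. i < m \<Longrightarrow> w i - mat_act m ?A w i = (mat_act m A1 (\<lambda>_. 1) i - mat_act m Am (\<lambda>_. 1) i) + d"
    using poisson_equation_solvable[OF _ nA one irreducible_A, where b = "\<lambda>i. mat_act m A1 (\<lambda>_. 1) i - mat_act m Am (\<lambda>_. 1) i"] m by auto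
  have "d \<noteq> 0"
  proof
    assume d: "d = 0"
    define C where "C = (\<Sum>i<m. \<bar>w i\<bar>)"
    have wC: "\<bar>w i\<bar> \<le> C" if "i < m" for i
      unfolding C_def using that by (intro member_le_sum) auto
    define V where "V x = real (fst x) + w (snd x) + C" for x :: "nat \<times> nat"
    have "null_recurrent_chain ?S ?p"
    proof (rule chain.null_recurrent_if_harmonic[of V "{0} \<times> {..<m}" "1 + 2 * C"])
      show "infinite ?S"
        using m by (auto simp: qbd_states_def finite_cartesian_product_iff lessThan_empty_iff)
      show "0 \<le> V x" if "x \<in> ?S" for x
        using wC[of "snd x"] that by (auto simp: V_def qbd_states_def)
      show "finite {x \<in> ?S. V x \<le> c}" for c
      proof (rule finite_subset)
        show "{x \<in> ?S. V x \<le> c} \<subseteq> {..nat \<lfloor>c\<rfloor>} \<times> {..<m}"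
        proof clarify
          fix n i assume x: "(n, i) \<in> ?S" "V (n, i) \<le> c"
          then have "real n \<le> c" using wC[of i] by (auto simp: V_def qbd_states_def)
          then show "n \<in> {..nat \<lfloor>c\<rfloor>} \<and> i \<in> {..<m}" using x(1)
            by (auto simp: qbd_states_def le_nat_floor)
        qed
      qed simp
      show "chain.step V x = V x" if x: "x \<in> ?S - {0} \<times> {..<m}" for x
      proof -
        obtain n i where xn: "x = (Suc n, i)" and i: "i < m"
          using x by (cases x; cases "fst x") (auto simp: qbd_states_def)
        have V1: "(\<lambda>j. V (n, j)) = (\<lambda>j. (w j + (real n + 1 + C) * 1) - 1)"
          "(\<lambda>j. V (Suc n, j)) = (\<lambda>j. w j + (real n + 1 + C) * 1)"
          "(\<lambda>j. V (Suc (Suc n), j)) = (\<lambda>j. (w j + (real n + 1 + C) * 1) + 1)"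
          by (auto simp: V_def)
        have "chain.step V x = mat_act m ?A w i + (real n + 1 + C) * mat_act m ?A (\<lambda>_. 1) i
            + (mat_act m A1 (\<lambda>_. 1) i - mat_act m Am (\<lambda>_. 1) i)"
          unfolding xn step[OF i] V1 split[OF i] act_diff act_add act_cmult by (simp add: algebra_simps)
        also have "\<dots> = V x" using w[OF i] d one[OF i] by (simp add: xn V_def)
        finally show ?thesis .
      qed
      show "V u \<le> V x + (1 + 2 * C)" if "x \<in> ?S" "u \<in> chain.succs x" for x u
      proof -
        have "fst u \<le> fst x + 1" "snd u < m" "snd x < m"
          using that near[of x u] unfolding chain.succs_def by (auto simp: qbd_states_def)
        then show ?thesis using wC[of "snd u"] wC[of "snd x"] unfolding V_def by linarith
      qed
    qed (auto simp: qbd_states_def)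
    then show False using nnr by simp
  qed
  from strict_supersolution[OF nn one w this] that show thesis by blast
qed

section \<open>Minimal nonnegative solvents\<close>

text \<open>All sizes are instantiated to \<open>m\<close>, so that the simplifier can discharge the carrier premises for
  composite factors.\<close>

lemmas square_algebra =
  mult_add_distrib_mat[of _ m m _ m] add_mult_distrib_mat[of _ m m _ _ m]
  mult_minus_distrib_mat[of _ m m _ m] minus_mult_distrib_mat[of _ m m _ _ m]
  assoc_mult_mat[of _ m m _ m _ m] assoc_add_mat[of _ m m] 
  mult_carrier_mat[of _ m m _ m] left_mult_one_mat[of _ m m] right_mult_one_mat[of _ m m] for m

text \<open>The fixed point form, which is the one that the monotone iteration uses.\<close>

lemma solvent_iff:
  fixes D C Up Y :: "real mat"
  assumes "D \<in> carrier_mat m m" "C \<in> carrier_mat m m" "Up \<in> carrier_mat m m" "Y \<in> carrier_mat m m"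
  shows "D + (C - 1\<^sub>m m) * Y + Up * Y ^\<^sub>m 2 = 0\<^sub>m m m \<longleftrightarrow> Y = D + C * Y + Up * (Y * Y)"
proof -
  have *: "(C - 1\<^sub>m m) * Y = C * Y - Y" "Y ^\<^sub>m 2 = Y * Y"
    using assms by (simp_all add: numeral_2_eq_2 minus_mult_distrib_mat[of _ m m _ _ m])
  show ?thesis
    unfolding * using assms
    by (auto simp: mat_eq_iff algebra_simps simp del: index_mult_mat(1))
qed

lemma left_solvent_iff:
  fixes D C Up Y :: "real mat"
  assumes "D \<in> carrier_mat m m" "C \<in> carrier_mat m m" "Up \<in> carrier_mat m m" "Y \<in> carrier_mat m m"
  shows "Up + Y * (C - 1\<^sub>m m) + Y ^\<^sub>m 2 * D = 0\<^sub>m m m \<longleftrightarrow> Y = Up + Y * C + Y * Y * D"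
proof -
  have *: "Y * (C - 1\<^sub>m m) = Y * C - Y" "Y ^\<^sub>m 2 = Y * Y"
    using assms by (simp_all add: numeral_2_eq_2 mult_minus_distrib_mat[of _ m m _ m])
  show ?thesis
    unfolding * using assms
    by (auto simp: mat_eq_iff algebra_simps simp del: index_mult_mat(1))
qed

definition solvent_iter :: "nat \<Rightarrow> real mat \<Rightarrow> real mat \<Rightarrow> real mat \<Rightarrow> nat \<Rightarrow> real mat" where
  "solvent_iter m D C Up k = ((\<lambda>Y. D + C * Y + Up * (Y * Y)) ^^ k) (0\<^sub>m m m)"

lemma solvent_iter_simps:
  "solvent_iter m D C Up 0 = 0\<^sub>m m m"
  "solvent_iter m D C Up (Suc k) = D + C * solvent_iter m D C Up k
     + Up * (solvent_iter m D C Up k * solvent_iter m D C Up k)"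
  by (simp_all add: solvent_iter_def)

lemma add_mono_mat:
  fixes A B C D :: "real mat"
  assumes "A \<le> B" "C \<le> D" "A \<in> carrier_mat m m" "B \<in> carrier_mat m m"
    "C \<in> carrier_mat m m" "D \<in> carrier_mat m m"
  shows "A + C \<le> B + D"
proof (rule le_matI[of _ m])
  fix i j assume ij: "i < m" "j < m"
  show "(A + C) $$ (i, j) \<le> (B + D) $$ (i, j)"
    using le_matD[OF assms(1,4) ij] le_matD[OF assms(2,6) ij] assms ij by simp
qed (use assms in auto)

lemma mult_mono_mat:
  fixes A B C D :: "real mat"
  assumes "A \<le> B" "C \<le> D" and n: "nonneg_mat m A" "nonneg_mat m B" "nonneg_mat m C" "nonneg_mat m D"
  shows "A * C \<le> B * D"
  using mult_right_mono_mat[OF n(3) n(1)[THEN nonneg_matD(1)] n(2)[THEN nonneg_matD(1)] assms(1)]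
    mult_left_mono_mat[OF n(2) n(3)[THEN nonneg_matD(1)] n(4)[THEN nonneg_matD(1)] assms(2)]
  by (rule order_trans)

lemma nonneg_zero: "nonneg_mat m (0\<^sub>m m m)"
  by (simp add: nonneg_mat_def)

lemma solvent_map_mono:
  assumes nn: "nonneg_mat m D" "nonneg_mat m C" "nonneg_mat m Up" and X: "nonneg_mat m X" and Y: "nonneg_mat m Y"
    and le: "X \<le> Y"
  shows "D + C * X + Up * (X * X) \<le> D + C * Y + Up * (Y * Y)"
proof -
  note c = nn[THEN nonneg_matD(1)] nonneg_matD(1)[OF X] nonneg_matD(1)[OF Y]
  show ?thesis
    by (intro add_mono_mat[of _ _ _ _ m] mult_mono_mat[of _ _ _ _ m] le order_refl nonneg_mult nn X Y
        mult_carrier_mat[of _ m m] add_carrier_mat[of _ m m] c)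
qed

lemma solvent_iter_nonneg:
  assumes nn: "nonneg_mat m D" "nonneg_mat m C" "nonneg_mat m Up"
  shows "nonneg_mat m (solvent_iter m D C Up k)"
  by (induction k) (simp_all add: solvent_iter_simps nonneg_zero nonneg_plus nonneg_mult nn)

lemma solvent_iter_mono:
  assumes nn: "nonneg_mat m D" "nonneg_mat m C" "nonneg_mat m Up"
  shows "solvent_iter m D C Up k \<le> solvent_iter m D C Up (Suc k)"
proof (induction k)
  case 0
  show ?case
    using solvent_iter_nonneg[OF nn, of "Suc 0"] by (simp add: solvent_iter_def nonneg_mat_def)
next
  case (Suc k)
  show ?case
    by (subst (1 2) solvent_iter_simps(2)) (intro solvent_map_mono[where m = m] solvent_iter_nonneg nn Suc)
qed

text \<open>The increasing iteration from 0 stays below every nonnegative solution, and its limit is one.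
  So bounds that the iteration preserves pass to the minimal solution.\<close>

lemma minimal_solvent_limit:
  assumes nn: "nonneg_mat m D" "nonneg_mat m C" "nonneg_mat m Up"
    and G: "minimal_nonneg_solution m (\<lambda>Y. D + (C - 1\<^sub>m m) * Y + Up * Y ^\<^sub>m 2) G"
    and ij: "i < m" "j < m"
  shows "(\<lambda>k. solvent_iter m D C Up k $$ (i, j)) \<longlonglongrightarrow> G $$ (i, j)"
proof -
  let ?X = "solvent_iter m D C Up"
  note c = nn[THEN nonneg_matD(1)]
  have Gn: "nonneg_mat m G" using G by (simp add: minimal_nonneg_solution_def nonneg_mat_def)
  note Gc = nonneg_matD(1)[OF Gn]
  note Xn = solvent_iter_nonneg[OF nn]
  note Xc = nonneg_matD(1)[OF Xn]
  have G_eq: "G = D + C * G + Up * (G * G)"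
    using G solvent_iff[OF c Gc] by (simp add: minimal_nonneg_solution_def)
  have X_le: "?X k \<le> G" for k
  proof (induction k)
    case 0
    show ?case using Gn by (simp add: solvent_iter_simps nonneg_mat_def)
  next
    case (Suc k)
    show ?case
      unfolding solvent_iter_simps(2)
      by (subst G_eq) (rule solvent_map_mono[OF nn Xn Gn Suc])
  qed
  have "\<exists>l. (\<lambda>k. ?X k $$ (i, j)) \<longlonglongrightarrow> l" if ij: "i < m" "j < m" for i j
  proof -
    have "incseq (\<lambda>k. ?X k $$ (i, j))"
      by (intro incseq_SucI le_matD[OF solvent_iter_mono[OF nn] Xc ij])
    moreover have "\<forall>k. ?X k $$ (i, j) \<le> G $$ (i, j)" using le_matD[OF X_le Gc ij] by blast
    ultimately show ?thesis by (metis incseq_convergent)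
  qed
  then obtain l where l: "\<And>i j. i < m \<Longrightarrow> j < m \<Longrightarrow> (\<lambda>k. ?X k $$ (i, j)) \<longlonglongrightarrow> l i j" by metis
  define Y where "Y = mat m m (\<lambda>(i, j). l i j)"
  have Yc: "Y \<in> carrier_mat m m" by (simp add: Y_def)
  have lY: "(\<lambda>k. ?X k $$ (i, j)) \<longlonglongrightarrow> Y $$ (i, j)" if "i < m" "j < m" for i j
    using l[OF that] that by (simp add: Y_def)
  have "Y = D + C * Y + Up * (Y * Y)"
  proof (rule eq_matI)
    fix i j assume "i < dim_row (D + C * Y + Up * (Y * Y))" "j < dim_col (D + C * Y + Up * (Y * Y))"
    then have ij: "i < m" "j < m" using c Yc by auto
    have ent: "(D + C * Z + Up * (Z * Z)) $$ (i, j) = D $$ (i, j) + (\<Sum>k<m. C $$ (i, k) * Z $$ (k, j))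
        + (\<Sum>k<m. Up $$ (i, k) * (\<Sum>q<m. Z $$ (k, q) * Z $$ (q, j)))" if Z: "Z \<in> carrier_mat m m" for Z
    proof -
      have "(D + C * Z + Up * (Z * Z)) $$ (i, j) = D $$ (i, j) + (C * Z) $$ (i, j) + (Up * (Z * Z)) $$ (i, j)"
        using c Z ij by (simp del: index_mult_mat(1))
      also have "(Up * (Z * Z)) $$ (i, j) = (\<Sum>k<m. Up $$ (i, k) * (Z * Z) $$ (k, j))"
        by (rule mult_entry[OF c(3) mult_carrier_mat[OF Z Z] ij])
      also have "\<dots> = (\<Sum>k<m. Up $$ (i, k) * (\<Sum>q<m. Z $$ (k, q) * Z $$ (q, j)))"
        by (rule sum.cong) (use mult_entry[OF Z Z _ ij(2)] in auto)
      finally show ?thesis by (simp only: mult_entry[OF c(2) Z ij])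
    qed
    have "(\<lambda>k. ?X (Suc k) $$ (i, j)) \<longlonglongrightarrow> (D + C * Y + Up * (Y * Y)) $$ (i, j)"
      unfolding solvent_iter_simps ent[OF Xc] ent[OF Yc]
      by (intro tendsto_intros lY ij) simp_all
    then show "Y $$ (i, j) = (D + C * Y + Up * (Y * Y)) $$ (i, j)"
      using LIMSEQ_Suc[OF lY[OF ij]] LIMSEQ_unique by blast
  qed (use c Yc in auto)
  then have sol: "D + (C - 1\<^sub>m m) * Y + Up * Y ^\<^sub>m 2 = 0\<^sub>m m m"
    using solvent_iff[OF c Yc] by simp
  have "nonneg_mat m Y"
  proof (rule nonneg_matI[OF Yc])
    fix i j assume ij: "i < m" "j < m"
    show "0 \<le> Y $$ (i, j)"
      by (rule LIMSEQ_le_const[OF lY[OF ij]]) (use nonneg_matD(2)[OF Xn ij] in blast)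
  qed
  then have "G \<le> Y" using G sol Yc by (simp add: minimal_nonneg_solution_def nonneg_mat_def)
  then have "G $$ (i, j) \<le> Y $$ (i, j)" using le_matD Yc ij by blast
  moreover have "Y $$ (i, j) \<le> G $$ (i, j)"
    by (rule LIMSEQ_le_const2[OF lY[OF ij]]) (use le_matD[OF X_le Gc ij] in blast)
  ultimately have "Y $$ (i, j) = G $$ (i, j)" by simp
  then show ?thesis using lY[OF ij] by simp
qed

lemma act_tendsto:
  assumes "i < m" "\<And>j. j < m \<Longrightarrow> (\<lambda>k. X k $$ (i, j)) \<longlonglongrightarrow> G $$ (i, j)"
  shows "(\<lambda>k. mat_act m (X k) v i) \<longlonglongrightarrow> mat_act m G v i"
  unfolding mat_act_def by (intro tendsto_intros assms) auto

text \<open>If \<open>Y v \<le> \<mu> v\<close>, then the next iterate \<open>D + C Y + Up Y\<^sup>2\<close> satisfies the same bound, strictly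
  by the assumption on \<open>v\<close>. The statement for \<open>C + Up G\<close> is the assumption divided by \<open>\<mu>\<close>, after
  replacing \<open>G v\<close> by \<open>\<mu> v\<close> and dropping \<open>D v \<ge> 0\<close>.\<close>

lemma minimal_solvent_supersolution:
  assumes nn: "nonneg_mat m D" "nonneg_mat m C" "nonneg_mat m Up"
    and G: "minimal_nonneg_solution m (\<lambda>Y. D + (C - 1\<^sub>m m) * Y + Up * Y ^\<^sub>m 2) G"
    and \<mu>: "0 < \<mu>" and v: "\<And>i. i < m \<Longrightarrow> 0 < v i"
    and sup: "\<And>i. i < m \<Longrightarrow> mat_act m D v i + \<mu> * mat_act m C v i + \<mu>\<^sup>2 * mat_act m Up v i < \<mu> * v i"
  shows "\<And>i. i < m \<Longrightarrow> mat_act m G v i < \<mu> * v i"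
    "\<And>i. i < m \<Longrightarrow> mat_act m (C + Up * G) v i < v i"
proof -
  let ?X = "solvent_iter m D C Up"
  note c = nn[THEN nonneg_matD(1)]
  have Gn: "nonneg_mat m G" using G by (simp add: minimal_nonneg_solution_def nonneg_mat_def)
  note Gc = nonneg_matD(1)[OF Gn]
  have G_eq: "G = D + C * G + Up * (G * G)"
    using G solvent_iff[OF c Gc] by (simp add: minimal_nonneg_solution_def)
  have image: "mat_act m (D + C * Y + Up * (Y * Y)) v i \<le> mat_act m D v i + \<mu> * mat_act m C v i + \<mu>\<^sup>2 * mat_act m Up v i"
    if Y: "nonneg_mat m Y" and Yv: "\<And>i. i < m \<Longrightarrow> mat_act m Y v i \<le> \<mu> * v i" and i: "i < m" for Y i
  proof -
    note Yc = nonneg_matD(1)[OF Y]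
    have YY: "mat_act m Y (mat_act m Y v) i \<le> \<mu>\<^sup>2 * v i" if "i < m" for i
    proof -
      have "mat_act m Y (mat_act m Y v) i \<le> mat_act m Y (\<lambda>i. \<mu> * v i) i" by (rule act_mono[OF Y that Yv])
      also have "\<dots> \<le> \<mu> * (\<mu> * v i)"
        unfolding act_cmult using \<mu> Yv[OF that] by (intro mult_left_mono) auto
      finally show ?thesis by (simp add: power2_eq_square mult.assoc)
    qed
    have "mat_act m (D + C * Y + Up * (Y * Y)) v i
        = mat_act m D v i + mat_act m C (mat_act m Y v) i + mat_act m Up (mat_act m (Y * Y) v) i"
      using c Yc i by (simp add: act_plus act_mult)
    also have "mat_act m Up (mat_act m (Y * Y) v) i = mat_act m Up (mat_act m Y (mat_act m Y v)) i"
      by (rule act_cong) (rule act_mult[OF Yc Yc])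
    also have "\<dots> \<le> mat_act m Up (\<lambda>i. \<mu>\<^sup>2 * v i) i" by (rule act_mono[OF nn(3) i YY])
    also have "mat_act m C (mat_act m Y v) i \<le> mat_act m C (\<lambda>i. \<mu> * v i) i" by (rule act_mono[OF nn(2) i Yv])
    finally show ?thesis by (simp add: act_cmult)
  qed
  have X_le: "mat_act m (?X k) v i \<le> \<mu> * v i" if "i < m" for k i
    using that
  proof (induction k arbitrary: i)
    case 0
    then show ?case using \<mu> v[OF 0] by (simp add: solvent_iter_simps act_zero)
  next
    case (Suc k)
    show ?case
      unfolding solvent_iter_simps(2)
      using image[OF solvent_iter_nonneg[OF nn] Suc.IH Suc.prems] sup[OF Suc.prems] by simp
  qed
  have G_le: "mat_act m G v i \<le> \<mu> * v i" if "i < m" for i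
    by (rule LIMSEQ_le_const2[OF act_tendsto[OF that minimal_solvent_limit[OF nn G that]]])
      (use X_le[OF that] in blast)+
  show "mat_act m G v i < \<mu> * v i" if "i < m" for i
    using image[OF Gn G_le that] sup[OF that] G_eq by simp
  show "mat_act m (C + Up * G) v i < v i" if i: "i < m" for i
  proof -
    have "mat_act m Up (mat_act m G v) i \<le> mat_act m Up (\<lambda>i. \<mu> * v i) i" by (rule act_mono[OF nn(3) i G_le])
    then have "mat_act m (C + Up * G) v i \<le> mat_act m C v i + \<mu> * mat_act m Up v i"
      using c Gc i by (simp add: act_plus act_mult act_cmult)
    moreover have "\<mu> * (mat_act m C v i + \<mu> * mat_act m Up v i) < \<mu> * v i"
      using sup[OF i] act_nonneg[OF nn(1) i, of v] v
      by (simp add: power2_eq_square algebra_simps less_imp_le)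
    ultimately show ?thesis using \<mu> by (simp add: mult_less_cancel_left_pos)
  qed
qed

text \<open>The two descriptions of \<open>U\<close> agree. One inequality is the minimality of \<open>R\<close>, as \<open>A1 S\<close> solves
  its equation. For the other, \<open>A1 X \<le> R Am\<close> is carried along the iteration \<open>X\<close> for \<open>G\<close>, using
  \<open>A1 = R (I - A0 - R Am)\<close>; this avoids inverting \<open>I - A0 - R Am\<close>, which is not yet known to be
  nonsingular.\<close>

lemma canonical_factorization:
  assumes nn: "nonneg_mat m Am" "nonneg_mat m A0" "nonneg_mat m A1"
    and G: "minimal_nonneg_solution m (\<lambda>Y. Am + (A0 - 1\<^sub>m m) * Y + A1 * Y ^\<^sub>m 2) G"
    and R: "minimal_nonneg_solution m (\<lambda>Y. A1 + Y * (A0 - 1\<^sub>m m) + Y ^\<^sub>m 2 * Am) R"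
    and S: "nonneg_mat m S" "S * (1\<^sub>m m - (A0 + A1 * G)) = 1\<^sub>m m"
      "(1\<^sub>m m - (A0 + A1 * G)) * S = 1\<^sub>m m"
  shows "A0 + R * Am = A0 + A1 * G" "R = A1 * S"
proof -
  let ?X = "solvent_iter m Am A0 A1"
  note c = nn[THEN nonneg_matD(1)]
  have Gn: "nonneg_mat m G" using G by (simp add: minimal_nonneg_solution_def nonneg_mat_def)
  have Rn: "nonneg_mat m R" using R by (simp add: minimal_nonneg_solution_def nonneg_mat_def)
  note Gc = nonneg_matD(1)[OF Gn] and Rc = nonneg_matD(1)[OF Rn] and Sc = nonneg_matD(1)[OF S(1)]
  note cs = c Gc Rc Sc
  have G_eq: "G = Am + A0 * G + A1 * (G * G)"
    using G solvent_iff[OF c Gc] by (simp add: minimal_nonneg_solution_def)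
  have R_eq: "R = A1 + R * A0 + R * R * Am"
    using R left_solvent_iff[OF c Rc] by (simp add: minimal_nonneg_solution_def)
  let ?T = "A0 + A1 * G"
  have Tc: "?T \<in> carrier_mat m m" using cs by simp
  have G_SAm: "G = S * Am"
  proof -
    have "(1\<^sub>m m - ?T) * G = G - A0 * G - A1 * (G * G)"
      using cs by (simp add: square_algebra[where m = m] mat_eq_iff algebra_simps del: index_mult_mat(1))
    also have "\<dots> = Am"
      using cs arg_cong[OF G_eq, of "\<lambda>Z. Z $$ (_, _)"]
      by (auto simp: mat_eq_iff simp del: index_mult_mat(1))
    finally have "S * ((1\<^sub>m m - ?T) * G) = S * Am" by simp
    then show ?thesis
      using cs Tc S(2) by (simp add: assoc_mult_mat[of S m m "1\<^sub>m m - ?T" m G m, symmetric] minus_carrier_mat del: assoc_mult_mat)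
  qed
  have upper: "A1 * ?X k \<le> R * Am" for k
  proof (induction k)
    case 0
    show ?case using cs nonneg_mult[OF Rn nn(1)] by (simp add: solvent_iter_simps nonneg_mat_def)
  next
    case (Suc k)
    let ?Y = "?X (Suc k)"
    note Xn = solvent_iter_nonneg[OF nn, of k] and Yn = solvent_iter_nonneg[OF nn, of "Suc k"]
    note Xc = nonneg_matD(1)[OF Xn] and Yc = nonneg_matD(1)[OF Yn]
    have "?Y = Am + A0 * ?X k + A1 * ?X k * ?X k"
      using cs Xc by (simp add: solvent_iter_simps)
    also have "\<dots> \<le> Am + A0 * ?Y + R * Am * ?Y"
      by (intro add_mono_mat[of _ _ _ _ m] mult_mono_mat[of _ _ _ _ m] Suc order_refl solvent_iter_mono nn
          nonneg_mult Xn Yn Rn mult_carrier_mat[of _ m m] add_carrier_mat[of _ m m] c Rc Xc Yc)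
    finally have "R * ?Y \<le> R * (Am + A0 * ?Y + R * Am * ?Y)"
      by (intro mult_left_mono_mat[where m = m, OF Rn]) (use cs Yc in auto)
    also have "R * (Am + A0 * ?Y + R * Am * ?Y) = R * Am + R * A0 * ?Y + R * R * Am * ?Y"
      using cs Yc by (simp add: square_algebra[where m = m])
    finally have le: "R * ?Y \<le> R * Am + R * A0 * ?Y + R * R * Am * ?Y" .
    have "R * ?Y = (A1 + R * A0 + R * R * Am) * ?Y" using R_eq by simp
    also have "\<dots> = A1 * ?Y + R * A0 * ?Y + R * R * Am * ?Y"
      using cs Yc by (simp add: square_algebra[where m = m])
    finally have eq: "R * ?Y = A1 * ?Y + R * A0 * ?Y + R * R * Am * ?Y" .
    show ?case
    proof (rule le_matI[of _ m])
      fix i j assume ij: "i < m" "j < m"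
      have "(R * ?Y) $$ (i, j) \<le> (R * Am + R * A0 * ?Y + R * R * Am * ?Y) $$ (i, j)"
        by (rule le_matD[OF le _ ij]) (use cs Yc in \<open>simp add: square_algebra[where m = m]\<close>)
      then show "(A1 * ?Y) $$ (i, j) \<le> (R * Am) $$ (i, j)"
        unfolding eq using cs Yc ij by (simp del: index_mult_mat(1) assoc_mult_mat)
    qed (use cs Yc in auto)
  qed
  have le1: "A1 * G \<le> R * Am"
  proof (rule le_matI[of _ m])
    fix i j assume ij: "i < m" "j < m"
    have "(\<lambda>k. (A1 * ?X k) $$ (i, j)) \<longlonglongrightarrow> (A1 * G) $$ (i, j)"
      unfolding mult_entry[OF c(3) nonneg_matD(1)[OF solvent_iter_nonneg[OF nn]] ij] mult_entry[OF c(3) Gc ij]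
      by (intro tendsto_intros minimal_solvent_limit[OF nn G _ ij(2)]) simp
    then show "(A1 * G) $$ (i, j) \<le> (R * Am) $$ (i, j)"
      by (rule LIMSEQ_le_const2) (use le_matD[OF upper mult_carrier_mat[OF Rc c(1)] ij] in blast)
  qed (use cs in auto)
  have "A1 * S = A1 + A1 * S * A0 + A1 * S * (A1 * S) * Am"
  proof -
    have "A1 * (S * (1\<^sub>m m - ?T)) = A1" using S(2) c by simp
    moreover have "A1 * (S * (1\<^sub>m m - ?T)) = A1 * S - (A1 * S * A0 + A1 * S * (A1 * G))"
      using cs Tc by (simp add: square_algebra[where m = m] minus_carrier_mat)
    moreover have "A1 * S * (A1 * G) = A1 * S * (A1 * S) * Am"
      using cs by (subst G_SAm) (simp add: square_algebra[where m = m])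
    ultimately have "A1 = A1 * S - (A1 * S * A0 + A1 * S * (A1 * S) * Am)" by simp
    then show ?thesis
      using cs by (auto simp: mat_eq_iff algebra_simps simp del: index_mult_mat(1) assoc_mult_mat)
  qed
  then have "A1 + A1 * S * (A0 - 1\<^sub>m m) + (A1 * S) ^\<^sub>m 2 * Am = 0\<^sub>m m m"
    using left_solvent_iff[OF c mult_carrier_mat[OF c(3) Sc]] by simp
  then have "R \<le> A1 * S"
    using R nonneg_mult[OF nn(3) S(1)] by (simp add: minimal_nonneg_solution_def nonneg_mat_def)
  then have "R * Am \<le> A1 * S * Am"
    by (intro mult_right_mono_mat[where m = m, OF nn(1)]) (use cs in auto)
  also have "A1 * S * Am = A1 * G" using cs by (subst G_SAm) simp
  finally have RAm: "R * Am = A1 * G" using le1 by (rule order_antisym)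
  then show "A0 + R * Am = A0 + A1 * G" by simp
  have "R * (1\<^sub>m m - ?T) = R - (R * A0 + R * R * Am)"
    using cs unfolding RAm[symmetric] by (simp add: square_algebra[where m = m])
  also have "\<dots> = A1"
    using cs arg_cong[OF R_eq, of "\<lambda>Z. Z $$ (_, _)"]
    by (auto simp: mat_eq_iff simp del: index_mult_mat(1))
  finally have "A1 * S = R * (1\<^sub>m m - ?T) * S" by simp
  also have "\<dots> = R * ((1\<^sub>m m - ?T) * S)" by (rule assoc_mult_mat[OF Rc minus_carrier_mat[OF Tc] Sc])
  also have "\<dots> = R" unfolding S(3) using Rc by simp
  finally show "R = A1 * S" by simp
qed

section \<open>The series W\<close>

lemma mat_inv_eqI:
  fixes A B :: "'a :: field mat"
  assumes A: "A \<in> carrier_mat n n" and B: "B \<in> carrier_mat n n" and AB: "A * B = 1\<^sub>m n"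
  shows "mat_inv A = B"
proof -
  have BA: "B * A = 1\<^sub>m n" by (rule mat_mult_left_right_inverse[OF A B AB])
  then have "A \<in> Units (ring_mat TYPE('a) n ())"
    using A B AB by (auto simp: Units_def ring_mat_simps)
  then obtain C where C: "mat_inverse A = Some C" using mat_inverse(1)[OF A] by fastforce
  then have C': "C * A = 1\<^sub>m n" "C \<in> carrier_mat n n" using mat_inverse(2)[OF A C] by auto
  have "C = C * (A * B)" using AB C' by simp
  also have "\<dots> = C * A * B" by (rule assoc_mult_mat[symmetric, OF C'(2) A B])
  also have "\<dots> = B" unfolding C'(1) using B by simp
  finally show ?thesis using C by (simp add: mat_inv_def)
qed

lemma pow_mat_nonneg: "nonneg_mat m A \<Longrightarrow> nonneg_mat m (A ^\<^sub>m k)"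
proof (induction k)
  case 0
  then show ?case using nonneg_matD(1)[OF 0] by (auto intro!: nonneg_matI)
qed (simp add: nonneg_mult)

lemma pow_mat_act_le:
  assumes A: "nonneg_mat m A" and a: "0 \<le> a"
    and le: "\<And>i. i < m \<Longrightarrow> mat_act m A v i \<le> a * v i" and i: "i < m"
  shows "mat_act m (A ^\<^sub>m k) v i \<le> a ^ k * v i"
proof -
  note Ac = nonneg_matD(1)[OF A]
  show ?thesis
    using i
  proof (induction k arbitrary: i)
    case (Suc k)
    have "mat_act m (A ^\<^sub>m Suc k) v i = mat_act m (A ^\<^sub>m k) (mat_act m A v) i"
      unfolding pow_mat.simps by (rule act_mult[OF pow_carrier_mat[OF Ac] Ac Suc.prems])
    also have "\<dots> \<le> mat_act m (A ^\<^sub>m k) (\<lambda>i. a * v i) i"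
      by (rule act_mono[OF pow_mat_nonneg[OF A] Suc.prems le])
    also have "\<dots> \<le> a * (a ^ k * v i)"
      unfolding act_cmult by (rule mult_left_mono[OF Suc.IH[OF Suc.prems] a])
    finally show ?case by (simp add: mult.assoc)
  qed (use Ac in \<open>simp add: act_one\<close>)
qed

lemma pow_mat_commute:
  assumes "A \<in> carrier_mat m m"
  shows "A * A ^\<^sub>m k = A ^\<^sub>m k * A"
proof (induction k)
  case (Suc k)
  have "A * A ^\<^sub>m Suc k = (A * A ^\<^sub>m k) * A"
    using assms by (simp add: square_algebra[where m = m])
  then show ?case by (simp add: Suc)
qed (use assms in simp)

text \<open>The equation \<open>N = S + G N R\<close> makes the series telescope, and intertwining turns the
  remainder \<open>G\<^sup>n N R\<^sup>n\<close> into \<open>G\<^sup>n Gh\<^sup>n N\<close>. This is what makes the convergence accessible: the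
  hypotheses control \<open>G\<close> and \<open>Gh\<close> by the same vector \<open>v\<close>, whereas they say nothing about powers
  of \<open>R\<close>.\<close>

lemma green_series_sums:
  assumes G: "nonneg_mat m G" and Gh: "nonneg_mat m Gh"
    and v: "\<And>i. i < m \<Longrightarrow> 0 < v i"
    and ab: "0 \<le> a" "0 \<le> b" "a * b < 1"
    and Gv: "\<And>i. i < m \<Longrightarrow> mat_act m G v i \<le> a * v i"
    and Ghv: "\<And>i. i < m \<Longrightarrow> mat_act m Gh v i \<le> b * v i"
    and c: "R \<in> carrier_mat m m" "S \<in> carrier_mat m m" "N \<in> carrier_mat m m"
    and N: "N = S + G * N * R" "Gh * N = N * R"
    and ij: "i < m" "j < m"
  shows "(\<lambda>k. (G ^\<^sub>m k * S * R ^\<^sub>m k) $$ (i, j)) sums N $$ (i, j)"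
proof -
  note Gc = nonneg_matD(1)[OF G] and Ghc = nonneg_matD(1)[OF Gh]
  have pc: "G ^\<^sub>m k \<in> carrier_mat m m" "Gh ^\<^sub>m k \<in> carrier_mat m m" "R ^\<^sub>m k \<in> carrier_mat m m" for k
    using Gc Ghc c by simp_all
  note sq = square_algebra[where m = m]
  have NR: "N * R ^\<^sub>m k = Gh ^\<^sub>m k * N" for k
  proof (induction k)
    case (Suc k)
    have "N * R ^\<^sub>m Suc k = (N * R ^\<^sub>m k) * R" using c pc by (simp add: sq)
    also have "\<dots> = Gh ^\<^sub>m k * (N * R)" unfolding Suc using c pc by (simp add: sq)
    also have "\<dots> = Gh ^\<^sub>m Suc k * N" unfolding N(2)[symmetric] using c Ghc pc by (simp add: sq)
    finally show ?case .
  qed (use c Ghc in simp)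
  have partial: "(\<Sum>k<n. (G ^\<^sub>m k * S * R ^\<^sub>m k) $$ (i, j)) = N $$ (i, j) - (G ^\<^sub>m n * Gh ^\<^sub>m n * N) $$ (i, j)" for n
  proof (induction n)
    case 0
    then show ?case using Gc Ghc c by simp
  next
    case (Suc n)
    have "G ^\<^sub>m n * Gh ^\<^sub>m n * N = G ^\<^sub>m n * (N * R ^\<^sub>m n)" using NR c pc by (simp add: sq)
    also have "\<dots> = G ^\<^sub>m n * ((S + G * N * R) * R ^\<^sub>m n)" using N(1) by simp
    also have "\<dots> = G ^\<^sub>m n * S * R ^\<^sub>m n + G ^\<^sub>m n * G * (N * (R * R ^\<^sub>m n))"
      using c pc Gc by (simp add: sq)
    also have "N * (R * R ^\<^sub>m n) = Gh ^\<^sub>m Suc n * N"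
      unfolding pow_mat_commute[OF c(1)] using NR[of "Suc n"] by simp
    also have "G ^\<^sub>m n * G * (Gh ^\<^sub>m Suc n * N) = G ^\<^sub>m Suc n * Gh ^\<^sub>m Suc n * N"
      using c pc Gc Ghc by (simp add: sq)
    finally have "(G ^\<^sub>m n * Gh ^\<^sub>m n * N) $$ (i, j)
        = (G ^\<^sub>m n * S * R ^\<^sub>m n) $$ (i, j) + (G ^\<^sub>m Suc n * Gh ^\<^sub>m Suc n * N) $$ (i, j)"
      using c pc Gc Ghc ij by (simp del: index_mult_mat(1) pow_mat.simps)
    then show ?case using Suc by simp
  qed
  define C where "C = (\<Sum>k<m. \<bar>N $$ (k, j)\<bar> / v k)"
  have NC: "\<bar>N $$ (k, j)\<bar> \<le> C * v k" if k: "k < m" for k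
  proof -
    have "\<bar>N $$ (k, j)\<bar> / v k \<le> C"
      unfolding C_def using k v by (intro member_le_sum) (auto intro!: divide_nonneg_pos)
    then show ?thesis using v[OF k] by (simp add: field_simps)
  qed
  have bound: "\<bar>(G ^\<^sub>m n * Gh ^\<^sub>m n * N) $$ (i, j)\<bar> \<le> C * v i * (a * b) ^ n" for n
  proof -
    note Gn = pow_mat_nonneg[OF G, of n] and Ghn = pow_mat_nonneg[OF Gh, of n]
    note Pn = nonneg_mult[OF Gn Ghn]
    have C0: "0 \<le> C" unfolding C_def using v by (intro sum_nonneg divide_nonneg_pos) auto
    have "\<bar>(G ^\<^sub>m n * Gh ^\<^sub>m n * N) $$ (i, j)\<bar> \<le> (\<Sum>k<m. \<bar>(G ^\<^sub>m n * Gh ^\<^sub>m n) $$ (i, k) * N $$ (k, j)\<bar>)"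
      unfolding mult_entry[OF nonneg_matD(1)[OF Pn] c(3) ij] by (rule sum_abs)
    also have "\<dots> \<le> (\<Sum>k<m. (G ^\<^sub>m n * Gh ^\<^sub>m n) $$ (i, k) * (C * v k))"
      using nonneg_matD(2)[OF Pn ij(1)] NC unfolding abs_mult
      by (intro sum_mono) (simp add: mult_left_mono del: index_mult_mat(1))
    also have "\<dots> = C * mat_act m (G ^\<^sub>m n * Gh ^\<^sub>m n) v i"
      by (simp add: mat_act_def sum_distrib_left mult.left_commute)
    also have "mat_act m (G ^\<^sub>m n * Gh ^\<^sub>m n) v i = mat_act m (G ^\<^sub>m n) (mat_act m (Gh ^\<^sub>m n) v) i"
      by (rule act_mult[OF pc(1,2) ij(1)])
    also have "\<dots> \<le> mat_act m (G ^\<^sub>m n) (\<lambda>i. b ^ n * v i) i"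
      by (rule act_mono[OF Gn ij(1) pow_mat_act_le[OF Gh ab(2) Ghv]])
    also have "\<dots> \<le> b ^ n * (a ^ n * v i)"
      unfolding act_cmult using ab by (intro mult_left_mono pow_mat_act_le[OF G ab(1) Gv ij(1)]) auto
    finally show ?thesis using C0 by (simp add: mult_right_mono power_mult_distrib mult_ac)
  qed
  have "(\<lambda>n. (G ^\<^sub>m n * Gh ^\<^sub>m n * N) $$ (i, j)) \<longlonglongrightarrow> 0"
  proof (rule tendsto_0_le)
    show "(\<lambda>n. (a * b) ^ n) \<longlonglongrightarrow> 0" using ab by (intro LIMSEQ_realpow_zero) auto
    show "\<forall>\<^sub>F n in sequentially. norm ((G ^\<^sub>m n * Gh ^\<^sub>m n * N) $$ (i, j)) \<le> norm ((a * b) ^ n) * (C * v i)"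
      using bound ab by (simp add: mult_ac abs_mult power_abs del: index_mult_mat(1))
  qed
  then have "(\<lambda>n. N $$ (i, j) - (G ^\<^sub>m n * Gh ^\<^sub>m n * N) $$ (i, j)) \<longlonglongrightarrow> N $$ (i, j) - 0"
    by (intro tendsto_intros)
  then show ?thesis unfolding sums_def partial by simp
qed

text \<open>All that the resolvent needs to know about the process, with \<open>N = - W\<close> in place
  of \<open>W\<close>. The matrix \<open>N\<close> is defined as \<open>(I - G Gh)\<^sup>-\<^sup>1 (I - U)\<^sup>-\<^sup>1\<close>, and only afterwards
  recognized as the sum of the series.\<close>

lemma green_matrix:
  assumes m: "m \<ge> 1"
    and nn: "nonneg_mat m Am" "nonneg_mat m A0" "nonneg_mat m A1"
    and G: "minimal_nonneg_solution m (\<lambda>Y. Am + (A0 - 1\<^sub>m m) * Y + A1 * Y ^\<^sub>m 2) G"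
    and Gh: "minimal_nonneg_solution m (\<lambda>Y. A1 + (A0 - 1\<^sub>m m) * Y + Am * Y ^\<^sub>m 2) Gh"
    and R: "minimal_nonneg_solution m (\<lambda>Y. A1 + Y * (A0 - 1\<^sub>m m) + Y ^\<^sub>m 2 * Am) R"
    and U: "U = A0 + R * Am"
    and \<mu>: "0 < \<mu>" and v: "\<And>i. i < m \<Longrightarrow> 0 < v i"
    and sup: "\<And>i. i < m \<Longrightarrow> mat_act m Am v i + \<mu> * mat_act m A0 v i + \<mu>\<^sup>2 * mat_act m A1 v i < \<mu> * v i"
  obtains D S H N where "{D, S, H, N} \<subseteq> carrier_mat m m"
    "A1 = R * D" "Am = D * G" "A0 - 1\<^sub>m m = - (D + R * D * G)" "S * D = 1\<^sub>m m"
    "(1\<^sub>m m - G * Gh) * H = 1\<^sub>m m"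
    "N = S + G * N * R" "Gh * N = N * R" "qbd_W m G U R = - N"
proof -
  note c = nn[THEN nonneg_matD(1)]
  have Gn: "nonneg_mat m G" using G by (simp add: minimal_nonneg_solution_def nonneg_mat_def)
  have Ghn: "nonneg_mat m Gh" using Gh by (simp add: minimal_nonneg_solution_def nonneg_mat_def)
  have Rn: "nonneg_mat m R" using R by (simp add: minimal_nonneg_solution_def nonneg_mat_def)
  note Gc = nonneg_matD(1)[OF Gn] and Rc = nonneg_matD(1)[OF Rn] and Ghc = nonneg_matD(1)[OF Ghn]
  note sq = square_algebra[where m = m]
  have G_eq: "G = Am + A0 * G + A1 * (G * G)"
    using G solvent_iff[OF c Gc] by (simp add: minimal_nonneg_solution_def)
  have Gh_eq: "Gh = A1 + A0 * Gh + Am * (Gh * Gh)"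
    using Gh solvent_iff[OF c(3,2,1) Ghc] by (simp add: minimal_nonneg_solution_def)
  have Gv: "mat_act m G v i < \<mu> * v i" "mat_act m (A0 + A1 * G) v i < v i" if "i < m" for i
    using minimal_solvent_supersolution[OF nn G \<mu>, of v] v sup that by blast+
  \<comment> \<open>reversing the levels exchanges \<open>Am\<close> with \<open>A1\<close> and \<open>\<mu>\<close> with its inverse\<close>
  have supr: "mat_act m A1 v i + inverse \<mu> * mat_act m A0 v i + (inverse \<mu>)\<^sup>2 * mat_act m Am v i < inverse \<mu> * v i"
    if "i < m" for i
  proof -
    have "(inverse \<mu>)\<^sup>2 * (mat_act m Am v i + \<mu> * mat_act m A0 v i + \<mu>\<^sup>2 * mat_act m A1 v i) < (inverse \<mu>)\<^sup>2 * (\<mu> * v i)"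
      using sup[OF that] \<mu> by (intro mult_strict_left_mono) auto
    then show ?thesis using \<mu> by (simp add: power2_eq_square field_simps)
  qed
  have Ghv: "mat_act m Gh v i < inverse \<mu> * v i" if "i < m" for i
    by (rule minimal_solvent_supersolution(1)[OF nn(3,2,1) Gh _ v supr that]) (use \<mu> in auto)
  let ?T = "A0 + A1 * G" and ?D = "1\<^sub>m m - (A0 + A1 * G)"
  have Tn: "nonneg_mat m ?T" by (intro nonneg_plus nonneg_mult nn Gn)
  obtain S where S: "nonneg_mat m S" "S * ?D = 1\<^sub>m m" "?D * S = 1\<^sub>m m"
    using contraction_inverse[OF Tn v Gv(2)] by blast
  note Sc = nonneg_matD(1)[OF S(1)]
  have Dc: "?D \<in> carrier_mat m m" by (rule minus_carrier_mat[OF nonneg_matD(1)[OF Tn]])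
  note fact = canonical_factorization[OF nn G R S]
  have UT: "U = ?T" using U fact(1) by simp
  define D where "D = ?D"
  note D = S(2,3)[folded D_def] and Dc = Dc[folded D_def]
  note cs = c Gc Ghc Rc Sc Dc
  have A1: "A1 = R * D"
  proof -
    have "R * D = A1 * (S * D)" unfolding fact(2) using cs by (simp add: sq)
    then show ?thesis using D cs by simp
  qed
  have Am: "Am = D * G"
  proof -
    have "D * G = G - (A0 * G + A1 * (G * G))" unfolding D_def using cs by (simp add: sq)
    then show ?thesis
      using cs arg_cong[OF G_eq, of "\<lambda>Z. Z $$ (_, _)"]
      by (auto simp: mat_eq_iff simp del: index_mult_mat(1))
  qed
  have A0: "A0 - 1\<^sub>m m = - (D + R * D * G)"
    unfolding A1[symmetric] using cs unfolding D_def
    by (auto simp: mat_eq_iff algebra_simps simp del: index_mult_mat(1))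
  define a where "a = Max ((\<lambda>i. mat_act m G v i / v i) ` {..<m})"
  have a_ge: "mat_act m G v i \<le> a * v i" if "i < m" for i
  proof -
    have "mat_act m G v i / v i \<le> a" unfolding a_def using that by (intro Max_ge) auto
    then show ?thesis using v[OF that] by (simp add: field_simps)
  qed
  have "a \<in> (\<lambda>i. mat_act m G v i / v i) ` {..<m}"
    unfolding a_def using m by (intro Max_in) (auto simp: lessThan_empty_iff)
  then obtain k where k: "k < m" "a = mat_act m G v k / v k" by auto
  have a: "0 \<le> a" "a * inverse \<mu> < 1"
  proof -
    show "0 \<le> a" unfolding k(2) using v k(1) by (intro divide_nonneg_pos act_nonneg[OF Gn]) (auto intro: less_imp_le)
    have "a < \<mu>" unfolding k(2) using Gv(1)[OF k(1)] v[OF k(1)] by (simp add: field_simps)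
    then show "a * inverse \<mu> < 1" using \<mu> by (simp add: field_simps)
  qed
  have GGv: "mat_act m (G * Gh) v i < v i" if i: "i < m" for i
  proof -
    have "mat_act m (G * Gh) v i = mat_act m G (mat_act m Gh v) i" by (rule act_mult[OF Gc Ghc i])
    also have "\<dots> \<le> mat_act m G (\<lambda>i. inverse \<mu> * v i) i" by (rule act_mono[OF Gn i]) (use Ghv in \<open>simp add: less_imp_le\<close>)
    also have "\<dots> < inverse \<mu> * (\<mu> * v i)"
      unfolding act_cmult using Gv(1)[OF i] \<mu> by (intro mult_strict_left_mono) auto
    also have "inverse \<mu> * (\<mu> * v i) = v i" using \<mu> by simp
    finally show ?thesis .
  qed
  obtain H where H: "nonneg_mat m H" "H * (1\<^sub>m m - G * Gh) = 1\<^sub>m m" "(1\<^sub>m m - G * Gh) * H = 1\<^sub>m m"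
    using contraction_inverse[OF nonneg_mult[OF Gn Ghn] v GGv] by blast
  note Hc = nonneg_matD(1)[OF H(1)]
  define K where "K = 1\<^sub>m m - G * Gh"
  have Kc: "K \<in> carrier_mat m m" unfolding K_def using cs by (simp add: minus_carrier_mat)
  note H' = H(2,3)[folded K_def]
  define N where "N = H * S"
  have Nc: "N \<in> carrier_mat m m" unfolding N_def using cs Hc by simp
  note cs = cs Hc Kc Nc
  have DK: "D * K = D - Am * Gh"
    unfolding K_def using cs by (simp add: Am sq)
  have D_Gh: "D * Gh - Am * (Gh * Gh) = A1 * K"
  proof -
    have "D * Gh = Gh - (A0 * Gh + A1 * (G * Gh))" unfolding D_def using cs by (simp add: sq)
    moreover have "A1 * K = A1 - A1 * (G * Gh)" unfolding K_def using cs by (simp add: sq)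
    ultimately show ?thesis
      using cs arg_cong[OF Gh_eq, of "\<lambda>Z. Z $$ (_, _)"]
      by (auto simp: mat_eq_iff simp del: index_mult_mat(1))
  qed
  \<comment> \<open>both sides are \<open>A1 K\<close>\<close>
  have intertwine: "D * K * Gh = R * (D * K)"
  proof -
    have "D * K * Gh = D * Gh - Am * (Gh * Gh)" unfolding DK using cs by (simp add: sq)
    also have "\<dots> = R * D * K" unfolding D_Gh A1 ..
    finally show ?thesis using cs by (simp add: sq)
  qed
  have DKN: "D * K * N = 1\<^sub>m m"
  proof -
    have "D * K * N = D * ((K * H) * S)" unfolding N_def using cs by (simp add: sq)
    then show ?thesis using H' D cs by simp
  qed
  have NDK: "N * (D * K) = 1\<^sub>m m"
    by (rule mat_mult_left_right_inverse[OF _ Nc DKN]) (use cs in simp)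
  have comm: "Gh * N = N * R"
  proof -
    have "Gh * N = (N * (D * K)) * (Gh * N)" unfolding NDK using cs by (simp add: sq)
    also have "\<dots> = N * ((D * K * Gh) * N)" using cs by (simp add: sq)
    also have "\<dots> = N * (R * (D * K * N))" unfolding intertwine using cs by (simp add: sq)
    finally show ?thesis unfolding DKN using cs by simp
  qed
  have N_eq: "N = S + G * N * R"
  proof -
    have "S = (K * H) * S" unfolding H' using cs by simp
    also have "\<dots> = K * N" unfolding N_def using cs by simp
    also have "\<dots> = N - G * (Gh * N)" unfolding K_def using cs by (simp add: sq)
    also have "\<dots> = N - G * N * R" unfolding comm using cs by simp
    finally show ?thesis using cs by (auto simp: mat_eq_iff simp del: index_mult_mat(1))
  qed
  have inv: "mat_inv (U - 1\<^sub>m m) = - S"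
  proof (rule mat_inv_eqI)
    have "U - 1\<^sub>m m = - D" unfolding UT D_def using cs by (auto simp: mat_eq_iff simp del: index_mult_mat(1))
    then show "(U - 1\<^sub>m m) * - S = 1\<^sub>m m" using D cs by simp
  qed (use cs UT in \<open>simp_all add: minus_carrier_mat\<close>)
  have "qbd_W m G U R = - N"
  proof (rule eq_matI)
    fix i j assume "i < dim_row (- N)" "j < dim_col (- N)"
    then have ij: "i < m" "j < m" using Nc by auto
    have "(\<lambda>k. (G ^\<^sub>m k * S * R ^\<^sub>m k) $$ (i, j)) sums N $$ (i, j)"
      by (rule green_series_sums[OF Gn Ghn v a(1) _ a(2) a_ge less_imp_le[OF Ghv] Rc Sc Nc N_eq comm ij])
        (use \<mu> in auto)
    then have "(\<lambda>k. - (G ^\<^sub>m k * S * R ^\<^sub>m k) $$ (i, j)) sums - N $$ (i, j)" by (rule sums_minus)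
    moreover have "(G ^\<^sub>m k * - S * R ^\<^sub>m k) $$ (i, j) = - (G ^\<^sub>m k * S * R ^\<^sub>m k) $$ (i, j)" for k
      using cs ij by (simp del: index_mult_mat(1))
    ultimately show "qbd_W m G U R $$ (i, j) = (- N) $$ (i, j)"
      using ij cs by (simp add: qbd_W_def inv sums_iff del: index_mult_mat(1))
  qed (use cs in \<open>auto simp: qbd_W_def\<close>)
  then show thesis
    using that[of D S H N] cs A1 Am A0 D H(3) N_eq comm by blast
qed

section \<open>Block matrices\<close>

text \<open>Matrix algebra with premises on dimensions. For rectangular factors the simplifier can decide
  these, while carrier premises would leave it with unknown intermediate sizes.\<close>

lemma assoc_mult_dim:
  fixes A B C :: "'a :: semiring_0 mat"
  assumes "dim_col A = dim_row B" "dim_col B = dim_row C"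
  shows "A * B * C = A * (B * C)"
  by (rule assoc_mult_mat[of _ "dim_row A" "dim_col A" _ "dim_col B" _ "dim_col C"]) (use assms in auto)

lemma mult_add_distrib_dim:
  fixes A B C :: "'a :: comm_ring_1 mat"
  assumes "dim_col A = dim_row B" "dim_row B = dim_row C" "dim_col B = dim_col C"
  shows "A * (B + C) = A * B + A * C" "A * (B - C) = A * B - A * C"
   by (rule mult_add_distrib_mat[of _ "dim_row A" "dim_col A" _ "dim_col B"],
        (use assms in \<open>auto intro!: carrier_matI\<close>)[3],
       rule mult_minus_distrib_mat[of _ "dim_row A" "dim_col A" _ "dim_col B"])
      (use assms in \<open>auto intro!: carrier_matI\<close>)

lemma add_mult_distrib_dim:
  fixes A B C :: "'a :: comm_ring_1 mat"
  assumes "dim_col A = dim_row C" "dim_row A = dim_row B" "dim_col A = dim_col B"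
  shows "(A + B) * C = A * C + B * C" "(A - B) * C = A * C - B * C"
   by (rule add_mult_distrib_mat[of _ "dim_row A" "dim_col A" _ _ "dim_col C"],
        (use assms in \<open>auto intro!: carrier_matI\<close>)[3],
       rule minus_mult_distrib_mat[of _ "dim_row A" "dim_col A" _ _ "dim_col C"])
      (use assms in \<open>auto intro!: carrier_matI\<close>)

lemma mult_smult_dim:
  fixes A B :: "'a :: comm_ring_1 mat"
  assumes "dim_col A = dim_row B"
  shows "A * (k \<cdot>\<^sub>m B) = k \<cdot>\<^sub>m (A * B)" "(k \<cdot>\<^sub>m A) * B = k \<cdot>\<^sub>m (A * B)"
   by (rule mult_smult_distrib[of _ "dim_row A" "dim_col A" _ "dim_col B"],
        (use assms in \<open>auto intro!: carrier_matI\<close>)[2],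
       rule mult_smult_assoc_mat[of _ "dim_row A" "dim_col A" _ "dim_col B"])
      (use assms in \<open>auto intro!: carrier_matI\<close>)

lemma one_mult_dim:
  fixes A :: "'a :: semiring_1 mat"
  shows "dim_row A = n \<Longrightarrow> 1\<^sub>m n * A = A" "dim_col A = n \<Longrightarrow> A * 1\<^sub>m n = A"
  using left_mult_one_mat[of A n "dim_col A"] right_mult_one_mat[of A "dim_row A" n] by auto

lemmas dim_algebra = assoc_mult_dim mult_add_distrib_dim add_mult_distrib_dim mult_smult_dim one_mult_dim

lemma append_cols_carrier [simp]:
  "A \<in> carrier_mat m n1 \<Longrightarrow> B \<in> carrier_mat m n2 \<Longrightarrow> A @\<^sub>c B \<in> carrier_mat m (n1 + n2)"
  unfolding append_cols_def by auto

lemma append_cols_index: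
  assumes "A \<in> carrier_mat m n1" "B \<in> carrier_mat m n2" "i < m" "j < n1 + n2"
  shows "(A @\<^sub>c B) $$ (i, j) = (if j < n1 then A $$ (i, j) else B $$ (i, j - n1))"
  using assms unfolding append_cols_def by auto

lemma append_rows_index:
  assumes "A \<in> carrier_mat n1 m" "B \<in> carrier_mat n2 m" "j < m" "i < n1 + n2"
  shows "(A @\<^sub>r B) $$ (i, j) = (if i < n1 then A $$ (i, j) else B $$ (i - n1, j))"
  using assms unfolding append_rows_def by auto

lemma append_cols_mult_append_rows:
  fixes A :: "'a :: comm_ring_1 mat"
  assumes "A \<in> carrier_mat m n1" "B \<in> carrier_mat m n2" "C \<in> carrier_mat n1 k" "D \<in> carrier_mat n2 k"
  shows "(A @\<^sub>c B) * (C @\<^sub>r D) = A * C + B * D"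
proof -
  have "(A @\<^sub>c B) * (C @\<^sub>r D) = four_block_mat (A * C + B * D) (A * 0\<^sub>m n1 0 + B * 0\<^sub>m n2 0)
      (0\<^sub>m 0 n1 * C + 0\<^sub>m 0 n2 * D) (0\<^sub>m 0 n1 * 0\<^sub>m n1 0 + 0\<^sub>m 0 n2 * 0\<^sub>m n2 0)"
    unfolding append_cols_def append_rows_def using assms
    by (subst mult_four_block_mat[of A m n1 B n2 _ 0 _ C k _ 0]) auto
  also have "\<dots> = A * C + B * D" using assms by (intro eq_matI) auto
  finally show ?thesis .
qed

lemma append_cols_mult_diag:
  fixes A :: "'a :: comm_ring_1 mat"
  assumes "A \<in> carrier_mat m n1" "B \<in> carrier_mat m n2" "P \<in> carrier_mat n1 k1" "Q \<in> carrier_mat n2 k2"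
  shows "(A @\<^sub>c B) * four_block_mat P (0\<^sub>m n1 k2) (0\<^sub>m n2 k1) Q = (A * P) @\<^sub>c (B * Q)"
proof -
  have "(A @\<^sub>c B) * four_block_mat P (0\<^sub>m n1 k2) (0\<^sub>m n2 k1) Q
     = four_block_mat (A * P + B * 0\<^sub>m n2 k1) (A * 0\<^sub>m n1 k2 + B * Q)
      (0\<^sub>m 0 n1 * P + 0\<^sub>m 0 n2 * 0\<^sub>m n2 k1) (0\<^sub>m 0 n1 * 0\<^sub>m n1 k2 + 0\<^sub>m 0 n2 * Q)"
    unfolding append_cols_def using assms
    by (subst mult_four_block_mat[of A m n1 B n2 _ 0 _ P k1 _ k2]) auto
  also have "\<dots> = (A * P) @\<^sub>c (B * Q)"
    unfolding append_cols_def using assms by (intro cong_four_block_mat eq_matI) auto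
  finally show ?thesis .
qed

lemma append_cols_add:
  fixes A B :: "'a :: comm_ring_1 mat"
  assumes "A \<in> carrier_mat m n1" "B \<in> carrier_mat m n2" "A' \<in> carrier_mat m n1" "B' \<in> carrier_mat m n2"
  shows "(A @\<^sub>c B) + (A' @\<^sub>c B') = (A + A') @\<^sub>c (B + B')"
  using assms unfolding append_cols_def by (intro eq_matI) auto

lemma mult_append_cols:
  fixes A :: "'a :: comm_ring_1 mat"
  assumes "C \<in> carrier_mat k m" "A \<in> carrier_mat m n1" "B \<in> carrier_mat m n2"
  shows "C * (A @\<^sub>c B) = (C * A) @\<^sub>c (C * B)"
proof (rule eq_matI)
  fix i j assume "i < dim_row ((C * A) @\<^sub>c (C * B))" "j < dim_col ((C * A) @\<^sub>c (C * B))"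
  then have ij: "i < k" "j < n1 + n2" using assms by (auto simp: append_cols_def)
  have "(C * (A @\<^sub>c B)) $$ (i, j) = (\<Sum>l<m. C $$ (i, l) * (A @\<^sub>c B) $$ (l, j))"
    by (rule mult_entry) (use assms ij in auto)
  also have "\<dots> = (\<Sum>l<m. C $$ (i, l) * (if j < n1 then A $$ (l, j) else B $$ (l, j - n1)))"
    by (rule sum.cong) (use assms ij in \<open>simp_all add: append_cols_index[of _ m n1 _ n2]\<close>)
  also have "\<dots> = ((C * A) @\<^sub>c (C * B)) $$ (i, j)"
    using assms ij mult_entry[OF assms(1,2) ij(1), of j] mult_entry[OF assms(1,3) ij(1), of "j - n1"]
    by (subst append_cols_index[of _ k n1 _ n2]) auto
  finally show "(C * (A @\<^sub>c B)) $$ (i, j) = ((C * A) @\<^sub>c (C * B)) $$ (i, j)" .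
qed (use assms in \<open>auto simp: append_cols_def\<close>)

lemma append_rows_mult:
  fixes A :: "'a :: comm_ring_1 mat"
  assumes "A \<in> carrier_mat n1 m" "B \<in> carrier_mat n2 m" "C \<in> carrier_mat m k"
  shows "(A @\<^sub>r B) * C = (A * C) @\<^sub>r (B * C)"
proof (rule eq_matI)
  fix i j assume "i < dim_row ((A * C) @\<^sub>r (B * C))" "j < dim_col ((A * C) @\<^sub>r (B * C))"
  then have ij: "i < n1 + n2" "j < k" using assms by (auto simp: append_rows_def)
  have "((A @\<^sub>r B) * C) $$ (i, j) = (\<Sum>l<m. (A @\<^sub>r B) $$ (i, l) * C $$ (l, j))"
    by (rule mult_entry) (use assms ij in auto)
  also have "\<dots> = (\<Sum>l<m. (if i < n1 then A $$ (i, l) else B $$ (i - n1, l)) * C $$ (l, j))"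
    by (rule sum.cong) (use assms ij in \<open>simp_all add: append_rows_index[of _ n1 m _ n2]\<close>)
  also have "\<dots> = ((A * C) @\<^sub>r (B * C)) $$ (i, j)"
    using assms ij mult_entry[OF assms(1,3) _ ij(2), of i] mult_entry[OF assms(2,3) _ ij(2), of "i - n1"]
    by (subst append_rows_index[of _ n1 k _ n2]) auto
  finally show "((A @\<^sub>r B) * C) $$ (i, j) = ((A * C) @\<^sub>r (B * C)) $$ (i, j)" .
qed (use assms in \<open>auto simp: append_rows_def\<close>)

lemma append_cols_eqD:
  assumes eq: "A @\<^sub>c B = A' @\<^sub>c B'"
    and c: "A \<in> carrier_mat m n1" "B \<in> carrier_mat m n2" "A' \<in> carrier_mat m n1" "B' \<in> carrier_mat m n2"
  shows "A = A'" "B = B'"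
proof -
  show "A = A'"
  proof (rule eq_matI)
    fix i j assume "i < dim_row A'" "j < dim_col A'"
    then show "A $$ (i, j) = A' $$ (i, j)"
      using c arg_cong[OF eq, of "\<lambda>Z. Z $$ (i, j)"] by (simp add: append_cols_index[of _ m n1 _ n2])
  qed (use c in auto)
  show "B = B'"
  proof (rule eq_matI)
    fix i j assume "i < dim_row B'" "j < dim_col B'"
    then show "B $$ (i, j) = B' $$ (i, j)"
      using c arg_cong[OF eq, of "\<lambda>Z. Z $$ (i, n1 + j)"] by (simp add: append_cols_index[of _ m n1 _ n2])
  qed (use c in auto)
qed

lemma append_rows_eqD:
  assumes eq: "A @\<^sub>r B = A' @\<^sub>r B'"
    and c: "A \<in> carrier_mat n1 m" "B \<in> carrier_mat n2 m" "A' \<in> carrier_mat n1 m" "B' \<in> carrier_mat n2 m"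
  shows "A = A'" "B = B'"
proof -
  show "A = A'"
  proof (rule eq_matI)
    fix i j assume "i < dim_row A'" "j < dim_col A'"
    then show "A $$ (i, j) = A' $$ (i, j)"
      using c arg_cong[OF eq, of "\<lambda>Z. Z $$ (i, j)"] by (simp add: append_rows_index[of _ n1 m _ n2])
  qed (use c in auto)
  show "B = B'"
  proof (rule eq_matI)
    fix i j assume "i < dim_row B'" "j < dim_col B'"
    then show "B $$ (i, j) = B' $$ (i, j)"
      using c arg_cong[OF eq, of "\<lambda>Z. Z $$ (n1 + i, j)"] by (simp add: append_rows_index[of _ n1 m _ n2])
  qed (use c in auto)
qed

lemma diag_block_mat_pair:
  assumes "A \<in> carrier_mat r1 c1" "B \<in> carrier_mat r2 c2"
  shows "diag_block_mat [A, B] = four_block_mat A (0\<^sub>m r1 c2) (0\<^sub>m r2 c1) B"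
  unfolding diag_block_mat.simps(2)[of A] diag_block_mat_singleton Let_def using assms by simp

lemma invertible_mat_iff_det:
  fixes A :: "'a :: field mat"
  assumes A: "A \<in> carrier_mat n n"
  shows "invertible_mat A \<longleftrightarrow> det A \<noteq> 0"
proof
  assume "invertible_mat A"
  then obtain B where B: "A * B = 1\<^sub>m (dim_row A)" "B * A = 1\<^sub>m (dim_row B)"
    unfolding invertible_mat_def inverts_mat_def by blast
  have Bc: "B \<in> carrier_mat n n"
    using A arg_cong[OF B(1), of dim_col] arg_cong[OF B(2), of dim_col] by auto
  have "det A * det B = det (1\<^sub>m n)" using det_mult[OF A Bc] B(1) A by simp
  then show "det A \<noteq> 0" by auto
next
  assume "det A \<noteq> 0"
  from det_non_zero_imp_unit[OF A this, of "()"]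
  obtain B where "B \<in> carrier_mat n n" "A * B = 1\<^sub>m n" "B * A = 1\<^sub>m n"
    by (auto simp: Units_def ring_mat_simps)
  then show "invertible_mat A" using A unfolding invertible_mat_def inverts_mat_def by auto
qed

lemma invertible_matE:
  fixes A :: "'a :: field mat"
  assumes "A \<in> carrier_mat n n" "invertible_mat A"
  obtains B where "B \<in> carrier_mat n n" "A * B = 1\<^sub>m n" "B * A = 1\<^sub>m n" "mat_inv A = B"
proof -
  have "det A \<noteq> 0" using assms invertible_mat_iff_det by blast
  from det_non_zero_imp_unit[OF assms(1) this, of "()"]
  obtain B where B: "B \<in> carrier_mat n n" "A * B = 1\<^sub>m n" "B * A = 1\<^sub>m n"
    by (auto simp: Units_def ring_mat_simps)
  with mat_inv_eqI[OF assms(1) B(1,2)] show thesis using that by blast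
qed

lemma invertible_matI:
  fixes A :: "'a :: field mat"
  assumes "A \<in> carrier_mat n n" "B \<in> carrier_mat n n" "A * B = 1\<^sub>m n"
  shows "invertible_mat A"
  using assms mat_mult_left_right_inverse[OF assms] unfolding invertible_mat_def inverts_mat_def by auto

lemma invertible_diag:
  fixes A B :: "'a :: field mat"
  assumes c: "A \<in> carrier_mat n n" "B \<in> carrier_mat k k"
    and inv: "invertible_mat (four_block_mat A (0\<^sub>m n k) (0\<^sub>m k n) B)"
  obtains A' B' where "A' \<in> carrier_mat n n" "A * A' = 1\<^sub>m n" "A' * A = 1\<^sub>m n"
    "B' \<in> carrier_mat k k" "B * B' = 1\<^sub>m k" "B' * B = 1\<^sub>m k"
    "mat_inv (four_block_mat A (0\<^sub>m n k) (0\<^sub>m k n) B) = four_block_mat A' (0\<^sub>m n k) (0\<^sub>m k n) B'"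
    "invertible_mat A" "invertible_mat B"
proof -
  let ?F = "four_block_mat A (0\<^sub>m n k) (0\<^sub>m k n) B"
  have Fc: "?F \<in> carrier_mat (n + k) (n + k)" using c by simp
  have "det ?F = det A * det B"
    by (rule det_four_block_mat_upper_right_zero[OF c(1) refl _ c(2)]) simp
  then have "det A \<noteq> 0" "det B \<noteq> 0" using inv invertible_mat_iff_det[OF Fc] by auto
  then have i: "invertible_mat A" "invertible_mat B" using c invertible_mat_iff_det by blast+
  obtain A' where A': "A' \<in> carrier_mat n n" "A * A' = 1\<^sub>m n" "A' * A = 1\<^sub>m n"
    using invertible_matE[OF c(1) i(1)] by metis
  obtain B' where B': "B' \<in> carrier_mat k k" "B * B' = 1\<^sub>m k" "B' * B = 1\<^sub>m k"
    using invertible_matE[OF c(2) i(2)] by metis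
  let ?F' = "four_block_mat A' (0\<^sub>m n k) (0\<^sub>m k n) B'"
  have "?F * ?F' = 1\<^sub>m (n + k)"
    using c A' B' by (subst mult_four_block_mat[of _ n n _ k _ k _ _ n _ k]) auto
  then have "mat_inv ?F = ?F'" using A' B' by (intro mat_inv_eqI[OF Fc]) auto
  with A' B' i show thesis using that by blast
qed

section \<open>The resolvent\<close>

text \<open>Here \<open>\<Gamma>\<close> plays the role of \<open>Gh (I - z Gh)\<^sup>-\<^sup>1\<close>. From \<open>Gh N = N R\<close> one gets
  \<open>\<Gamma> N (I - z R) = N R\<close>, and from \<open>N = S + G N R\<close> that \<open>D1 N (I - z R) = D1 S - N R\<close>; the sum
  \<open>D1 S\<close> cancels against the remaining factors \<open>D (z I - G)\<close> of \<open>\<eta>(z)\<close>.\<close>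

lemma resolvent_identity:
  fixes z :: "'a :: field"
  assumes c: "R \<in> carrier_mat m m" "D \<in> carrier_mat m m" "G \<in> carrier_mat m m" "Gh \<in> carrier_mat m m"
      "S \<in> carrier_mat m m" "N \<in> carrier_mat m m" "D1 \<in> carrier_mat m m" "\<Gamma> \<in> carrier_mat m m"
    and D1: "D1 * (z \<cdot>\<^sub>m 1\<^sub>m m - G) = 1\<^sub>m m"
    and SD: "S * D = 1\<^sub>m m"
    and N: "N = S + G * N * R" "Gh * N = N * R"
    and \<Gamma>: "\<Gamma> - z \<cdot>\<^sub>m (\<Gamma> * Gh) = Gh"
  shows "((D1 + \<Gamma>) * N) * (D * G + z \<cdot>\<^sub>m (- (D + R * D * G)) + z ^ 2 \<cdot>\<^sub>m (R * D)) = - 1\<^sub>m m"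
proof -
  note sq = square_algebra[where m = m] mult_smult_distrib[of _ m m _ m]
    mult_smult_assoc_mat[of _ m m _ m] add_smult_distrib_left_mat[of _ m m] minus_carrier_mat[of _ m m]
  let ?C = "z \<cdot>\<^sub>m 1\<^sub>m m - G" and ?K = "N - z \<cdot>\<^sub>m (N * R)"
  have Cc: "?C \<in> carrier_mat m m" using c by (simp add: minus_carrier_mat)
  have Kc: "?K \<in> carrier_mat m m" using c by (simp add: minus_carrier_mat)
  have G_part: "\<Gamma> * ?K = N * R"
  proof -
    have "\<Gamma> * ?K = \<Gamma> * N - z \<cdot>\<^sub>m (\<Gamma> * (N * R))" using c by (simp add: sq)
    also have "\<dots> = (\<Gamma> - z \<cdot>\<^sub>m (\<Gamma> * Gh)) * N" unfolding N(2)[symmetric] using c by (simp add: sq)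
    finally show ?thesis unfolding \<Gamma> N(2) .
  qed
  have D1_part: "D1 * ?K = D1 * S - N * R"
  proof -
    have "?C * (N * R) = z \<cdot>\<^sub>m (N * R) - G * N * R" using c by (simp add: sq)
    then have "?K = S - ?C * (N * R)"
      using c arg_cong[OF N(1), of "\<lambda>Z. Z $$ (_, _)"]
      by (auto simp: mat_eq_iff simp del: index_mult_mat(1))
    then have "D1 * ?K = D1 * (S - ?C * (N * R))" by simp
    also have "\<dots> = D1 * S - D1 * (?C * (N * R))"
      by (rule mult_minus_distrib_mat[of _ m m _ m]) (use c Cc in \<open>simp_all add: sq\<close>)
    also have "D1 * (?C * (N * R)) = (D1 * ?C) * (N * R)"
      by (rule assoc_mult_mat[symmetric, OF c(7) Cc mult_carrier_mat[OF c(6,1)]])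
    finally show ?thesis using c unfolding D1 by simp
  qed
  have sum: "(D1 + \<Gamma>) * ?K = D1 * S"
    using c Kc by (simp add: sq(2) D1_part G_part) (auto simp: mat_eq_iff simp del: index_mult_mat(1))
  have fact: "N * (D * G + z \<cdot>\<^sub>m (- (D + R * D * G)) + z ^ 2 \<cdot>\<^sub>m (R * D)) = - (?K * (D * ?C))"
  proof -
    have 1: "?K * (D * ?C) = N * (z \<cdot>\<^sub>m D) - N * (D * G) - (z \<cdot>\<^sub>m (z \<cdot>\<^sub>m (N * (R * D))) - z \<cdot>\<^sub>m (N * (R * (D * G))))"
      using c by (simp add: dim_algebra)
        (auto simp: mat_eq_iff algebra_simps simp del: index_mult_mat(1))
    have 2: "N * (D * G + z \<cdot>\<^sub>m (- (D + R * D * G)) + z ^ 2 \<cdot>\<^sub>m (R * D))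
      = N * (D * G) + z \<cdot>\<^sub>m (- (N * D + N * (R * (D * G)))) + z ^ 2 \<cdot>\<^sub>m (N * (R * D))"
      using c by (simp add: dim_algebra)
    have 3: "N * (z \<cdot>\<^sub>m D) = z \<cdot>\<^sub>m (N * D)" using c by (simp add: dim_algebra)
    show ?thesis unfolding 1 2 3 using c
      by (auto simp: mat_eq_iff algebra_simps power2_eq_square simp del: index_mult_mat(1))
  qed
  have "((D1 + \<Gamma>) * N) * (D * G + z \<cdot>\<^sub>m (- (D + R * D * G)) + z ^ 2 \<cdot>\<^sub>m (R * D))
     = (D1 + \<Gamma>) * (N * (D * G + z \<cdot>\<^sub>m (- (D + R * D * G)) + z ^ 2 \<cdot>\<^sub>m (R * D)))"
    by (rule assoc_mult_mat[of _ m m _ m _ m]) (use c in \<open>simp_all add: sq\<close>)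
  also have "\<dots> = - ((D1 + \<Gamma>) * (?K * (D * ?C)))" unfolding fact using c by simp
  also have "(D1 + \<Gamma>) * (?K * (D * ?C)) = ((D1 + \<Gamma>) * ?K) * (D * ?C)"
    by (rule assoc_mult_mat[symmetric, of _ m m _ m _ m]) (use c Kc Cc in \<open>simp_all add: sq\<close>)
  also have "\<dots> = D1 * ((S * D) * ?C)" unfolding sum using c Cc by (simp add: sq)
  also have "\<dots> = 1\<^sub>m m" unfolding SD left_mult_one_mat[OF Cc] by (rule D1)
  finally show ?thesis .
qed

lemma mat_sum_2:
  assumes "\<And>i. i \<le> 2 \<Longrightarrow> f i \<in> carrier_mat nr nc"
  shows "mat_sum nr nc f 2 = f 0 + f 1 + f 2"
proof -
  have "{..2::nat} = {0, 1, 2}" by auto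
  then show ?thesis
    using assms[of 0] assms[of 1] assms[of 2] unfolding mat_sum_def by (intro eq_matI) (auto simp: ac_simps)
qed

lemma pair_matrix_2:
  assumes c: "X1 \<in> carrier_mat m (m + p)" "X2 \<in> carrier_mat m (m - p)"
    "T1 \<in> carrier_mat (m + p) (m + p)" "T2 \<in> carrier_mat (m - p) (m - p)"
    and p: "p \<le> m"
  shows "pair_matrix m 2 X1 X2 T1 T2 = four_block_mat X1 (X2 * T2) (X1 * T1) X2"
proof (rule eq_matI)
  fix i j assume "i < dim_row (four_block_mat X1 (X2 * T2) (X1 * T1) X2)"
    "j < dim_col (four_block_mat X1 (X2 * T2) (X1 * T1) X2)"
  then have ij: "i < m + m" "j < (m + p) + (m - p)" using c by auto
  then have j2: "j < m * 2" "i < m * 2" using p by auto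
  show "pair_matrix m 2 X1 X2 T1 T2 $$ (i, j) = four_block_mat X1 (X2 * T2) (X1 * T1) X2 $$ (i, j)"
  proof (cases "i < m")
    case True
    then have *: "i div m = 0" "i mod m = i" by auto
    show ?thesis
      unfolding pair_matrix_def
      using ij j2 c True by (simp add: * append_cols_def del: index_mult_mat(1))
  next
    case False
    then obtain k where k: "i = m + k" "k < m" using ij by (metis add_less_cancel_left le_Suc_ex linorder_not_less)
    then have *: "i div m = 1" "i mod m = k" by auto
    show ?thesis
      unfolding pair_matrix_def
      using ij j2 c k by (simp add: * append_cols_def del: index_mult_mat(1))
  qed
qed (use c p in \<open>auto simp: pair_matrix_def\<close>)

lemma resolvent_pencil_diag:
  assumes "T1 \<in> carrier_mat q q" "T2 \<in> carrier_mat r r"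
  shows "resolvent_pencil q (diag_block_mat [T1, T2]) z
    = four_block_mat (z \<cdot>\<^sub>m 1\<^sub>m q - T1) (0\<^sub>m q r) (0\<^sub>m r q) (z \<cdot>\<^sub>m T2 - 1\<^sub>m r)"
proof -
  let ?T = "diag_block_mat [T1, T2]"
  have T: "?T = four_block_mat T1 (0\<^sub>m q r) (0\<^sub>m r q) T2" by (rule diag_block_mat_pair[OF assms])
  have 1: "mat q q (\<lambda>ij. ?T $$ ij) = T1" "mat r r (\<lambda>(i, j). ?T $$ (i + q, j + q)) = T2"
    unfolding T using assms by (auto intro!: eq_matI)
  have d: "dim_row ?T = q + r" "dim_col ?T = q + r" unfolding T using assms by auto
  have "resolvent_pencil q ?T z = diag_block_mat [z \<cdot>\<^sub>m 1\<^sub>m (dim_row T1) - T1, z \<cdot>\<^sub>m T2 - 1\<^sub>m (dim_row T2)]"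
    unfolding resolvent_pencil_def split_block_def Let_def d using 1 by simp
  also have "\<dots> = four_block_mat (z \<cdot>\<^sub>m 1\<^sub>m q - T1) (0\<^sub>m q r) (0\<^sub>m r q) (z \<cdot>\<^sub>m T2 - 1\<^sub>m r)"
    using assms by (subst diag_block_mat_pair[of _ q q _ r r]) (auto simp: minus_carrier_mat)
  finally show ?thesis .
qed

text \<open>The complex matrices after the probabilistic part has been extracted: \<open>B0\<close> stands for \<open>A0 - I\<close>
  and \<open>N\<close> for \<open>- W\<close>, and the Jordan data enter through the relations between \<open>L\<close>, \<open>K\<close>, \<open>E\<close>, \<open>F\<close>.\<close>

locale spectral_factorization =
  fixes m p :: nat
    and Am B0 A1 G Gh R D S H N V1 V0 V1i L K E F :: "complex mat"
  assumes p: "p \<le> m"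
    and sq: "Am \<in> carrier_mat m m" "B0 \<in> carrier_mat m m" "A1 \<in> carrier_mat m m"
      "G \<in> carrier_mat m m" "Gh \<in> carrier_mat m m" "R \<in> carrier_mat m m"
      "D \<in> carrier_mat m m" "S \<in> carrier_mat m m" "H \<in> carrier_mat m m" "N \<in> carrier_mat m m"
    and vc: "V1 \<in> carrier_mat p p" "V1i \<in> carrier_mat p p" "V0 \<in> carrier_mat (m - p) (m - p)"
      "L \<in> carrier_mat m p" "K \<in> carrier_mat m (m - p)" "E \<in> carrier_mat p m" "F \<in> carrier_mat (m - p) m"
    and fact: "A1 = R * D" "Am = D * G" "B0 = - (D + R * D * G)" "S * D = 1\<^sub>m m"
    and H: "(1\<^sub>m m - G * Gh) * H = 1\<^sub>m m"
    and N: "N = S + G * N * R" "Gh * N = N * R"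
    and Gh: "A1 + B0 * Gh + Am * (Gh * Gh) = 0\<^sub>m m m"
    and V1i: "V1 * V1i = 1\<^sub>m p" "V1i * V1 = 1\<^sub>m p"
    and LEKF: "L * E + K * F = 1\<^sub>m m"
    and EL: "E * L = 1\<^sub>m p" "E * K = 0\<^sub>m p (m - p)" "F * L = 0\<^sub>m (m - p) p" "F * K = 1\<^sub>m (m - p)"
    and GhL: "Gh * L = L * V1" and GhK: "Gh * K = K * V0"
begin

definition "X1 = 1\<^sub>m m @\<^sub>c L"
definition "T1 = four_block_mat G (0\<^sub>m m p) (0\<^sub>m p m) V1i"

lemmas carriers = sq vc

lemma X1_carrier: "X1 \<in> carrier_mat m (m + p)" unfolding X1_def using vc by simp

lemma T1_carrier: "T1 \<in> carrier_mat (m + p) (m + p)" unfolding T1_def using carriers by simp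

lemma X1_T1: "X1 * T1 = G @\<^sub>c (L * V1i)"
  unfolding X1_def T1_def using carriers
  by (subst append_cols_mult_diag[of _ m m _ p _ m _ p]) auto

lemma X1_T1_T1: "X1 * (T1 * T1) = (G * G) @\<^sub>c (L * V1i * V1i)"
proof -
  have "X1 * (T1 * T1) = (X1 * T1) * T1" using X1_carrier T1_carrier by (simp add: dim_algebra)
  also have "\<dots> = (G * G) @\<^sub>c (L * V1i * V1i)"
    unfolding X1_T1 unfolding T1_def using carriers
    by (subst append_cols_mult_diag[of _ m m _ p _ m _ p]) auto
  finally show ?thesis .
qed

lemma Gh_eigen: "Gh = L * (V1 * E) + K * (V0 * F)"
proof -
  have "Gh = Gh * (L * E + K * F)" unfolding LEKF using carriers by simp
  also have "\<dots> = (Gh * L) * E + (Gh * K) * F" using carriers by (simp add: dim_algebra)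
  finally show ?thesis unfolding GhL GhK using carriers by (simp add: dim_algebra)
qed

lemma right_solvent_G: "Am + B0 * G + A1 * (G * G) = 0\<^sub>m m m"
proof -
  have "Am + B0 * G + A1 * (G * G) = D * G + - (D * G + R * (D * (G * G))) + R * (D * (G * G))"
    unfolding fact using carriers by (simp add: dim_algebra)
  also have "\<dots> = 0\<^sub>m m m" using carriers by (auto simp: mat_eq_iff simp del: index_mult_mat(1))
  finally show ?thesis .
qed

text \<open>Both \<open>L\<close> and \<open>K\<close> enter the polynomial conditions through this equation, after their powers of \<open>V1\<^sup>-\<^sup>1\<close>
  or \<open>V0\<close> have been rewritten as powers of \<open>Gh\<close>.\<close>

lemma Gh_combination:
  assumes "Y \<in> carrier_mat m k"
  shows "Am * (Gh * (Gh * Y)) + B0 * (Gh * Y) + A1 * Y = 0\<^sub>m m k"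
proof -
  have "Am * (Gh * (Gh * Y)) + B0 * (Gh * Y) + A1 * Y = (A1 + B0 * Gh + Am * (Gh * Gh)) * Y"
    using carriers assms by (simp add: dim_algebra)
      (auto simp: mat_eq_iff simp del: index_mult_mat(1))
  then show ?thesis unfolding Gh using assms by simp
qed

lemma L_descend: "L = Gh * (L * V1i)" "L * V1i = Gh * (L * V1i * V1i)"
proof -
  have "Gh * (L * V1i) = (Gh * L) * V1i" using carriers by (simp add: dim_algebra)
  also have "\<dots> = L * (V1 * V1i)" unfolding GhL using carriers by (simp add: dim_algebra)
  finally show 1: "L = Gh * (L * V1i)" unfolding V1i using carriers by simp
  have "L * V1i = Gh * (L * V1i) * V1i" by (rule arg_cong[OF 1, of "\<lambda>Z. Z * V1i"])
  also have "\<dots> = Gh * (L * V1i * V1i)" using carriers by (simp add: dim_algebra)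
  finally show "L * V1i = Gh * (L * V1i * V1i)" .
qed

lemma K_ascend: "K * V0 = Gh * K" "K * (V0 * V0) = Gh * (Gh * K)"
proof -
  show "K * V0 = Gh * K" using GhK by simp
  have "K * (V0 * V0) = (Gh * K) * V0" unfolding GhK using carriers by (simp add: dim_algebra)
  also have "\<dots> = Gh * (K * V0)" using carriers by (simp add: dim_algebra)
  finally show "K * (V0 * V0) = Gh * (Gh * K)" unfolding GhK .
qed

text \<open>An explicit right inverse. To solve \<open>x + L y + K V0 z = a\<close>, \<open>G x + L V1\<^sup>-\<^sup>1 y + K z = b\<close>, put
  \<open>u = L V1\<^sup>-\<^sup>1 y + K z\<close>. Then \<open>L y + K V0 z = Gh u\<close>, so \<open>x = a - Gh u\<close> and \<open>(I - G Gh) u = b - G a\<close>;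
  finally \<open>y = V1 E u\<close> and \<open>z = F u\<close>.\<close>

lemma pair_matrix_invertible: "invertible_mat (pair_matrix m 2 X1 K T1 V0)"
proof -
  let ?I1 = "(1\<^sub>m m + Gh * (H * G)) @\<^sub>r (- (V1 * (E * (H * G))))"
  let ?I2 = "(- (Gh * H)) @\<^sub>r (V1 * (E * H))"
  let ?I3 = "- (F * (H * G))" and ?I4 = "F * H"
  let ?P = "four_block_mat X1 (K * V0) (X1 * T1) K"
  have I: "?I1 \<in> carrier_mat (m + p) m" "?I2 \<in> carrier_mat (m + p) m"
    "?I3 \<in> carrier_mat (m - p) m" "?I4 \<in> carrier_mat (m - p) m"
    using carriers by (auto intro!: carrier_append_rows)
  have Gh_split: "Gh * Y = L * (V1 * (E * Y)) + K * (V0 * (F * Y))" if "dim_row Y = m" for Y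
    by (subst Gh_eigen) (use carriers that in \<open>simp add: dim_algebra\<close>)
  have split1: "L * (E * Y) + K * (F * Y) = Y" if Y: "dim_row Y = m" for Y
  proof -
    have "L * (E * Y) + K * (F * Y) = (L * E + K * F) * Y" using carriers Y by (simp add: dim_algebra)
    then show ?thesis unfolding LEKF using Y by (simp add: dim_algebra)
  qed
  have H': "H - G * (Gh * H) = 1\<^sub>m m" using H carriers by (simp add: dim_algebra)
  have V: "L * (V1i * (V1 * Y)) = L * Y" if "dim_row Y = p" for Y
  proof -
    have "V1i * (V1 * Y) = (V1i * V1) * Y" using carriers that by (simp add: dim_algebra)
    then show ?thesis unfolding V1i using that by (simp add: dim_algebra)
  qed
  have b11: "X1 * ?I1 + K * V0 * ?I3 = 1\<^sub>m m"
  proof -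
    have "X1 * ?I1 = 1\<^sub>m m * (1\<^sub>m m + Gh * (H * G)) + L * - (V1 * (E * (H * G)))"
      unfolding X1_def
      by (rule append_cols_mult_append_rows[of _ m m _ p _ m]) (use carriers in auto)
    also have "\<dots> = 1\<^sub>m m + Gh * (H * G) + - (L * (V1 * (E * (H * G))))"
      using carriers by (simp add: dim_algebra)
    finally have 1: "X1 * ?I1 = 1\<^sub>m m + Gh * (H * G) + - (L * (V1 * (E * (H * G))))" .
    have 2: "K * V0 * ?I3 = - (K * (V0 * (F * (H * G))))" using carriers by (simp add: dim_algebra)
    have 3: "Gh * (H * G) = L * (V1 * (E * (H * G))) + K * (V0 * (F * (H * G)))"
      by (rule Gh_split) (use carriers in simp)
    show ?thesis
      unfolding 1 unfolding 2 unfolding 3 using carriers by (intro eq_matI) (auto simp del: index_mult_mat(1))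
  qed
  have b12: "X1 * ?I2 + K * V0 * ?I4 = 0\<^sub>m m m"
  proof -
    have "X1 * ?I2 = 1\<^sub>m m * - (Gh * H) + L * (V1 * (E * H))"
      unfolding X1_def
      by (rule append_cols_mult_append_rows[of _ m m _ p _ m]) (use carriers in auto)
    also have "\<dots> = - (Gh * H) + L * (V1 * (E * H))" using carriers by (simp add: dim_algebra)
    finally have 1: "X1 * ?I2 = - (Gh * H) + L * (V1 * (E * H))" .
    have 2: "K * V0 * ?I4 = K * (V0 * (F * H))" using carriers by (simp add: dim_algebra)
    have 3: "Gh * H = L * (V1 * (E * H)) + K * (V0 * (F * H))"
      by (rule Gh_split) (use carriers in simp)
    show ?thesis
      unfolding 1 unfolding 2 unfolding 3 using carriers by (intro eq_matI) (auto simp del: index_mult_mat(1))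
  qed
  have b21: "X1 * T1 * ?I1 + K * ?I3 = 0\<^sub>m m m"
  proof -
    have "X1 * T1 * ?I1 = G * (1\<^sub>m m + Gh * (H * G)) + L * V1i * - (V1 * (E * (H * G)))"
      unfolding X1_T1
      by (rule append_cols_mult_append_rows[of _ m m _ p _ m]) (use carriers in auto)
    also have "\<dots> = G + G * (Gh * (H * G)) + - (L * (E * (H * G)))"
      using carriers by (simp add: dim_algebra V)
    finally have 1: "X1 * T1 * ?I1 = G + G * (Gh * (H * G)) + - (L * (E * (H * G)))" .
    have 2: "K * ?I3 = - (K * (F * (H * G)))" using carriers by (simp add: dim_algebra)
    have "G = (H - G * (Gh * H)) * G" unfolding H' using carriers by simp
    also have "\<dots> = H * G - G * (Gh * (H * G))" using carriers by (simp add: dim_algebra)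
    also have "H * G = L * (E * (H * G)) + K * (F * (H * G))"
      by (rule split1[symmetric]) (use carriers in simp)
    finally have 3: "G = L * (E * (H * G)) + K * (F * (H * G)) - G * (Gh * (H * G))" 
      using split1[of "H * G"] carriers by simp
    show ?thesis
      unfolding 1 unfolding 2
    proof (rule eq_matI)
      fix i j assume "i < dim_row (0\<^sub>m m m :: complex mat)" "j < dim_col (0\<^sub>m m m :: complex mat)"
      then have ij: "i < m" "j < m" by auto
      show "(G + G * (Gh * (H * G)) + - (L * (E * (H * G))) + - (K * (F * (H * G)))) $$ (i, j)
          = 0\<^sub>m m m $$ (i, j)"
        using arg_cong[OF 3, of "\<lambda>Z. Z $$ (i, j)"] carriers ij
        by (simp del: index_mult_mat(1))
    qed (use carriers in auto)
  qed
  have b22: "X1 * T1 * ?I2 + K * ?I4 = 1\<^sub>m m"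
  proof -
    have "X1 * T1 * ?I2 = G * - (Gh * H) + L * V1i * (V1 * (E * H))"
      unfolding X1_T1
      by (rule append_cols_mult_append_rows[of _ m m _ p _ m]) (use carriers in auto)
    also have "\<dots> = - (G * (Gh * H)) + L * (E * H)"
      using carriers by (simp add: dim_algebra V)
    finally have 1: "X1 * T1 * ?I2 = - (G * (Gh * H)) + L * (E * H)" .
    have 2: "H = L * (E * H) + K * (F * H)" by (rule split1[symmetric]) (use carriers in simp)
    show ?thesis
      unfolding 1 H'[symmetric]
    proof (rule eq_matI)
      fix i j assume "i < dim_row (H - G * (Gh * H))" "j < dim_col (H - G * (Gh * H))"
      then have ij: "i < m" "j < m" using carriers by auto
      show "(- (G * (Gh * H)) + L * (E * H) + K * (F * H)) $$ (i, j) = (H - G * (Gh * H)) $$ (i, j)"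
        using arg_cong[OF 2, of "\<lambda>Z. Z $$ (i, j)"] carriers ij
        by (simp del: index_mult_mat(1))
    qed (use carriers in auto)
  qed
  have "?P * four_block_mat ?I1 ?I2 ?I3 ?I4
      = four_block_mat (X1 * ?I1 + K * V0 * ?I3) (X1 * ?I2 + K * V0 * ?I4)
          (X1 * T1 * ?I1 + K * ?I3) (X1 * T1 * ?I2 + K * ?I4)"
    by (rule mult_four_block_mat[OF X1_carrier _ _ _ I]) (use carriers X1_carrier T1_carrier in auto)
  also have "\<dots> = four_block_mat (1\<^sub>m m) (0\<^sub>m m m) (0\<^sub>m m m) (1\<^sub>m m)"
    unfolding b11 b12 b21 b22 ..
  finally have inv: "?P * four_block_mat ?I1 ?I2 ?I3 ?I4 = 1\<^sub>m (m + m)" by simp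
  have "?P \<in> carrier_mat (m + m) (m + m)"
    using four_block_carrier_mat[OF X1_carrier vc(5)] p by simp
  moreover have "four_block_mat ?I1 ?I2 ?I3 ?I4 \<in> carrier_mat (m + m) (m + m)"
    using four_block_carrier_mat[OF I(1,4)] p by simp
  ultimately have "invertible_mat ?P" using inv by (rule invertible_matI)
  then show ?thesis
    unfolding pair_matrix_2[OF X1_carrier vc(5) T1_carrier vc(3) p] .
qed

text \<open>The conditions on the three column blocks are the equations of the solvent \<open>G\<close> and, twice, of
  the reversed solvent \<open>Gh\<close>.\<close>

lemma decomposable:
  "decomposable_pair m 2 ((!) [Am, B0, A1]) (m + p) (X1 @\<^sub>c K) (diag_block_mat [T1, V0])"
proof -
  have r: "m * 2 - (m + p) = m - p" by simp
  let ?Bs = "(!) [Am, B0, A1]"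
  have nth: "?Bs 0 = Am" "?Bs 1 = B0" "?Bs 2 = A1" by simp_all
  have Bc: "?Bs i \<in> carrier_mat m m" if "i \<le> 2" for i
    using that sq by (auto simp: le_Suc_eq numeral_2_eq_2)
  have s1: "mat_sum m (m + p) (\<lambda>i. ?Bs i * X1 * T1 ^\<^sub>m i) 2 = 0\<^sub>m m (m + p)"
  proof -
    have "mat_sum m (m + p) (\<lambda>i. ?Bs i * X1 * T1 ^\<^sub>m i) 2
      = Am * X1 * T1 ^\<^sub>m 0 + B0 * X1 * T1 ^\<^sub>m 1 + A1 * X1 * T1 ^\<^sub>m 2"
      by (subst mat_sum_2)
        (simp_all only: nth mult_carrier_mat[OF mult_carrier_mat[OF Bc X1_carrier] pow_carrier_mat[OF T1_carrier]])
    also have "\<dots> = Am * X1 + B0 * (X1 * T1) + A1 * (X1 * (T1 * T1))"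
      using X1_carrier T1_carrier sq by (simp add: dim_algebra numeral_2_eq_2)
    also have "\<dots> = ((Am + B0 * G) + A1 * (G * G)) @\<^sub>c
        ((Am * L + B0 * (L * V1i)) + A1 * (L * V1i * V1i))"
      unfolding X1_T1 X1_T1_T1 unfolding X1_def using carriers
      by (simp add: mult_append_cols[of _ m m _ m _ p] append_cols_add[of _ m m _ p])
    also have "Am * L + B0 * (L * V1i) + A1 * (L * V1i * V1i) = 0\<^sub>m m p"
      by (subst (1) L_descend(1), subst (1 2) L_descend(2), rule Gh_combination) (use carriers in auto)
    also have "Am + B0 * G + A1 * (G * G) = 0\<^sub>m m m" by (rule right_solvent_G)
    finally show ?thesis unfolding append_cols_def by (auto intro!: eq_matI)
  qed
  have s2: "mat_sum m (m - p) (\<lambda>i. ?Bs i * K * V0 ^\<^sub>m (2 - i)) 2 = 0\<^sub>m m (m - p)"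
  proof -
    have "mat_sum m (m - p) (\<lambda>i. ?Bs i * K * V0 ^\<^sub>m (2 - i)) 2
      = Am * K * V0 ^\<^sub>m (2 - 0) + B0 * K * V0 ^\<^sub>m (2 - 1) + A1 * K * V0 ^\<^sub>m (2 - 2)"
      by (subst mat_sum_2)
        (simp_all only: nth mult_carrier_mat[OF mult_carrier_mat[OF Bc vc(5)] pow_carrier_mat[OF vc(3)]])
    also have "\<dots> = Am * (K * (V0 * V0)) + B0 * (K * V0) + A1 * K"
      using carriers by (simp add: dim_algebra numeral_2_eq_2)
    also have "\<dots> = 0\<^sub>m m (m - p)" unfolding K_ascend by (rule Gh_combination) (rule vc)
    finally show ?thesis .
  qed
  show ?thesis
    unfolding decomposable_pair_def r
  proof (intro conjI exI)
    show "m + p \<le> m * 2" using p by simp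
  qed (rule X1_carrier T1_carrier vc pair_matrix_invertible s1 s2 refl)+
qed

text \<open>Multiplying out the blocks of \<open>X T(z)\<^sup>-\<^sup>1 Z\<close> leaves \<open>- (D1 + \<Gamma>) N\<close> with \<open>D1\<close> the inverse of
  \<open>z I - G\<close>. That this is a left inverse of \<open>\<eta>(z)\<close> is the resolvent identity, so where the pencil is
  invertible the polynomial is invertible too.\<close>

theorem resolvent_triple_qbd:
  assumes Z1: "Z1 = - N @\<^sub>r (- (E * - N))" and Z2: "Z2 = - (V0 * F * - N)"
  shows "resolvent_triple m 2 ((!) [Am, B0, A1]) (m + p) (X1 @\<^sub>c K) (diag_block_mat [T1, V0]) (Z1 @\<^sub>r Z2)"
proof -
  let ?Bs = "(!) [Am, B0, A1]" and ?T = "diag_block_mat [T1, V0]"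
  have Z1c: "Z1 \<in> carrier_mat (m + p) m" unfolding Z1 using carriers by (auto intro!: carrier_append_rows)
  have Z2c: "Z2 \<in> carrier_mat (m - p) m" unfolding Z2 using carriers by auto
  have Zc: "Z1 @\<^sub>r Z2 \<in> carrier_mat (m * 2) m"
    using carrier_append_rows[OF Z1c Z2c] p by (simp add: mult_2_right)
  have "mat_inv (matrix_poly m 2 ?Bs z) = (X1 @\<^sub>c K) * mat_inv (resolvent_pencil (m + p) ?T z) * (Z1 @\<^sub>r Z2)"
    if inv: "invertible_mat (resolvent_pencil (m + p) ?T z)" for z
  proof -
    let ?C1 = "z \<cdot>\<^sub>m 1\<^sub>m m - G" and ?C2 = "z \<cdot>\<^sub>m 1\<^sub>m p - V1i" and ?C3 = "z \<cdot>\<^sub>m V0 - 1\<^sub>m (m - p)"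
    let ?C = "four_block_mat ?C1 (0\<^sub>m m p) (0\<^sub>m p m) ?C2"
    have Cc: "?C1 \<in> carrier_mat m m" "?C2 \<in> carrier_mat p p" "?C3 \<in> carrier_mat (m - p) (m - p)"
      using carriers by (auto simp: minus_carrier_mat)
    then have Cc': "?C \<in> carrier_mat (m + p) (m + p)" by simp
    have C: "z \<cdot>\<^sub>m 1\<^sub>m (m + p) - T1 = ?C"
      unfolding T1_def using carriers by (intro eq_matI) auto
    have pencil: "resolvent_pencil (m + p) ?T z
        = four_block_mat ?C (0\<^sub>m (m + p) (m - p)) (0\<^sub>m (m - p) (m + p)) ?C3"
      unfolding resolvent_pencil_diag[OF T1_carrier vc(3)] C ..
    obtain CI D3 where CI: "CI \<in> carrier_mat (m + p) (m + p)" "?C * CI = 1\<^sub>m (m + p)" "CI * ?C = 1\<^sub>m (m + p)"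
      and D3: "D3 \<in> carrier_mat (m - p) (m - p)" "?C3 * D3 = 1\<^sub>m (m - p)" "D3 * ?C3 = 1\<^sub>m (m - p)"
      and inv3: "mat_inv (four_block_mat ?C (0\<^sub>m (m + p) (m - p)) (0\<^sub>m (m - p) (m + p)) ?C3)
        = four_block_mat CI (0\<^sub>m (m + p) (m - p)) (0\<^sub>m (m - p) (m + p)) D3"
      and invC: "invertible_mat ?C" "invertible_mat ?C3"
      by (rule invertible_diag[OF Cc' Cc(3) inv[unfolded pencil]])
    obtain D1 D2 where D1: "D1 \<in> carrier_mat m m" "?C1 * D1 = 1\<^sub>m m" "D1 * ?C1 = 1\<^sub>m m"
      and D2: "D2 \<in> carrier_mat p p" "?C2 * D2 = 1\<^sub>m p" "D2 * ?C2 = 1\<^sub>m p"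
      and invC': "mat_inv ?C = four_block_mat D1 (0\<^sub>m m p) (0\<^sub>m p m) D2"
        "invertible_mat ?C1" "invertible_mat ?C2"
      by (rule invertible_diag[OF Cc(1,2) invC(1)])
    have CI_eq: "CI = four_block_mat D1 (0\<^sub>m m p) (0\<^sub>m p m) D2"
      using mat_inv_eqI[OF Cc' CI(1,2)] invC'(1) by simp
    note cs = carriers D1(1) D2(1) D3(1)
    \<comment> \<open>the blocks of the resolvent that belong to \<open>L\<close> and \<open>K\<close> form \<open>Gh (I - z Gh)\<^sup>-\<^sup>1\<close>\<close>
    define \<Gamma> where "\<Gamma> = - (L * (D2 * E)) - K * (D3 * (V0 * F))"
    have \<Gamma>c: "\<Gamma> \<in> carrier_mat m m" unfolding \<Gamma>_def using cs by (auto simp: minus_carrier_mat)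
    have prod: "(X1 @\<^sub>c K) * mat_inv (resolvent_pencil (m + p) ?T z) * (Z1 @\<^sub>r Z2) = - ((D1 + \<Gamma>) * N)"
    proof -
      have 1: "X1 * CI = D1 @\<^sub>c (L * D2)"
      proof -
        have "X1 * CI = (1\<^sub>m m * D1) @\<^sub>c (L * D2)"
          unfolding X1_def CI_eq by (rule append_cols_mult_diag) (use cs in auto)
        then show ?thesis using cs by simp
      qed
      have 2: "(X1 @\<^sub>c K) * mat_inv (resolvent_pencil (m + p) ?T z) = (X1 * CI) @\<^sub>c (K * D3)"
        unfolding pencil inv3 by (rule append_cols_mult_diag[OF X1_carrier vc(5) CI(1) D3(1)])
      have c1: "D1 @\<^sub>c (L * D2) \<in> carrier_mat m (m + p)" "K * D3 \<in> carrier_mat m (m - p)" using cs by auto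
      have 3: "(X1 @\<^sub>c K) * mat_inv (resolvent_pencil (m + p) ?T z) * (Z1 @\<^sub>r Z2)
          = (D1 @\<^sub>c (L * D2)) * Z1 + (K * D3) * Z2"
        unfolding 2 unfolding 1 by (rule append_cols_mult_append_rows[OF c1 Z1c Z2c])
      have 4: "(D1 @\<^sub>c (L * D2)) * Z1 = D1 * - N + L * D2 * (- (E * - N))"
        unfolding Z1 by (rule append_cols_mult_append_rows[of _ m m _ p _ m]) (use cs in auto)
      have 5: "D1 * - N + L * D2 * (- (E * - N)) + K * D3 * (- (V0 * F * - N))
          = - (D1 * N) + L * (D2 * (E * N)) + K * (D3 * (V0 * (F * N)))"
        using cs by (simp add: dim_algebra)
      have 6: "(D1 + \<Gamma>) * N = D1 * N + (- (L * (D2 * (E * N))) - K * (D3 * (V0 * (F * N))))"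
        unfolding \<Gamma>_def using cs by (simp add: dim_algebra)
      show ?thesis
        unfolding 3 4 unfolding Z2 5 6 using cs by (intro eq_matI) (auto simp del: index_mult_mat(1))
    qed
    have EGh: "E * Gh = V1 * E" "F * Gh = V0 * F"
    proof -
      have "E * Gh = (E * L) * (V1 * E) + (E * K) * (V0 * F)"
        by (subst Gh_eigen) (use carriers in \<open>simp add: dim_algebra\<close>)
      then show "E * Gh = V1 * E" unfolding EL using carriers by simp
      have "F * Gh = (F * L) * (V1 * E) + (F * K) * (V0 * F)"
        by (subst Gh_eigen) (use carriers in \<open>simp add: dim_algebra\<close>)
      then show "F * Gh = V0 * F" unfolding EL using carriers by simp
    qed
    have D2': "D2 - z \<cdot>\<^sub>m (D2 * V1) = - V1"
    proof -
      have "V1 = D2 * ?C2 * V1" unfolding D2(3) using carriers by simp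
      also have "\<dots> = z \<cdot>\<^sub>m (D2 * V1) - D2 * (V1i * V1)" using cs by (simp add: dim_algebra)
      also have "\<dots> = z \<cdot>\<^sub>m (D2 * V1) - D2" unfolding V1i using cs by simp
      finally show ?thesis using cs by (auto simp: mat_eq_iff simp del: index_mult_mat(1))
    qed
    have D3': "D3 * V0 - z \<cdot>\<^sub>m (D3 * (V0 * V0)) = - V0"
    proof -
      have "V0 = D3 * ?C3 * V0" unfolding D3(3) using carriers by simp
      also have "\<dots> = z \<cdot>\<^sub>m (D3 * (V0 * V0)) - D3 * V0" using cs by (simp add: dim_algebra)
      finally show ?thesis using cs by (auto simp: mat_eq_iff simp del: index_mult_mat(1))
    qed
    have \<Gamma>_eq: "\<Gamma> - z \<cdot>\<^sub>m (\<Gamma> * Gh) = Gh"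
    proof -
      have GG: "\<Gamma> * Gh = - (L * (D2 * (V1 * E))) - K * (D3 * (V0 * (V0 * F)))"
      proof -
        have "\<Gamma> * Gh = - (L * (D2 * (E * Gh))) - K * (D3 * (V0 * (F * Gh)))"
          unfolding \<Gamma>_def using cs by (simp add: dim_algebra)
        then show ?thesis unfolding EGh .
      qed
      have "L * ((D2 - z \<cdot>\<^sub>m (D2 * V1)) * E) = L * (D2 * E) - z \<cdot>\<^sub>m (L * (D2 * (V1 * E)))"
        using cs by (simp add: dim_algebra)
      then have 1: "L * (D2 * E) - z \<cdot>\<^sub>m (L * (D2 * (V1 * E))) = - (L * (V1 * E))"
        unfolding D2' using cs by (simp add: dim_algebra)
      have "K * ((D3 * V0 - z \<cdot>\<^sub>m (D3 * (V0 * V0))) * F)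
          = K * (D3 * (V0 * F)) - z \<cdot>\<^sub>m (K * (D3 * (V0 * (V0 * F))))"
        using cs by (simp add: dim_algebra)
      then have 2: "K * (D3 * (V0 * F)) - z \<cdot>\<^sub>m (K * (D3 * (V0 * (V0 * F)))) = - (K * (V0 * F))"
        unfolding D3' using cs by (simp add: dim_algebra)
      have "\<Gamma> - z \<cdot>\<^sub>m (\<Gamma> * Gh) = L * (V1 * E) + K * (V0 * F)"
        unfolding GG unfolding \<Gamma>_def
      proof (rule eq_matI)
        fix i j assume "i < dim_row (L * (V1 * E) + K * (V0 * F))" "j < dim_col (L * (V1 * E) + K * (V0 * F))"
        then have ij: "i < m" "j < m" using carriers by auto
        have e1: "(L * (D2 * E)) $$ (i, j) = - (L * (V1 * E)) $$ (i, j) + z * (L * (D2 * (V1 * E))) $$ (i, j)"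
          using arg_cong[OF 1, of "\<lambda>Z. Z $$ (i, j)"] cs ij by (simp add: diff_eq_eq del: index_mult_mat(1))
        have e2: "(K * (D3 * (V0 * F))) $$ (i, j)
            = - (K * (V0 * F)) $$ (i, j) + z * (K * (D3 * (V0 * (V0 * F)))) $$ (i, j)"
          using arg_cong[OF 2, of "\<lambda>Z. Z $$ (i, j)"] cs ij by (simp add: diff_eq_eq del: index_mult_mat(1))
        show "(- (L * (D2 * E)) - K * (D3 * (V0 * F))
            - z \<cdot>\<^sub>m (- (L * (D2 * (V1 * E))) - K * (D3 * (V0 * (V0 * F))))) $$ (i, j)
            = (L * (V1 * E) + K * (V0 * F)) $$ (i, j)"
          using cs ij by (simp add: e1 e2 algebra_simps del: index_mult_mat(1))
      qed (use cs in auto)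
      then show ?thesis using Gh_eigen by simp
    qed
    have poly: "matrix_poly m 2 ?Bs z = D * G + z \<cdot>\<^sub>m (- (D + R * D * G)) + z ^ 2 \<cdot>\<^sub>m (R * D)"
    proof -
      have "matrix_poly m 2 ?Bs z = z ^ 0 \<cdot>\<^sub>m ?Bs 0 + z ^ 1 \<cdot>\<^sub>m ?Bs 1 + z ^ 2 \<cdot>\<^sub>m ?Bs 2"
        unfolding matrix_poly_def
        by (rule mat_sum_2) (use sq in \<open>auto simp: le_Suc_eq numeral_2_eq_2\<close>)
      also have "\<dots> = Am + z \<cdot>\<^sub>m B0 + z ^ 2 \<cdot>\<^sub>m A1"
        using sq by (intro eq_matI) auto
      finally show ?thesis by (simp only: fact(1-3))
    qed
    have pc: "matrix_poly m 2 ?Bs z \<in> carrier_mat m m"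
      by (simp add: matrix_poly_def mat_sum_def)
    have id: "((D1 + \<Gamma>) * N) * matrix_poly m 2 ?Bs z = - 1\<^sub>m m"
      unfolding poly
      by (rule resolvent_identity[OF sq(6,7,4,5,8,10) D1(1) \<Gamma>c D1(3) fact(4) N \<Gamma>_eq])
    have "(D1 + \<Gamma>) * N \<in> carrier_mat m m"
      by (rule mult_carrier_mat[OF add_carrier_mat[OF \<Gamma>c] sq(10)])
    then have Qc: "- ((D1 + \<Gamma>) * N) \<in> carrier_mat m m" by simp
    have "- ((D1 + \<Gamma>) * N) * matrix_poly m 2 ?Bs z = 1\<^sub>m m"
      using id pc cs \<Gamma>c by simp
    then have "matrix_poly m 2 ?Bs z * - ((D1 + \<Gamma>) * N) = 1\<^sub>m m"
      by (rule mat_mult_left_right_inverse[OF Qc pc])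
    then show ?thesis unfolding prod by (rule mat_inv_eqI[OF pc Qc])
  qed
  with decomposable Zc show ?thesis unfolding resolvent_triple_def by blast
qed

end

section \<open>Passage to the complex numbers\<close>

lemma cmat_arith:
  "A \<in> carrier_mat nr n \<Longrightarrow> B \<in> carrier_mat n nc \<Longrightarrow> cmat (A * B) = cmat A * cmat B"
  "A \<in> carrier_mat nr nc \<Longrightarrow> B \<in> carrier_mat nr nc \<Longrightarrow> cmat (A + B) = cmat A + cmat B"
  "A \<in> carrier_mat nr nc \<Longrightarrow> B \<in> carrier_mat nr nc \<Longrightarrow> cmat (A - B) = cmat A - cmat B"
  "cmat (- A) = - cmat A" "cmat (1\<^sub>m k) = 1\<^sub>m k" "cmat (0\<^sub>m nr nc) = 0\<^sub>m nr nc"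
  by (rule of_real_hom.mat_hom_mult) (auto intro!: eq_matI)

theorem theorem2:
  fixes m p :: nat
    and B Am A0 A1 G Gh R U W :: "real mat"
    and M J L K E F V1 V0 X1 X2 T1 T2 X T Z1 Z2 Z :: "complex mat"
  assumes m: "m \<ge> 1"
    and carrier: "B \<in> carrier_mat m m" "Am \<in> carrier_mat m m"
      "A0 \<in> carrier_mat m m" "A1 \<in> carrier_mat m m"
    and nonneg: "0\<^sub>m m m \<le> B" "0\<^sub>m m m \<le> Am" "0\<^sub>m m m \<le> A0" "0\<^sub>m m m \<le> A1"
    and stochastic: "stochastic_on (qbd_states m) (qbd_matrix m B Am A0 A1)"
    and irreducible_P: "irreducible_on (qbd_states m) (qbd_matrix m B Am A0 A1)"
    and irreducible_A: "irreducible_matrix m (Am + A0 + A1)"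
    and final: "dqbd_one_final_class m Am A0 A1"
    and G: "minimal_nonneg_solution m (\<lambda>Y. Am + (A0 - 1\<^sub>m m) * Y + A1 * Y ^\<^sub>m 2) G"
    and Gh: "minimal_nonneg_solution m (\<lambda>Y. A1 + (A0 - 1\<^sub>m m) * Y + Am * Y ^\<^sub>m 2) Gh"
    and R: "minimal_nonneg_solution m (\<lambda>Y. A1 + Y * (A0 - 1\<^sub>m m) + Y ^\<^sub>m 2 * Am) R"
    and U: "U = A0 + R * Am"
    and W: "W = qbd_W m G U R"
    and p: "p \<le> m"
    and M: "M \<in> carrier_mat m m" "invertible_mat M"
    and V1: "V1 \<in> carrier_mat p p" "invertible_mat V1"
    and V0: "V0 \<in> carrier_mat (m - p) (m - p)" "p < m \<longrightarrow> spectral_radius V0 = 0"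
    and J: "J = diag_block_mat [V1, V0]"
    and M_J: "cmat Gh * M = M * J"
    and LK: "L \<in> carrier_mat m p" "K \<in> carrier_mat m (m - p)" "M = L @\<^sub>c K"
    and EF: "E \<in> carrier_mat p m" "F \<in> carrier_mat (m - p) m" "mat_inv M = E @\<^sub>r F"
    and not_null_recurrent: "\<not> null_recurrent_chain (qbd_states m) (qbd_matrix m B Am A0 A1)"
    and X: "X1 = 1\<^sub>m m @\<^sub>c L" "X2 = K" "X = X1 @\<^sub>c X2"
    and T: "T1 = diag_block_mat [cmat G, mat_inv V1]" "T2 = V0" "T = diag_block_mat [T1, T2]"
    and Z: "Z1 = cmat W @\<^sub>r (- (E * cmat W))" "Z2 = - (V0 * F * cmat W)" "Z = Z1 @\<^sub>r Z2"
  shows "resolvent_triple m 2 ((!) [cmat Am, cmat (A0 - 1\<^sub>m m), cmat A1]) (m + p) X T Z"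
proof -
  have nn: "nonneg_mat m Am" "nonneg_mat m A0" "nonneg_mat m A1"
    using carrier nonneg by (simp_all add: nonneg_mat_def)
  obtain \<mu> v where mv: "0 < \<mu>" "\<And>i. i < m \<Longrightarrow> 0 < v i"
    "\<And>i. i < m \<Longrightarrow> mat_act m Am v i + \<mu> * mat_act m A0 v i + \<mu>\<^sup>2 * mat_act m A1 v i < \<mu> * v i"
    using strict_supersolution_if_not_null_recurrent[OF m nn stochastic irreducible_P irreducible_A not_null_recurrent] by blast
  obtain D S H N where c: "{D, S, H, N} \<subseteq> carrier_mat m m"
    and fact: "A1 = R * D" "Am = D * G" "A0 - 1\<^sub>m m = - (D + R * D * G)" "S * D = 1\<^sub>m m"
    and H: "(1\<^sub>m m - G * Gh) * H = 1\<^sub>m m"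
    and N: "N = S + G * N * R" "Gh * N = N * R" and WN: "qbd_W m G U R = - N"
    by (rule green_matrix[OF m nn G Gh R U mv])
  have sols: "G \<in> carrier_mat m m" "Gh \<in> carrier_mat m m" "R \<in> carrier_mat m m"
    using G Gh R by (auto simp: minimal_nonneg_solution_def)
  have DSHN: "D \<in> carrier_mat m m" "S \<in> carrier_mat m m" "H \<in> carrier_mat m m" "N \<in> carrier_mat m m"
    using c by auto
  have A0c: "A0 - 1\<^sub>m m \<in> carrier_mat m m" by (simp add: minus_carrier_mat)
  note rc = carrier sols DSHN A0c
  have hom_mult: "cmat (A * B) = cmat A * cmat B" if "A \<in> carrier_mat m m" "B \<in> carrier_mat m m" for A B
    by (rule cmat_arith(1)[OF that])
  note hom = hom_mult cmat_arith(2,3)[where nr = m and nc = m] cmat_arith(4-6)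
  obtain V1i where V1i: "V1i \<in> carrier_mat p p" "V1 * V1i = 1\<^sub>m p" "V1i * V1 = 1\<^sub>m p" "mat_inv V1 = V1i"
    by (rule invertible_matE[OF V1])
  obtain Mi where Mi: "Mi \<in> carrier_mat m m" "M * Mi = 1\<^sub>m m" "Mi * M = 1\<^sub>m m" "mat_inv M = Mi"
    by (rule invertible_matE[OF M])
  have Mi_EF: "Mi = E @\<^sub>r F" using Mi(4) EF(3) by simp
  have LEKF: "L * E + K * F = 1\<^sub>m m"
    using append_cols_mult_append_rows[OF LK(1,2) EF(1,2)] Mi(2) unfolding Mi_EF LK(3) by simp
  have "(E * M) @\<^sub>r (F * M) = 1\<^sub>m m"
    using append_rows_mult[OF EF(1,2) M(1)] Mi(3) unfolding Mi_EF by simp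
  also have "1\<^sub>m m = (1\<^sub>m p @\<^sub>c 0\<^sub>m p (m - p)) @\<^sub>r (0\<^sub>m (m - p) p @\<^sub>c (1\<^sub>m (m - p) :: complex mat))"
    using p by (intro eq_matI) (auto simp: append_rows_def append_cols_def)
  finally have EF_M: "(E * M) @\<^sub>r (F * M)
      = (1\<^sub>m p @\<^sub>c 0\<^sub>m p (m - p)) @\<^sub>r (0\<^sub>m (m - p) p @\<^sub>c 1\<^sub>m (m - p))" .
  have pm: "p + (m - p) = m" using p by simp
  have ec: "E * M \<in> carrier_mat p m" "F * M \<in> carrier_mat (m - p) m"
    "1\<^sub>m p @\<^sub>c 0\<^sub>m p (m - p) \<in> carrier_mat p m" "0\<^sub>m (m - p) p @\<^sub>c 1\<^sub>m (m - p) \<in> carrier_mat (m - p) m"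
    using EF M append_cols_carrier[OF one_carrier_mat zero_carrier_mat, of p "m - p"]
      append_cols_carrier[OF zero_carrier_mat one_carrier_mat, of "m - p" p] by (auto simp: pm)
  have "E * L @\<^sub>c E * K = 1\<^sub>m p @\<^sub>c 0\<^sub>m p (m - p)"
    using append_rows_eqD(1)[OF EF_M ec] mult_append_cols[OF EF(1) LK(1,2)] LK(3) by simp
  then have EL: "E * L = 1\<^sub>m p" "E * K = 0\<^sub>m p (m - p)"
    using append_cols_eqD[of "E * L" "E * K" "1\<^sub>m p" "0\<^sub>m p (m - p)" p p "m - p"] EF LK by auto
  have "F * L @\<^sub>c F * K = 0\<^sub>m (m - p) p @\<^sub>c 1\<^sub>m (m - p)"
    using append_rows_eqD(2)[OF EF_M ec] mult_append_cols[OF EF(2) LK(1,2)] LK(3) by simp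
  then have FL: "F * L = 0\<^sub>m (m - p) p" "F * K = 1\<^sub>m (m - p)"
    using append_cols_eqD[of "F * L" "F * K" "0\<^sub>m (m - p) p" "1\<^sub>m (m - p)" "m - p" p "m - p"] EF LK by auto
  have "cmat Gh * L @\<^sub>c cmat Gh * K = L * V1 @\<^sub>c K * V0"
  proof -
    have "cmat Gh * L @\<^sub>c cmat Gh * K = cmat Gh * M"
      unfolding LK(3) by (rule mult_append_cols[symmetric, OF _ LK(1,2)]) (use rc in simp)
    also have "\<dots> = (L @\<^sub>c K) * four_block_mat V1 (0\<^sub>m p (m - p)) (0\<^sub>m (m - p) p) V0"
      using M_J unfolding J LK(3) diag_block_mat_pair[OF V1(1) V0(1)] .
    also have "\<dots> = L * V1 @\<^sub>c K * V0" by (rule append_cols_mult_diag[OF LK(1,2) V1(1) V0(1)])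
    finally show ?thesis .
  qed
  then have GhLK: "cmat Gh * L = L * V1" "cmat Gh * K = K * V0"
    using append_cols_eqD[of "cmat Gh * L" "cmat Gh * K" "L * V1" "K * V0" m p "m - p"] LK V1(1) V0(1) rc by auto
  interpret sf: spectral_factorization m p "cmat Am" "cmat (A0 - 1\<^sub>m m)" "cmat A1" "cmat G" "cmat Gh"
    "cmat R" "cmat D" "cmat S" "cmat H" "cmat N" V1 V0 V1i L K E F
  proof
    show "cmat A1 = cmat R * cmat D" using fact(1) rc by (simp flip: hom)
    show "cmat Am = cmat D * cmat G" using fact(2) rc by (simp flip: hom)
    show "cmat (A0 - 1\<^sub>m m) = - (cmat D + cmat R * cmat D * cmat G)"
      unfolding fact(3) using rc by (simp add: hom)
    show "cmat S * cmat D = 1\<^sub>m m" using arg_cong[OF fact(4), of cmat] rc by (simp add: hom)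
    show "(1\<^sub>m m - cmat G * cmat Gh) * cmat H = 1\<^sub>m m"
      using arg_cong[OF H, of cmat] rc by (simp add: hom minus_carrier_mat)
    show "cmat N = cmat S + cmat G * cmat N * cmat R"
      using arg_cong[OF N(1), of cmat] rc by (simp add: hom)
    show "cmat Gh * cmat N = cmat N * cmat R" using arg_cong[OF N(2), of cmat] rc by (simp add: hom)
    have "A1 + (A0 - 1\<^sub>m m) * Gh + Am * (Gh * Gh) = 0\<^sub>m m m"
      using Gh rc by (simp add: minimal_nonneg_solution_def numeral_2_eq_2)
    from arg_cong[OF this, of cmat]
    show "cmat A1 + cmat (A0 - 1\<^sub>m m) * cmat Gh + cmat Am * (cmat Gh * cmat Gh) = 0\<^sub>m m m"
      using rc by (simp add: hom del: assoc_add_mat)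
  qed (use p rc V1 V1i V0 LK EF LEKF EL FL GhLK in simp_all)
  have X1_eq: "sf.X1 = X1" using X(1) by (simp add: sf.X1_def)
  have T1_eq: "sf.T1 = T1"
    unfolding T(1) V1i(4) sf.T1_def by (rule diag_block_mat_pair[symmetric]) (use rc V1i in auto)
  have W_eq: "cmat W = - cmat N" unfolding W WN by (rule cmat_arith(4))
  show ?thesis
    unfolding X(3) X(2) T(3) T(2) Z(3) X1_eq[symmetric] T1_eq[symmetric]
    by (rule sf.resolvent_triple_qbd) (simp_all only: Z W_eq)
qed

end
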